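(* Let $a,b$ be distributions over $[n]$, where Alice receives $\mathrm{Poi}(t)$ i.i.d. samples from $a$ and Bob receives $\mathrm{Poi}(t)$ i.i.d. samples from $b$, with $t\le n/\log^c n$ for some sufficiently large constant $c>1$. Then any (two-way) communication protocol that distinguishes between $a=b$ and $\|a-b\|_1\ge 1/2$ requires $\tilde\Omega(n^2/t^2)$ bits of communication.
   Context: "Distinguishes" means: outputs the correct answer with probability at least $2/3$ whenever $a=b$ or $\|a-b\|_1\ge 1/2$ (probability over the samples and the protocol's randomness). $\tilde\Omega$ hides polylogarithmic factors in $n$. *)

theory Defs
  imports "HOL-Probability.Probability"
begin

(* A deterministic two-way protocol tree in the sense of Yao.  At an Alice (Bob) node the
   respective party sends one bit depending on its own input; the first subtree is taken if
   that bit is True.  The output is determined by the leaf, hence by the transcript. *)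
datatype ('x, 'y) protocol =
    Output bool
  | Alice "'x \<Rightarrow> bool" "('x, 'y) protocol" "('x, 'y) protocol"
  | Bob "'y \<Rightarrow> bool" "('x, 'y) protocol" "('x, 'y) protocol"

primrec run :: "('x, 'y) protocol \<Rightarrow> 'x \<Rightarrow> 'y \<Rightarrow> bool" where
  "run (Output b) x y = b"
| "run (Alice f P Q) x y = (if f x then run P x y else run Q x y)"
| "run (Bob g P Q) x y = (if g y then run P x y else run Q x y)"

primrec comm_bits :: "('x, 'y) protocol \<Rightarrow> nat" where
  "comm_bits (Output b) = 0"
| "comm_bits (Alice f P Q) = Suc (max (comm_bits P) (comm_bits Q))"
| "comm_bits (Bob g P Q) = Suc (max (comm_bits P) (comm_bits Q))"

(* A randomized protocol is a probability distribution over deterministic ones.  This is the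
   public-coin model; private coins of either party are covered, since they can be drawn
   jointly in advance, Alice's node functions using only her coins and Bob's only his.
   M need not be discrete, so continuous or infinitely many coins are allowed; the sigma
   algebra only has to make the output on each fixed pair of inputs an event. *)
definition randomized_protocol :: "('x, 'y) protocol measure \<Rightarrow> bool" where
  "randomized_protocol M \<longleftrightarrow>
     prob_space M \<and> (\<forall>x y. (\<lambda>P. run P x y) \<in> M \<rightarrow>\<^sub>M count_space UNIV)"

definition uses_at_most_bits :: "('x, 'y) protocol measure \<Rightarrow> nat \<Rightarrow> bool" where
  "uses_at_most_bits M C \<longleftrightarrow> (\<forall>P \<in> space M. comm_bits P \<le> C)"

definition distribution_on :: "nat \<Rightarrow> nat pmf \<Rightarrow> bool" where
  "distribution_on n a \<longleftrightarrow> set_pmf a \<subseteq> {1..n}"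

definition l1_dist :: "nat \<Rightarrow> nat pmf \<Rightarrow> nat pmf \<Rightarrow> real" where
  "l1_dist n a b = (\<Sum>i = 1..n. \<bar>pmf a i - pmf b i\<bar>)"

definition poisson_samples :: "real \<Rightarrow> nat pmf \<Rightarrow> nat list pmf" where
  "poisson_samples t a = bind_pmf (poisson_pmf t) (\<lambda>N. replicate_pmf N a)"

definition output_prob ::
    "real \<Rightarrow> nat pmf \<Rightarrow> nat pmf \<Rightarrow> (nat list, nat list) protocol measure \<Rightarrow> bool \<Rightarrow> real" where
  "output_prob t a b M ans =
     measure (M \<Otimes>\<^sub>M measure_pmf (pair_pmf (poisson_samples t a) (poisson_samples t b)))
       {(P, x, y). P \<in> space M \<and> run P x y = ans}"

(* The answer True stands for a = b. *)
definition distinguishes ::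
    "nat \<Rightarrow> real \<Rightarrow> (nat list, nat list) protocol measure \<Rightarrow> bool" where
  "distinguishes n t M \<longleftrightarrow>
     (\<forall>a b. distribution_on n a \<longrightarrow> distribution_on n b \<longrightarrow>
        (a = b \<longrightarrow> output_prob t a b M True \<ge> 2/3) \<and>
        (l1_dist n a b \<ge> 1/2 \<longrightarrow> output_prob t a b M False \<ge> 2/3))"

end

theory Submission
  imports Defs "HOL-Combinatorics.Multiset_Permutations"
begin

text \<open>
  Fix small Poisson rates: an element is ``heavy'' (rate 1 for both parties) with probability
  \<open>\<theta> / 200\<close> and otherwise ``light'', with rates \<open>(\<theta>, \<theta>)\<close> or \<open>(0, 0)\<close> when \<open>a = b\<close>, and
  \<open>(\<theta>, 0)\<close> or \<open>(0, \<theta>)\<close> when \<open>a\<close> and \<open>b\<close> are far apart; here \<open>\<theta>\<close> is of order \<open>t / n\<close>.  Both parties'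
  marginals agree in the two cases, and the difference of the joint laws of the counts of one
  element is a multiple of \<open>(q - \<delta>\<^sub>0) \<otimes> (q - \<delta>\<^sub>0)\<close>.  The heavy elements dominate a product measure that
  masks this difference, so with public coins the counts are a function of bits \<open>(u, v)\<close> that are
  independent (far case) or have correlation \<open>\<epsilon> = 900 \<theta>\<close> (equal case).

  Telling correlation \<open>\<epsilon>\<close> from independence takes order \<open>1 / \<epsilon>\<^sup>2\<close> bits of interaction: the relative
  entropy of the two transcript laws is at most \<open>I(X; Y) - I(X; Y | \<Pi>)\<close>, and
  \<open>I(X; Y | \<Pi>) \<ge> \<Sum>\<^sub>i I(X\<^sub>i; Y\<^sub>i | \<Pi>, X\<^bsub>j<i\<^esub>, Y\<^bsub>j>i\<^esub>)\<close>.  Under this conditioning each pair \<open>(X\<^sub>i, Y\<^sub>i)\<close> has a law of the form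
  \<open>f(x) g(y) (1 + \<epsilon> x y)\<close>, for which the loss of information is at most \<open>O(\<epsilon>\<^sup>2)\<close> times the information
  revealed about \<open>X\<^sub>i\<close> given \<open>Y\<^sub>i\<close> and vice versa; the chain rule sums the latter to at most twice the
  number of bits.
\<close>

section \<open>Loss of mutual information under rectangular conditioning\<close>

text \<open>The heavy elements are forced. In the far case a light element is never sampled by both
  parties, so without heavy ones a single common sample would settle the question. Heavy elements
  produce common samples with weight of order \<theta> in both cases, against a signal of order
  \<theta>^2 from the light ones; the quotient of the two orders is the correlation \<epsilon>.
  Their share has a ceiling: heavy elements add the same rate to both parties, so their expected
  total m \<theta> / 200 must stay well below the light total, of order m \<theta>, or a and b would
  come too close. The constant 900 follows from this ceiling. Both q and the point mass at 0 lie
  below 3 Poi(1), so a product of the laws (q + point mass) / 2 taken with weight w fits under the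
  heavy part as soon as w / 4 is at most \<theta> / (200 * 9), that is w at most \<theta> / 450.
  Correlation \<epsilon> changes the mixture by the coefficient w \<epsilon> / 4, which has to match
  a difference of the two laws of size about \<theta>^2 / 2.\<close>

text \<open>The tangent bound \<open>ln z \<ge> 1 - 1 / z\<close> at z = q / r. Summed over two laws
  of equal mass it says that relative entropy is nonnegative; the pointwise form allows several
  logarithms to be combined under one sum before the masses are compared.\<close>

lemma gibbs_term:
  fixes q r :: real
  assumes "0 \<le> q" "0 \<le> r" "r = 0 \<Longrightarrow> q = 0"
  shows "q - r \<le> q * ln (q / r)"
proof (cases "q = 0")
  case False
  then have "0 < q" "0 < r" using assms by (auto simp: less_le)
  then have "1 - r / q \<le> ln (q / r)"
    using ln_ge_iff ln_le_minus_one[of "r / q"] by (simp add: ln_div)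
  then have "q * (1 - r / q) \<le> q * ln (q / r)"
    using \<open>0 < q\<close> by (intro mult_left_mono) auto
  then show ?thesis using \<open>0 < q\<close> by (simp add: algebra_simps)
qed (use assms in auto)

text \<open>Applying the tangent bound to the square root of t, instead of to t, leaves a square as
  remainder. This second-order gain is what later bounds revealed information from below.\<close>

lemma xlnx_ge_sqrt:
  fixes t :: real
  assumes "0 \<le> t"
  shows "t - 1 + (sqrt t - 1)\<^sup>2 \<le> t * ln t"
proof (cases "t = 0")
  case False
  define s where "s = sqrt t"
  have s: "0 < s" "t = s * s" using False assms by (auto simp: s_def)
  then have "1 - 1 / s \<le> ln s"
    using ln_le_minus_one[of "1 / s"] by (simp add: ln_div)
  then have "2 * t * (1 - 1 / s) \<le> 2 * t * ln s"
    using s by (intro mult_left_mono) auto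
  moreover have "2 * ln s = ln t"
    using s by (simp add: ln_mult)
  moreover have "2 * t * (1 - 1 / s) = t - 1 + (s - 1)\<^sup>2"
    using s by (simp add: power2_eq_square field_simps)
  ultimately show ?thesis by (simp add: s_def mult.assoc mult.left_commute[of 2])
qed simp

text \<open>For t up to 4 the square of \<open>sqrt t + 1\<close> is at most 9. The value 4 is the
  largest likelihood ratio that occurs for bits of correlation at most 1/2.\<close>

lemma xlnx_ge_quadratic:
  fixes t :: real
  assumes "0 \<le> t" "t \<le> 4"
  shows "t - 1 + (t - 1)\<^sup>2 / 9 \<le> t * ln t"
proof -
  have s: "0 \<le> sqrt t" "sqrt t \<le> 2"
    using assms real_sqrt_le_mono[of t 4] by auto
  have "(t - 1)\<^sup>2 = (sqrt t - 1)\<^sup>2 * (sqrt t + 1)\<^sup>2"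
    using assms by (simp flip: power_mult_distrib add: algebra_simps)
  also have "\<dots> \<le> (sqrt t - 1)\<^sup>2 * 3\<^sup>2"
    using s by (intro mult_left_mono power_mono) auto
  finally show ?thesis using xlnx_ge_sqrt[OF assms(1)] by simp
qed

text \<open>For weights of total mass Z this is Z times the mutual information of the normalised
  law. Averages over leaves or over conditioned coordinates thereby become plain sums.\<close>

definition mutual_info :: "'a set \<Rightarrow> 'b set \<Rightarrow> ('a \<Rightarrow> 'b \<Rightarrow> real) \<Rightarrow> real" where
  "mutual_info X Y q = (\<Sum>x\<in>X. \<Sum>y\<in>Y. q x y *
     ln (q x y * (\<Sum>x\<in>X. \<Sum>y\<in>Y. q x y) / ((\<Sum>y\<in>Y. q x y) * (\<Sum>x\<in>X. q x y))))"

text \<open>With \<open>q(x, y) = p(x, y) f(x) g(y)\<close> normalised, this is the relative entropy of the law of \<open>x\<close> given \<open>y\<close>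
  under \<open>q\<close> with respect to that under \<open>p\<close>, averaged over \<open>y\<close>.\<close>

definition cond_ent :: "'a set \<Rightarrow> 'b set \<Rightarrow> ('a \<Rightarrow> 'b \<Rightarrow> real) \<Rightarrow> ('a \<Rightarrow> real) \<Rightarrow> ('b \<Rightarrow> real) \<Rightarrow> real" where
  "cond_ent X Y p f g = (\<Sum>x\<in>X. \<Sum>y\<in>Y. p x y * f x * g y *
     ln (f x * (\<Sum>x\<in>X. p x y) / (\<Sum>x\<in>X. p x y * f x)))"

text \<open>This is \<open>I(X\<^sub>1X\<^sub>2; Y\<^sub>1Y\<^sub>2) \<ge> I(X\<^sub>1; Y\<^sub>1 | Y\<^sub>2) + I(X\<^sub>2; Y\<^sub>2 | X\<^sub>1)\<close>.  Conditioning on opposite coordinates is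
  what makes \<open>contracting\<close> tensorize: fixing \<open>Y\<^sub>2\<close> (or \<open>X\<^sub>1\<close>) leaves the other pair with a law of
  the same form \<open>p(x, y) f(x) g(y)\<close>.\<close>

lemma mutual_info_superadditive:
  fixes Q :: "'a \<Rightarrow> 'c \<Rightarrow> 'b \<Rightarrow> 'd \<Rightarrow> real"
  assumes fin: "finite X1" "finite X2" "finite Y1" "finite Y2"
    and nn: "\<And>x1 x2 y1 y2. x1 \<in> X1 \<Longrightarrow> x2 \<in> X2 \<Longrightarrow> y1 \<in> Y1 \<Longrightarrow> y2 \<in> Y2 \<Longrightarrow> 0 \<le> Q x1 x2 y1 y2"
  shows "(\<Sum>y2\<in>Y2. mutual_info X1 Y1 (\<lambda>x1 y1. \<Sum>x2\<in>X2. Q x1 x2 y1 y2)) +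
         (\<Sum>x1\<in>X1. mutual_info X2 Y2 (\<lambda>x2 y2. \<Sum>y1\<in>Y1. Q x1 x2 y1 y2))
       \<le> mutual_info (X1 \<times> X2) (Y1 \<times> Y2) (\<lambda>(x1, x2) (y1, y2). Q x1 x2 y1 y2)"
proof -
  define q1 where "q1 = (\<lambda>x1 y1 y2. \<Sum>x2\<in>X2. Q x1 x2 y1 y2)"
  define q2 where "q2 = (\<lambda>x1 x2 y2. \<Sum>y1\<in>Y1. Q x1 x2 y1 y2)"
  define a where "a = (\<lambda>x1 x2. \<Sum>y1\<in>Y1. \<Sum>y2\<in>Y2. Q x1 x2 y1 y2)"
  define b where "b = (\<lambda>y1 y2. \<Sum>x1\<in>X1. \<Sum>x2\<in>X2. Q x1 x2 y1 y2)"
  define c where "c = (\<lambda>x1 y2. \<Sum>x2\<in>X2. \<Sum>y1\<in>Y1. Q x1 x2 y1 y2)"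
  define d where "d = (\<lambda>x1. \<Sum>y2\<in>Y2. c x1 y2)"
  define e where "e = (\<lambda>y2. \<Sum>x1\<in>X1. c x1 y2)"
  define Z where "Z = (\<Sum>x1\<in>X1. \<Sum>y2\<in>Y2. c x1 y2)"
  \<comment> \<open>The pair (x1, y2) is summed outermost, since both conditional terms and
    \<open>c\<close> are organised around it.\<close>
  define S where "S = (\<lambda>h. \<Sum>x1\<in>X1. \<Sum>y2\<in>Y2. \<Sum>x2\<in>X2. \<Sum>y1\<in>Y1. (h x1 x2 y1 y2 :: real))"
  have reord: "(\<Sum>x1\<in>X1. \<Sum>x2\<in>X2. \<Sum>y1\<in>Y1. \<Sum>y2\<in>Y2. h x1 x2 y1 y2) = S h" for h
  proof -
    have "(\<Sum>x2\<in>X2. \<Sum>y1\<in>Y1. \<Sum>y2\<in>Y2. h x1 x2 y1 y2) = (\<Sum>y2\<in>Y2. \<Sum>x2\<in>X2. \<Sum>y1\<in>Y1. h x1 x2 y1 y2)" for x1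
    proof -
      have "(\<Sum>x2\<in>X2. \<Sum>y1\<in>Y1. \<Sum>y2\<in>Y2. h x1 x2 y1 y2) = (\<Sum>x2\<in>X2. \<Sum>y2\<in>Y2. \<Sum>y1\<in>Y1. h x1 x2 y1 y2)"
        by (intro sum.cong refl sum.swap)
      also have "\<dots> = (\<Sum>y2\<in>Y2. \<Sum>x2\<in>X2. \<Sum>y1\<in>Y1. h x1 x2 y1 y2)" by (rule sum.swap)
      finally show ?thesis .
    qed
    then show ?thesis by (simp add: S_def)
  qed
  have Z: "(\<Sum>x1\<in>X1. \<Sum>x2\<in>X2. \<Sum>y1\<in>Y1. \<Sum>y2\<in>Y2. Q x1 x2 y1 y2) = Z"
    unfolding reord by (simp add: S_def Z_def c_def)
  have M: "mutual_info (X1 \<times> X2) (Y1 \<times> Y2) (\<lambda>(x1, x2) (y1, y2). Q x1 x2 y1 y2)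
      = S (\<lambda>x1 x2 y1 y2. Q x1 x2 y1 y2 * ln (Q x1 x2 y1 y2 * Z / (a x1 x2 * b y1 y2)))"
    unfolding mutual_info_def reord[symmetric] Z[symmetric] a_def b_def
    by (simp add: sum.cartesian_product')
  have M1: "(\<Sum>y2\<in>Y2. mutual_info X1 Y1 (\<lambda>x1 y1. \<Sum>x2\<in>X2. Q x1 x2 y1 y2))
      = S (\<lambda>x1 x2 y1 y2. Q x1 x2 y1 y2 * ln (q1 x1 y1 y2 * e y2 / (c x1 y2 * b y1 y2)))"
  proof -
    have c': "(\<Sum>y1\<in>Y1. q1 x1 y1 y2) = c x1 y2" for x1 y2
      unfolding q1_def c_def by (rule sum.swap)
    have "(\<Sum>y2\<in>Y2. mutual_info X1 Y1 (\<lambda>x1 y1. q1 x1 y1 y2))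
       = (\<Sum>y2\<in>Y2. \<Sum>x1\<in>X1. \<Sum>y1\<in>Y1. q1 x1 y1 y2 * ln (q1 x1 y1 y2 * e y2 / (c x1 y2 * b y1 y2)))"
      unfolding mutual_info_def c' e_def by (simp add: b_def q1_def)
    also have "\<dots> = (\<Sum>x1\<in>X1. \<Sum>y2\<in>Y2. \<Sum>y1\<in>Y1. q1 x1 y1 y2 * ln (q1 x1 y1 y2 * e y2 / (c x1 y2 * b y1 y2)))"
      by (rule sum.swap)
    also have "\<dots> = S (\<lambda>x1 x2 y1 y2. Q x1 x2 y1 y2 * ln (q1 x1 y1 y2 * e y2 / (c x1 y2 * b y1 y2)))"
      unfolding S_def
    proof (intro sum.cong refl)
      fix x1 y2
      show "(\<Sum>y1\<in>Y1. q1 x1 y1 y2 * ln (q1 x1 y1 y2 * e y2 / (c x1 y2 * b y1 y2)))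
        = (\<Sum>x2\<in>X2. \<Sum>y1\<in>Y1. Q x1 x2 y1 y2 * ln (q1 x1 y1 y2 * e y2 / (c x1 y2 * b y1 y2)))"
        by (subst sum.swap) (simp add: q1_def sum_distrib_right)
    qed
    finally show ?thesis by (simp add: q1_def)
  qed
  have M2: "(\<Sum>x1\<in>X1. mutual_info X2 Y2 (\<lambda>x2 y2. \<Sum>y1\<in>Y1. Q x1 x2 y1 y2))
      = S (\<lambda>x1 x2 y1 y2. Q x1 x2 y1 y2 * ln (q2 x1 x2 y2 * d x1 / (a x1 x2 * c x1 y2)))"
  proof -
    have a': "(\<Sum>y2\<in>Y2. q2 x1 x2 y2) = a x1 x2" for x1 x2
      unfolding q2_def a_def by (rule sum.swap)
    have d': "(\<Sum>x2\<in>X2. a x1 x2) = d x1" for x1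
      unfolding a'[symmetric] q2_def d_def c_def by (rule sum.swap)
    have "(\<Sum>x1\<in>X1. mutual_info X2 Y2 (\<lambda>x2 y2. q2 x1 x2 y2))
       = (\<Sum>x1\<in>X1. \<Sum>x2\<in>X2. \<Sum>y2\<in>Y2. q2 x1 x2 y2 * ln (q2 x1 x2 y2 * d x1 / (a x1 x2 * c x1 y2)))"
      unfolding mutual_info_def a' d' by (simp add: c_def q2_def)
    also have "\<dots> = (\<Sum>x1\<in>X1. \<Sum>y2\<in>Y2. \<Sum>x2\<in>X2. q2 x1 x2 y2 * ln (q2 x1 x2 y2 * d x1 / (a x1 x2 * c x1 y2)))"
      by (intro sum.cong refl sum.swap)
    also have "\<dots> = S (\<lambda>x1 x2 y1 y2. Q x1 x2 y1 y2 * ln (q2 x1 x2 y2 * d x1 / (a x1 x2 * c x1 y2)))"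
      unfolding S_def by (intro sum.cong refl) (simp add: q2_def sum_distrib_right)
    finally show ?thesis by (simp add: q2_def)
  qed
  have nn': "0 \<le> c x1 y2" "0 \<le> d x1" "0 \<le> e y2" "0 \<le> Z" if "x1 \<in> X1" "y2 \<in> Y2" for x1 y2
    using that nn unfolding c_def d_def e_def Z_def by (auto intro!: sum_nonneg)
  \<comment> \<open>By the chain rule the excess of the right side over the left is
    \<open>I(X1; Y2) + I(X2; Y1 | X1 Y2)\<close>. The two subtracted terms here come from one Gibbs
    bound for each of these informations.\<close>
  have pw: "2 * Q x1 x2 y1 y2 - q1 x1 y1 y2 * q2 x1 x2 y2 / c x1 y2 - Q x1 x2 y1 y2 * (e y2 * d x1 / (Z * c x1 y2))
     \<le> Q x1 x2 y1 y2 * ln (Q x1 x2 y1 y2 * Z / (a x1 x2 * b y1 y2))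
       - Q x1 x2 y1 y2 * ln (q1 x1 y1 y2 * e y2 / (c x1 y2 * b y1 y2))
       - Q x1 x2 y1 y2 * ln (q2 x1 x2 y2 * d x1 / (a x1 x2 * c x1 y2))"
    if m: "x1 \<in> X1" "x2 \<in> X2" "y1 \<in> Y1" "y2 \<in> Y2" for x1 x2 y1 y2
  proof (cases "Q x1 x2 y1 y2 = 0")
    case True
    have "0 \<le> q1 x1 y1 y2 * q2 x1 x2 y2 / c x1 y2"
      using m nn unfolding q1_def q2_def c_def
      by (intro divide_nonneg_nonneg mult_nonneg_nonneg sum_nonneg) auto
    then show ?thesis using True by simp
  next
    case False
    let ?Q = "Q x1 x2 y1 y2"
    have Q: "0 < ?Q" using False nn[OF m] by simp
    have "?Q \<le> q1 x1 y1 y2" unfolding q1_def using m nn fin by (intro member_le_sum) auto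
    then have q1: "0 < q1 x1 y1 y2" using Q by simp
    have q2le: "?Q \<le> q2 x1 x2 y2" unfolding q2_def using m nn fin by (intro member_le_sum) auto
    then have q2: "0 < q2 x1 x2 y2" using Q by simp
    have "?Q \<le> (\<Sum>y2\<in>Y2. Q x1 x2 y1 y2)" using m nn fin by (intro member_le_sum) auto
    also have "\<dots> \<le> a x1 x2" unfolding a_def using m nn fin
      by (intro member_le_sum[where f = "\<lambda>y1. \<Sum>y2\<in>Y2. Q x1 x2 y1 y2"] sum_nonneg) auto
    finally have a: "0 < a x1 x2" using Q by simp
    have "?Q \<le> (\<Sum>x2\<in>X2. Q x1 x2 y1 y2)" using m nn fin by (intro member_le_sum) auto
    also have "\<dots> \<le> b y1 y2" unfolding b_def using m nn fin
      by (intro member_le_sum[where f = "\<lambda>x1. \<Sum>x2\<in>X2. Q x1 x2 y1 y2"] sum_nonneg) auto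
    finally have b: "0 < b y1 y2" using Q by simp
    have "q2 x1 x2 y2 \<le> c x1 y2" unfolding c_def q2_def using m nn fin
      by (intro member_le_sum[where f = "\<lambda>x2. \<Sum>y1\<in>Y1. Q x1 x2 y1 y2"] sum_nonneg) auto
    then have c: "0 < c x1 y2" using q2 by simp
    have cd: "c x1 y2 \<le> d x1" unfolding d_def using m nn' fin by (intro member_le_sum) auto
    then have d: "0 < d x1" using c by simp
    have "c x1 y2 \<le> e y2" unfolding e_def using m nn' fin
      by (intro member_le_sum[where f = "\<lambda>x1. c x1 y2"]) auto
    then have e: "0 < e y2" using c by simp
    have "d x1 \<le> Z" unfolding Z_def d_def using m nn' fin
      by (intro member_le_sum[where f = "\<lambda>x1. \<Sum>y2\<in>Y2. c x1 y2"] sum_nonneg) auto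
    then have Zp: "0 < Z" using d by simp
    have t1: "?Q - q1 x1 y1 y2 * q2 x1 x2 y2 / c x1 y2 \<le> ?Q * ln (?Q / (q1 x1 y1 y2 * q2 x1 x2 y2 / c x1 y2))"
      using Q q1 q2 c by (intro gibbs_term) auto
    have "1 - e y2 * d x1 / (Z * c x1 y2) \<le> ln (Z * c x1 y2 / (e y2 * d x1))"
      using gibbs_term[of 1 "e y2 * d x1 / (Z * c x1 y2)"] Zp c d e by auto
    then have t2: "?Q * (1 - e y2 * d x1 / (Z * c x1 y2)) \<le> ?Q * ln (Z * c x1 y2 / (e y2 * d x1))"
      using Q by (intro mult_left_mono) auto
    have "ln (?Q * Z / (a x1 x2 * b y1 y2)) - ln (q1 x1 y1 y2 * e y2 / (c x1 y2 * b y1 y2))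
        - ln (q2 x1 x2 y2 * d x1 / (a x1 x2 * c x1 y2))
        = ln (?Q / (q1 x1 y1 y2 * q2 x1 x2 y2 / c x1 y2)) + ln (Z * c x1 y2 / (e y2 * d x1))"
      using Q q1 q2 a b c d e Zp by (simp add: ln_div ln_mult)
    then have "?Q * ln (?Q * Z / (a x1 x2 * b y1 y2)) - ?Q * ln (q1 x1 y1 y2 * e y2 / (c x1 y2 * b y1 y2))
        - ?Q * ln (q2 x1 x2 y2 * d x1 / (a x1 x2 * c x1 y2))
        = ?Q * ln (?Q / (q1 x1 y1 y2 * q2 x1 x2 y2 / c x1 y2)) + ?Q * ln (Z * c x1 y2 / (e y2 * d x1))"
      by (simp only: right_diff_distrib[symmetric] distrib_left[symmetric])
    then show ?thesis using t1 t2 by (simp add: algebra_simps)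
  qed
  have s1: "S Q = Z" by (simp add: S_def Z_def c_def)
  have s2: "S (\<lambda>x1 x2 y1 y2. q1 x1 y1 y2 * q2 x1 x2 y2 / c x1 y2) = Z"
  proof -
    have "(\<Sum>x2\<in>X2. \<Sum>y1\<in>Y1. q1 x1 y1 y2 * q2 x1 x2 y2 / c x1 y2) = c x1 y2" for x1 y2
    proof -
      have "(\<Sum>x2\<in>X2. \<Sum>y1\<in>Y1. q1 x1 y1 y2 * q2 x1 x2 y2 / c x1 y2)
        = (\<Sum>x2\<in>X2. \<Sum>y1\<in>Y1. q2 x1 x2 y2 * q1 x1 y1 y2) / c x1 y2"
        by (simp add: sum_divide_distrib mult.commute)
      also have "\<dots> = (\<Sum>x2\<in>X2. q2 x1 x2 y2) * (\<Sum>y1\<in>Y1. q1 x1 y1 y2) / c x1 y2"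
        by (simp add: sum_product)
      also have "(\<Sum>y1\<in>Y1. q1 x1 y1 y2) = c x1 y2" unfolding q1_def c_def by (rule sum.swap)
      also have "(\<Sum>x2\<in>X2. q2 x1 x2 y2) = c x1 y2" by (simp add: q2_def c_def)
      finally show ?thesis by simp
    qed
    then show ?thesis by (simp add: S_def Z_def)
  qed
  \<comment> \<open>Only an inequality: cells with \<open>c x1 y2 = 0\<close> contribute 0 on the
    left, although \<open>e y2 * d x1\<close> may be positive there.\<close>
  have s3: "S (\<lambda>x1 x2 y1 y2. Q x1 x2 y1 y2 * (e y2 * d x1 / (Z * c x1 y2))) \<le> Z"
  proof -
    have "S (\<lambda>x1 x2 y1 y2. Q x1 x2 y1 y2 * (e y2 * d x1 / (Z * c x1 y2)))
      = (\<Sum>x1\<in>X1. \<Sum>y2\<in>Y2. c x1 y2 * (e y2 * d x1 / (Z * c x1 y2)))"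
      unfolding S_def c_def by (simp only: sum_distrib_right)
    also have "\<dots> \<le> (\<Sum>x1\<in>X1. \<Sum>y2\<in>Y2. e y2 * d x1 / Z)"
    proof (intro sum_mono)
      fix x1 y2 assume m: "x1 \<in> X1" "y2 \<in> Y2"
      have "0 \<le> e y2 * d x1 / Z" using nn'[OF m] by simp
      then show "c x1 y2 * (e y2 * d x1 / (Z * c x1 y2)) \<le> e y2 * d x1 / Z"
        by (cases "c x1 y2 = 0") auto
    qed
    also have "\<dots> = (\<Sum>y2\<in>Y2. e y2) * (\<Sum>x1\<in>X1. d x1) / Z"
      by (simp add: sum_product sum_divide_distrib sum.swap[of _ X1])
    also have "(\<Sum>x1\<in>X1. d x1) = Z" by (simp add: d_def Z_def)
    also have "(\<Sum>y2\<in>Y2. e y2) = Z" unfolding e_def Z_def by (rule sum.swap)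
    finally show ?thesis by simp
  qed
  have "0 \<le> 2 * S Q - S (\<lambda>x1 x2 y1 y2. q1 x1 y1 y2 * q2 x1 x2 y2 / c x1 y2)
     - S (\<lambda>x1 x2 y1 y2. Q x1 x2 y1 y2 * (e y2 * d x1 / (Z * c x1 y2)))"
    using s1 s2 s3 by simp
  also have "\<dots> = S (\<lambda>x1 x2 y1 y2. 2 * Q x1 x2 y1 y2 - q1 x1 y1 y2 * q2 x1 x2 y2 / c x1 y2
     - Q x1 x2 y1 y2 * (e y2 * d x1 / (Z * c x1 y2)))"
    unfolding S_def by (simp only: sum_subtractf sum_distrib_left)
  also have "\<dots> \<le> S (\<lambda>x1 x2 y1 y2. Q x1 x2 y1 y2 * ln (Q x1 x2 y1 y2 * Z / (a x1 x2 * b y1 y2))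
       - Q x1 x2 y1 y2 * ln (q1 x1 y1 y2 * e y2 / (c x1 y2 * b y1 y2))
       - Q x1 x2 y1 y2 * ln (q2 x1 x2 y2 * d x1 / (a x1 x2 * c x1 y2)))"
    unfolding S_def by (intro sum_mono pw)
  finally show ?thesis unfolding M M1 M2 S_def by (simp add: sum_subtractf)
qed

section \<open>Tensorization of the contraction inequality\<close>

text \<open>The reweightings f(x) g(y) are what conditioning on a transcript does to p. In the uses
  below J is the mutual information of p itself, so the left side is the information lost by the
  reweighting, and it is charged to what the reweighting reveals about x given y and about y given
  x.\<close>

definition contracting :: "'a set \<Rightarrow> 'b set \<Rightarrow> ('a \<Rightarrow> 'b \<Rightarrow> real) \<Rightarrow> real \<Rightarrow> real \<Rightarrow> bool" where
  "contracting X Y p J \<kappa> \<longleftrightarrow> (\<forall>f g. (\<forall>x\<in>X. 0 \<le> f x) \<longrightarrow> (\<forall>y\<in>Y. 0 \<le> g y) \<longrightarrow>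
     J * (\<Sum>x\<in>X. \<Sum>y\<in>Y. p x y * f x * g y) - mutual_info X Y (\<lambda>x y. p x y * f x * g y)
     \<le> \<kappa> * (cond_ent X Y p f g + cond_ent Y X (\<lambda>y x. p x y) g f))"

text \<open>The chain rule for relative entropy, with x1 revealed before x2. Under the reweighted
  law, x2 given (x1, y1, y2) has weights \<open>p2 x2 y2 * f (x1, x2)\<close>, free of y1. Hence the
  first summand freezes y2 and the second freezes x1, exactly as in
  \<open>mutual_info_superadditive\<close>.\<close>

lemma cond_ent_chain:
  assumes fin: "finite X1" "finite X2" "finite Y1" "finite Y2"
    and p1: "\<And>x y. x \<in> X1 \<Longrightarrow> y \<in> Y1 \<Longrightarrow> 0 < p1 x y"
    and p2: "\<And>x y. x \<in> X2 \<Longrightarrow> y \<in> Y2 \<Longrightarrow> 0 < p2 x y"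
    and f: "\<And>x1 x2. x1 \<in> X1 \<Longrightarrow> x2 \<in> X2 \<Longrightarrow> 0 \<le> f (x1, x2)"
    and g: "\<And>y1 y2. y1 \<in> Y1 \<Longrightarrow> y2 \<in> Y2 \<Longrightarrow> 0 \<le> g (y1, y2)"
  shows "cond_ent (X1 \<times> X2) (Y1 \<times> Y2) (\<lambda>(x1, x2) (y1, y2). p1 x1 y1 * p2 x2 y2) f g =
    (\<Sum>y2\<in>Y2. cond_ent X1 Y1 p1 (\<lambda>x1. \<Sum>x2\<in>X2. p2 x2 y2 * f (x1, x2)) (\<lambda>y1. g (y1, y2))) +
    (\<Sum>x1\<in>X1. cond_ent X2 Y2 p2 (\<lambda>x2. f (x1, x2)) (\<lambda>y2. \<Sum>y1\<in>Y1. p1 x1 y1 * g (y1, y2)))"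
proof -
  define v1 where "v1 = (\<lambda>y1. \<Sum>x1\<in>X1. p1 x1 y1)"
  define v2 where "v2 = (\<lambda>y2. \<Sum>x2\<in>X2. p2 x2 y2)"
  define F where "F = (\<lambda>x1 y2. \<Sum>x2\<in>X2. p2 x2 y2 * f (x1, x2))"
  define T where "T = (\<lambda>y1 y2. \<Sum>x1\<in>X1. p1 x1 y1 * F x1 y2)"
  define Q where "Q = (\<lambda>x1 x2 y1 y2. p1 x1 y1 * p2 x2 y2 * f (x1, x2) * g (y1, y2))"
  define S where "S = (\<lambda>h. \<Sum>x1\<in>X1. \<Sum>x2\<in>X2. \<Sum>y1\<in>Y1. \<Sum>y2\<in>Y2. (h x1 x2 y1 y2 :: real))"
  have v: "(\<Sum>x1\<in>X1. \<Sum>x2\<in>X2. p1 x1 y1 * p2 x2 y2) = v1 y1 * v2 y2" for y1 y2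
    by (simp add: v1_def v2_def sum_product)
  have T: "(\<Sum>x1\<in>X1. \<Sum>x2\<in>X2. p1 x1 y1 * p2 x2 y2 * f (x1, x2)) = T y1 y2" for y1 y2
    by (simp add: T_def F_def sum_distrib_left mult.assoc)
  have E: "cond_ent (X1 \<times> X2) (Y1 \<times> Y2) (\<lambda>(x1, x2) (y1, y2). p1 x1 y1 * p2 x2 y2) f g =
     S (\<lambda>x1 x2 y1 y2. Q x1 x2 y1 y2 * ln (f (x1, x2) * (v1 y1 * v2 y2) / T y1 y2))"
    unfolding cond_ent_def S_def Q_def v[symmetric] T[symmetric]
    by (simp add: sum.cartesian_product' case_prod_unfold)
  have E1: "(\<Sum>y2\<in>Y2. cond_ent X1 Y1 p1 (\<lambda>x1. F x1 y2) (\<lambda>y1. g (y1, y2))) =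
     S (\<lambda>x1 x2 y1 y2. Q x1 x2 y1 y2 * ln (F x1 y2 * v1 y1 / T y1 y2))"
  proof -
    have "(\<Sum>y2\<in>Y2. cond_ent X1 Y1 p1 (\<lambda>x1. F x1 y2) (\<lambda>y1. g (y1, y2)))
      = (\<Sum>y2\<in>Y2. \<Sum>x1\<in>X1. \<Sum>y1\<in>Y1. p1 x1 y1 * F x1 y2 * g (y1, y2) * ln (F x1 y2 * v1 y1 / T y1 y2))"
      unfolding cond_ent_def v1_def T_def by simp
    also have "\<dots> = (\<Sum>x1\<in>X1. \<Sum>y2\<in>Y2. \<Sum>y1\<in>Y1. p1 x1 y1 * F x1 y2 * g (y1, y2) * ln (F x1 y2 * v1 y1 / T y1 y2))"
      by (rule sum.swap)
    also have "\<dots> = (\<Sum>x1\<in>X1. \<Sum>y1\<in>Y1. \<Sum>y2\<in>Y2. p1 x1 y1 * F x1 y2 * g (y1, y2) * ln (F x1 y2 * v1 y1 / T y1 y2))"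
      by (intro sum.cong refl sum.swap)
    also have "\<dots> = (\<Sum>x1\<in>X1. \<Sum>y1\<in>Y1. \<Sum>y2\<in>Y2. \<Sum>x2\<in>X2. Q x1 x2 y1 y2 * ln (F x1 y2 * v1 y1 / T y1 y2))"
      by (intro sum.cong refl, subst (1) F_def)
         (simp add: Q_def sum_distrib_left sum_distrib_right mult_ac)
    also have "\<dots> = (\<Sum>x1\<in>X1. \<Sum>y1\<in>Y1. \<Sum>x2\<in>X2. \<Sum>y2\<in>Y2. Q x1 x2 y1 y2 * ln (F x1 y2 * v1 y1 / T y1 y2))"
      by (intro sum.cong refl sum.swap)
    also have "\<dots> = S (\<lambda>x1 x2 y1 y2. Q x1 x2 y1 y2 * ln (F x1 y2 * v1 y1 / T y1 y2))"
      unfolding S_def by (intro sum.cong refl sum.swap)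
    finally show ?thesis .
  qed
  have E2: "(\<Sum>x1\<in>X1. cond_ent X2 Y2 p2 (\<lambda>x2. f (x1, x2)) (\<lambda>y2. \<Sum>y1\<in>Y1. p1 x1 y1 * g (y1, y2))) =
     S (\<lambda>x1 x2 y1 y2. Q x1 x2 y1 y2 * ln (f (x1, x2) * v2 y2 / F x1 y2))"
  proof -
    have "(\<Sum>x1\<in>X1. cond_ent X2 Y2 p2 (\<lambda>x2. f (x1, x2)) (\<lambda>y2. \<Sum>y1\<in>Y1. p1 x1 y1 * g (y1, y2)))
      = (\<Sum>x1\<in>X1. \<Sum>x2\<in>X2. \<Sum>y2\<in>Y2. \<Sum>y1\<in>Y1. Q x1 x2 y1 y2 * ln (f (x1, x2) * v2 y2 / F x1 y2))"
      unfolding cond_ent_def v2_def F_def Q_def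
      by (simp add: sum_distrib_left sum_distrib_right mult_ac)
    also have "\<dots> = S (\<lambda>x1 x2 y1 y2. Q x1 x2 y1 y2 * ln (f (x1, x2) * v2 y2 / F x1 y2))"
      unfolding S_def by (intro sum.cong refl sum.swap)
    finally show ?thesis .
  qed
  have pw: "Q x1 x2 y1 y2 * ln (f (x1, x2) * (v1 y1 * v2 y2) / T y1 y2)
     = Q x1 x2 y1 y2 * ln (F x1 y2 * v1 y1 / T y1 y2) + Q x1 x2 y1 y2 * ln (f (x1, x2) * v2 y2 / F x1 y2)"
    if m: "x1 \<in> X1" "x2 \<in> X2" "y1 \<in> Y1" "y2 \<in> Y2" for x1 x2 y1 y2
  proof (cases "f (x1, x2) = 0")
    case False
    then have f0: "0 < f (x1, x2)" using f[of x1 x2] m by simp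
    have "0 < v1 y1" "0 < v2 y2"
      unfolding v1_def v2_def using fin m p1 p2 by (auto intro!: sum_pos)
    moreover have F: "0 \<le> F x1' y2" if "x1' \<in> X1" for x1'
      unfolding F_def using m that p2 f by (intro sum_nonneg mult_nonneg_nonneg) (auto intro: less_imp_le)
    moreover have "p2 x2 y2 * f (x1, x2) \<le> F x1 y2"
      unfolding F_def using fin m p2 f by (intro member_le_sum[where f = "\<lambda>x2. p2 x2 y2 * f (x1, x2)"])
        (auto intro!: mult_nonneg_nonneg intro: less_imp_le)
    then have F1: "0 < F x1 y2" using f0 p2[OF m(2,4)] by (smt (verit) mult_pos_pos)
    have "p1 x1 y1 * F x1 y2 \<le> T y1 y2"
      unfolding T_def using fin m p1 F by (intro member_le_sum[where f = "\<lambda>x1. p1 x1 y1 * F x1 y2"])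
        (auto intro!: mult_nonneg_nonneg intro: less_imp_le)
    then have "0 < T y1 y2" using F1 p1[OF m(1,3)] by (smt (verit) mult_pos_pos)
    ultimately have "ln (f (x1, x2) * (v1 y1 * v2 y2) / T y1 y2) = ln (F x1 y2 * v1 y1 / T y1 y2) + ln (f (x1, x2) * v2 y2 / F x1 y2)"
      using f0 F1 by (simp add: ln_mult ln_div)
    then show ?thesis by (simp add: distrib_left)
  qed (simp add: Q_def)
  have "S (\<lambda>x1 x2 y1 y2. Q x1 x2 y1 y2 * ln (f (x1, x2) * (v1 y1 * v2 y2) / T y1 y2)) =
     S (\<lambda>x1 x2 y1 y2. Q x1 x2 y1 y2 * ln (F x1 y2 * v1 y1 / T y1 y2) + Q x1 x2 y1 y2 * ln (f (x1, x2) * v2 y2 / F x1 y2))"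
    unfolding S_def by (intro sum.cong refl pw)
  then show ?thesis using E E1 E2 by (simp add: S_def sum.distrib F_def)
qed

text \<open>The same rule with the second coordinate revealed first. Bob's term is expanded in this
  order so that, like Alice's, it freezes y2 for the first pair and x1 for the second.\<close>

lemma cond_ent_chain_rev:
  assumes fin: "finite X1" "finite X2" "finite Y1" "finite Y2"
    and p1: "\<And>x y. x \<in> X1 \<Longrightarrow> y \<in> Y1 \<Longrightarrow> 0 < p1 x y"
    and p2: "\<And>x y. x \<in> X2 \<Longrightarrow> y \<in> Y2 \<Longrightarrow> 0 < p2 x y"
    and f: "\<And>x1 x2. x1 \<in> X1 \<Longrightarrow> x2 \<in> X2 \<Longrightarrow> 0 \<le> f (x1, x2)"
    and g: "\<And>y1 y2. y1 \<in> Y1 \<Longrightarrow> y2 \<in> Y2 \<Longrightarrow> 0 \<le> g (y1, y2)"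
  shows "cond_ent (X1 \<times> X2) (Y1 \<times> Y2) (\<lambda>(x1, x2) (y1, y2). p1 x1 y1 * p2 x2 y2) f g =
    (\<Sum>y1\<in>Y1. cond_ent X2 Y2 p2 (\<lambda>x2. \<Sum>x1\<in>X1. p1 x1 y1 * f (x1, x2)) (\<lambda>y2. g (y1, y2))) +
    (\<Sum>x2\<in>X2. cond_ent X1 Y1 p1 (\<lambda>x1. f (x1, x2)) (\<lambda>y1. \<Sum>y2\<in>Y2. p2 x2 y2 * g (y1, y2)))"
proof -
  have "cond_ent (X1 \<times> X2) (Y1 \<times> Y2) (\<lambda>(x1, x2) (y1, y2). p1 x1 y1 * p2 x2 y2) f g =
    cond_ent (X2 \<times> X1) (Y2 \<times> Y1) (\<lambda>(x2, x1) (y2, y1). p2 x2 y2 * p1 x1 y1) (\<lambda>(x2, x1). f (x1, x2)) (\<lambda>(y2, y1). g (y1, y2))"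
  proof -
    have sw: "(\<Sum>z\<in>A \<times> B. h z) = (\<Sum>z\<in>B \<times> A. h (prod.swap z))" for A B and h :: "_ \<Rightarrow> real"
      by (rule sum.reindex_bij_betw[symmetric, where h = prod.swap]) (auto intro!: bij_betwI[where g = prod.swap])
    show ?thesis unfolding cond_ent_def
      by (subst (1 2 3 4) sw) (simp add: case_prod_unfold mult_ac)
  qed
  also have "\<dots> = (\<Sum>y1\<in>Y1. cond_ent X2 Y2 p2 (\<lambda>x2. \<Sum>x1\<in>X1. p1 x1 y1 * f (x1, x2)) (\<lambda>y2. g (y1, y2))) +
    (\<Sum>x2\<in>X2. cond_ent X1 Y1 p1 (\<lambda>x1. f (x1, x2)) (\<lambda>y1. \<Sum>y2\<in>Y2. p2 x2 y2 * g (y1, y2)))"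
    by (subst cond_ent_chain) (use assms in auto)
  finally show ?thesis .
qed

text \<open>All four expansions freeze the same coordinates, so the two hypotheses can be applied
  slice by slice and summed. J adds up while \<kappa> is unchanged, which is why the final bound
  does not deteriorate with the number of elements.\<close>

lemma contracting_tensor:
  assumes fin: "finite X1" "finite X2" "finite Y1" "finite Y2"
    and p1: "\<And>x y. x \<in> X1 \<Longrightarrow> y \<in> Y1 \<Longrightarrow> 0 < p1 x y"
    and p2: "\<And>x y. x \<in> X2 \<Longrightarrow> y \<in> Y2 \<Longrightarrow> 0 < p2 x y"
    and c1: "contracting X1 Y1 p1 J1 \<kappa>" and c2: "contracting X2 Y2 p2 J2 \<kappa>"
  shows "contracting (X1 \<times> X2) (Y1 \<times> Y2) (\<lambda>(x1, x2) (y1, y2). p1 x1 y1 * p2 x2 y2) (J1 + J2) \<kappa>"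
  unfolding contracting_def
proof (intro allI impI)
  fix f g
  assume f: "\<forall>x\<in>X1 \<times> X2. 0 \<le> (f x :: real)" and g: "\<forall>y\<in>Y1 \<times> Y2. 0 \<le> (g y :: real)"
  let ?p = "\<lambda>(x1, x2) (y1, y2). p1 x1 y1 * p2 x2 y2"
  define F where "F = (\<lambda>y2 x1. \<Sum>x2\<in>X2. p2 x2 y2 * f (x1, x2))"
  define G where "G = (\<lambda>x1 y2. \<Sum>y1\<in>Y1. p1 x1 y1 * g (y1, y2))"
  define Q where "Q = (\<lambda>x1 x2 y1 y2. p1 x1 y1 * p2 x2 y2 * f (x1, x2) * g (y1, y2))"
  define Z where "Z = (\<Sum>x1\<in>X1. \<Sum>x2\<in>X2. \<Sum>y1\<in>Y1. \<Sum>y2\<in>Y2. Q x1 x2 y1 y2)"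
  have q1: "p1 x1 y1 * F y2 x1 * g (y1, y2) = (\<Sum>x2\<in>X2. Q x1 x2 y1 y2)" for x1 y1 y2
    by (simp add: F_def Q_def sum_distrib_left sum_distrib_right mult_ac)
  have q2: "p2 x2 y2 * f (x1, x2) * G x1 y2 = (\<Sum>y1\<in>Y1. Q x1 x2 y1 y2)" for x1 x2 y2
    by (simp add: G_def Q_def sum_distrib_left sum_distrib_right mult_ac)
  have F: "0 \<le> F y2 x1" if "y2 \<in> Y2" "x1 \<in> X1" for x1 y2
    unfolding F_def using that f p2 by (auto intro!: sum_nonneg mult_nonneg_nonneg intro: less_imp_le)
  have G: "0 \<le> G x1 y2" if "y2 \<in> Y2" "x1 \<in> X1" for x1 y2
    unfolding G_def using that g p1 by (auto intro!: sum_nonneg mult_nonneg_nonneg intro: less_imp_le)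
  have i1: "J1 * (\<Sum>x1\<in>X1. \<Sum>y1\<in>Y1. \<Sum>x2\<in>X2. Q x1 x2 y1 y2) - mutual_info X1 Y1 (\<lambda>x1 y1. \<Sum>x2\<in>X2. Q x1 x2 y1 y2)
     \<le> \<kappa> * (cond_ent X1 Y1 p1 (F y2) (\<lambda>y1. g (y1, y2)) + cond_ent Y1 X1 (\<lambda>y x. p1 x y) (\<lambda>y1. g (y1, y2)) (F y2))"
    if "y2 \<in> Y2" for y2
    using c1[unfolded contracting_def, rule_format, of "F y2" "\<lambda>y1. g (y1, y2)"] F g that
    unfolding q1 by auto
  have i2: "J2 * (\<Sum>x2\<in>X2. \<Sum>y2\<in>Y2. \<Sum>y1\<in>Y1. Q x1 x2 y1 y2) - mutual_info X2 Y2 (\<lambda>x2 y2. \<Sum>y1\<in>Y1. Q x1 x2 y1 y2)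
     \<le> \<kappa> * (cond_ent X2 Y2 p2 (\<lambda>x2. f (x1, x2)) (G x1) + cond_ent Y2 X2 (\<lambda>y x. p2 x y) (G x1) (\<lambda>x2. f (x1, x2)))"
    if "x1 \<in> X1" for x1
    using c2[unfolded contracting_def, rule_format, of "\<lambda>x2. f (x1, x2)" "G x1"] G f that
    unfolding q2 by auto
  have z1: "(\<Sum>y2\<in>Y2. \<Sum>x1\<in>X1. \<Sum>y1\<in>Y1. \<Sum>x2\<in>X2. Q x1 x2 y1 y2) = Z"
  proof -
    have "(\<Sum>y2\<in>Y2. \<Sum>x1\<in>X1. \<Sum>y1\<in>Y1. \<Sum>x2\<in>X2. Q x1 x2 y1 y2) = (\<Sum>x1\<in>X1. \<Sum>y2\<in>Y2. \<Sum>y1\<in>Y1. \<Sum>x2\<in>X2. Q x1 x2 y1 y2)"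
      by (rule sum.swap)
    also have "\<dots> = (\<Sum>x1\<in>X1. \<Sum>y1\<in>Y1. \<Sum>y2\<in>Y2. \<Sum>x2\<in>X2. Q x1 x2 y1 y2)"
      by (intro sum.cong refl sum.swap)
    also have "\<dots> = (\<Sum>x1\<in>X1. \<Sum>y1\<in>Y1. \<Sum>x2\<in>X2. \<Sum>y2\<in>Y2. Q x1 x2 y1 y2)"
      by (intro sum.cong refl sum.swap)
    also have "\<dots> = Z" unfolding Z_def
      by (intro sum.cong refl sum.swap)
    finally show ?thesis .
  qed
  have z2: "(\<Sum>x1\<in>X1. \<Sum>x2\<in>X2. \<Sum>y2\<in>Y2. \<Sum>y1\<in>Y1. Q x1 x2 y1 y2) = Z"
    unfolding Z_def by (intro sum.cong refl sum.swap)
  have Zp: "(\<Sum>x\<in>X1 \<times> X2. \<Sum>y\<in>Y1 \<times> Y2. ?p x y * f x * g y) = Z"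
    by (simp add: Z_def Q_def sum.cartesian_product' case_prod_unfold)
  have Qn: "0 \<le> Q x1 x2 y1 y2" if "x1 \<in> X1" "x2 \<in> X2" "y1 \<in> Y1" "y2 \<in> Y2" for x1 x2 y1 y2
    unfolding Q_def using that p1[of x1 y1] p2[of x2 y2] f g
    by (auto intro!: mult_nonneg_nonneg intro: less_imp_le)
  have mi: "mutual_info (X1 \<times> X2) (Y1 \<times> Y2) (\<lambda>x y. ?p x y * f x * g y)
     = mutual_info (X1 \<times> X2) (Y1 \<times> Y2) (\<lambda>(x1, x2) (y1, y2). Q x1 x2 y1 y2)"
    by (rule arg_cong[where f = "mutual_info (X1 \<times> X2) (Y1 \<times> Y2)"]) (auto simp: fun_eq_iff Q_def)
  have eA: "cond_ent (X1 \<times> X2) (Y1 \<times> Y2) ?p f g =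
    (\<Sum>y2\<in>Y2. cond_ent X1 Y1 p1 (F y2) (\<lambda>y1. g (y1, y2))) +
    (\<Sum>x1\<in>X1. cond_ent X2 Y2 p2 (\<lambda>x2. f (x1, x2)) (G x1))"
    unfolding F_def G_def using f g by (intro cond_ent_chain fin p1 p2) auto
  have pp: "(\<lambda>y x. ?p x y) = (\<lambda>(y1, y2) (x1, x2). p1 x1 y1 * p2 x2 y2)"
    by (auto simp: fun_eq_iff)
  have eB: "cond_ent (Y1 \<times> Y2) (X1 \<times> X2) (\<lambda>y x. ?p x y) g f =
    (\<Sum>x1\<in>X1. cond_ent Y2 X2 (\<lambda>y x. p2 x y) (G x1) (\<lambda>x2. f (x1, x2))) +
    (\<Sum>y2\<in>Y2. cond_ent Y1 X1 (\<lambda>y x. p1 x y) (\<lambda>y1. g (y1, y2)) (F y2))"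
    unfolding F_def G_def pp using f g p1 p2 by (intro cond_ent_chain_rev fin) auto
  have "(J1 + J2) * Z - mutual_info (X1 \<times> X2) (Y1 \<times> Y2) (\<lambda>(x1, x2) (y1, y2). Q x1 x2 y1 y2)
    \<le> (J1 + J2) * Z - ((\<Sum>y2\<in>Y2. mutual_info X1 Y1 (\<lambda>x1 y1. \<Sum>x2\<in>X2. Q x1 x2 y1 y2)) +
         (\<Sum>x1\<in>X1. mutual_info X2 Y2 (\<lambda>x2 y2. \<Sum>y1\<in>Y1. Q x1 x2 y1 y2)))"
    using mutual_info_superadditive[of X1 X2 Y1 Y2 Q] fin Qn by auto
  also have "\<dots> = (\<Sum>y2\<in>Y2. J1 * (\<Sum>x1\<in>X1. \<Sum>y1\<in>Y1. \<Sum>x2\<in>X2. Q x1 x2 y1 y2) - mutual_info X1 Y1 (\<lambda>x1 y1. \<Sum>x2\<in>X2. Q x1 x2 y1 y2))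
    + (\<Sum>x1\<in>X1. J2 * (\<Sum>x2\<in>X2. \<Sum>y2\<in>Y2. \<Sum>y1\<in>Y1. Q x1 x2 y1 y2) - mutual_info X2 Y2 (\<lambda>x2 y2. \<Sum>y1\<in>Y1. Q x1 x2 y1 y2))"
    by (simp only: sum_subtractf sum_distrib_left[symmetric] z1 z2) (simp add: algebra_simps)
  also have "\<dots> \<le> (\<Sum>y2\<in>Y2. \<kappa> * (cond_ent X1 Y1 p1 (F y2) (\<lambda>y1. g (y1, y2)) + cond_ent Y1 X1 (\<lambda>y x. p1 x y) (\<lambda>y1. g (y1, y2)) (F y2)))
    + (\<Sum>x1\<in>X1. \<kappa> * (cond_ent X2 Y2 p2 (\<lambda>x2. f (x1, x2)) (G x1) + cond_ent Y2 X2 (\<lambda>y x. p2 x y) (G x1) (\<lambda>x2. f (x1, x2))))"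
    by (intro add_mono sum_mono i1 i2)
  also have "\<dots> = \<kappa> * (cond_ent (X1 \<times> X2) (Y1 \<times> Y2) ?p f g + cond_ent (Y1 \<times> Y2) (X1 \<times> X2) (\<lambda>y x. ?p x y) g f)"
    unfolding eA eB by (simp add: sum_distrib_left sum.distrib algebra_simps)
  finally show "(J1 + J2) * (\<Sum>x\<in>X1 \<times> X2. \<Sum>y\<in>Y1 \<times> Y2. ?p x y * f x * g y) -
      mutual_info (X1 \<times> X2) (Y1 \<times> Y2) (\<lambda>x y. ?p x y * f x * g y)
    \<le> \<kappa> * (cond_ent (X1 \<times> X2) (Y1 \<times> Y2) ?p f g + cond_ent (Y1 \<times> Y2) (X1 \<times> X2) (\<lambda>y x. ?p x y) g f)"
    unfolding Zp mi .
qed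

section \<open>Correlated bits\<close>

abbreviation sg :: "bool \<Rightarrow> real" where "sg b \<equiv> (if b then 1 else -1)"

definition corr :: "real \<Rightarrow> bool \<Rightarrow> bool \<Rightarrow> real" where
  "corr \<epsilon> x y = (1 + \<epsilon> * sg x * sg y) / 4"

text \<open>The mutual information, in nats, of two uniform bits with law
  \<open>corr \<epsilon>\<close>.\<close>

definition bit_info :: "real \<Rightarrow> real" where
  "bit_info \<epsilon> = ((1 + \<epsilon>) * ln (1 + \<epsilon>) + (1 - \<epsilon>) * ln (1 - \<epsilon>)) / 2"

lemma corr_sym: "corr \<epsilon> x y = corr \<epsilon> y x"
  by (auto simp: corr_def)

text \<open>Parametrises a reweighting by its mass F and its bias a. Both sides of the contraction
  inequality for bits will be compared with F G (a^2 + b^2).\<close>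

lemma bool_fun_affine:
  fixes f :: "bool \<Rightarrow> real"
  assumes "\<And>x. 0 \<le> f x"
  obtains F a where "0 \<le> F" "\<bar>a\<bar> \<le> 1" "f = (\<lambda>x. F * (1 + a * sg x))"
proof (cases "f True + f False = 0")
  case True
  then have "f True = 0" "f False = 0"
    using assms[of True] assms[of False] by auto
  then have "f = (\<lambda>x. 0 * (1 + 0 * sg x))" by (simp add: fun_eq_iff all_bool_eq)
  then show thesis by (intro that[of 0 0]) auto
next
  case False
  then have p: "0 < f True + f False"
    using assms[of True] assms[of False] by linarith
  show thesis
    using p assms[of True] assms[of False]
    by (intro that[of "(f True + f False) / 2" "(f True - f False) / (f True + f False)"])
       (auto simp: fun_eq_iff all_bool_eq field_simps)
qed

text \<open>A reweighting of bias a reveals information of order a^2, even after conditioning on a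
  correlated y: since \<epsilon> is at most 1/2, y predicts x too poorly to absorb the bias.\<close>

lemma cond_ent_bits_ge:
  assumes e: "0 \<le> \<epsilon>" "\<epsilon> \<le> 1 / 2" and F: "0 \<le> F" and a: "\<bar>a\<bar> \<le> 1"
    and g: "\<And>y. 0 \<le> g y"
  shows "F * a\<^sup>2 / 36 * (g True + g False) \<le> cond_ent UNIV UNIV (corr \<epsilon>) (\<lambda>x. F * (1 + a * sg x)) g"
proof (cases "F = 0")
  case True
  then show ?thesis by (simp add: cond_ent_def)
next
  case False
  then have F: "0 < F" using F by simp
  let ?f = "\<lambda>x. F * (1 + a * sg x)"
  have ea: "\<bar>\<epsilon> * a\<bar> \<le> 1 / 2"
    using e a mult_mono[of \<epsilon> "1/2" "\<bar>a\<bar>" 1] by (simp add: abs_mult)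
  have s1: "(\<Sum>x\<in>UNIV. corr \<epsilon> x y) = 1 / 2" for y
    by (simp add: UNIV_bool corr_def field_simps)
  have s2: "(\<Sum>x\<in>UNIV. corr \<epsilon> x y * ?f x) = F * (1 + \<epsilon> * a * sg y) / 2" for y
    by (simp add: UNIV_bool corr_def field_simps)
  have term_ge: "F * g y * corr \<epsilon> x y * (a * sg x - \<epsilon> * a * sg y + 2 / 27 * (a * sg x - \<epsilon> * a * sg y)\<^sup>2)
     \<le> corr \<epsilon> x y * ?f x * g y * ln (?f x * (1 / 2) / (F * (1 + \<epsilon> * a * sg y) / 2))" for x y
  proof -
    define w where "w = 1 + \<epsilon> * a * sg y"
    define t where "t = (1 + a * sg x) / w"
    have w: "1 / 2 \<le> w" "w \<le> 3 / 2" using ea by (auto simp: w_def)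
    have t0: "0 \<le> t" using w a by (auto simp: t_def)
    have "1 + a * sg x \<le> 4 * w" using w a by (auto simp: abs_le_iff)
    then have t4: "t \<le> 4" using w by (simp add: t_def divide_simps)
    have wt: "w * (t - 1) = a * sg x - \<epsilon> * a * sg y"
      using w by (simp add: t_def w_def field_simps)
    \<comment> \<open>Because w is at most 3/2, the quadratic gain 1/9 in \<open>t - 1\<close>
      becomes (1/9) / (3/2) = 2/27 in \<open>w * (t - 1)\<close>.\<close>
    have "2 / 27 * (a * sg x - \<epsilon> * a * sg y)\<^sup>2 \<le> w * ((t - 1)\<^sup>2 / 9)"
    proof -
      have "(a * sg x - \<epsilon> * a * sg y)\<^sup>2 = w * w * (t - 1)\<^sup>2"
        unfolding wt[symmetric] by (simp add: power2_eq_square)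
      moreover have "w * (w * (t - 1)\<^sup>2) \<le> 3 / 2 * (w * (t - 1)\<^sup>2)"
        using w by (intro mult_right_mono) auto
      ultimately show ?thesis by simp
    qed
    moreover have "w * (t - 1 + (t - 1)\<^sup>2 / 9) \<le> w * (t * ln t)"
      using w xlnx_ge_quadratic[OF t0 t4] by (intro mult_left_mono) auto
    ultimately have "a * sg x - \<epsilon> * a * sg y + 2 / 27 * (a * sg x - \<epsilon> * a * sg y)\<^sup>2 \<le> w * (t * ln t)"
      using wt by (simp add: distrib_left)
    moreover have "0 \<le> F * g y * corr \<epsilon> x y"
      using F g[of y] e by (auto simp: corr_def)
    ultimately have "F * g y * corr \<epsilon> x y * (a * sg x - \<epsilon> * a * sg y + 2 / 27 * (a * sg x - \<epsilon> * a * sg y)\<^sup>2)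
       \<le> F * g y * corr \<epsilon> x y * (w * (t * ln t))"
      by (rule mult_left_mono)
    moreover have "?f x * (1 / 2) / (F * (1 + \<epsilon> * a * sg y) / 2) = t"
      using F by (simp add: t_def w_def)
    moreover have "w * t = 1 + a * sg x" using w by (simp add: t_def)
    then have "F * g y * corr \<epsilon> x y * (w * (t * ln t)) = corr \<epsilon> x y * ?f x * g y * ln t"
      by (metis (no_types, opaque_lifting) mult.assoc mult.commute)
    ultimately show ?thesis by simp
  qed
  \<comment> \<open>Given y, the sign of x has mean \<open>\<epsilon> * sg y\<close>. So the linear
    part averages to 0 and its square to
    \<open>a\<^sup>2 * (1 - \<epsilon>\<^sup>2)\<close>.\<close>
  have eq: "(\<Sum>x\<in>UNIV. \<Sum>y\<in>UNIV. F * g y * corr \<epsilon> x y * (a * sg x - \<epsilon> * a * sg y + 2 / 27 * (a * sg x - \<epsilon> * a * sg y)\<^sup>2))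
    = F * a\<^sup>2 * (1 - \<epsilon>\<^sup>2) / 27 * (g True + g False)"
    by (simp add: UNIV_bool corr_def power2_eq_square field_simps)
  have "F * a\<^sup>2 / 36 * (g True + g False) \<le> F * a\<^sup>2 * (1 - \<epsilon>\<^sup>2) / 27 * (g True + g False)"
  proof (rule mult_right_mono)
    have "\<epsilon>\<^sup>2 \<le> (1/2)\<^sup>2" using e by (intro power_mono) auto
    then have "3 / 4 \<le> 1 - \<epsilon>\<^sup>2" by (simp add: power2_eq_square)
    then have "(F * a\<^sup>2) * (3 / 4) \<le> (F * a\<^sup>2) * (1 - \<epsilon>\<^sup>2)" using F by (intro mult_left_mono) auto
    then show "F * a\<^sup>2 / 36 \<le> F * a\<^sup>2 * (1 - \<epsilon>\<^sup>2) / 27" by simp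
  qed (use g[of True] g[of False] in auto)
  also note eq[symmetric]
  also have "(\<Sum>x\<in>UNIV. \<Sum>y\<in>UNIV. F * g y * corr \<epsilon> x y * (a * sg x - \<epsilon> * a * sg y + 2 / 27 * (a * sg x - \<epsilon> * a * sg y)\<^sup>2))
     \<le> cond_ent UNIV UNIV (corr \<epsilon>) ?f g"
    unfolding cond_ent_def s1 s2 by (intro sum_mono term_ge)
  finally show ?thesis .
qed

text \<open>In the logarithm the factors f and g cancel against the marginals, leaving
  \<open>1 + \<epsilon> * a * b\<close>, \<open>1 + \<epsilon> * sg x * sg y\<close> and two
  correction factors for the shifted marginals. The loss has no term of first order in \<epsilon>:
  the contributions to the coefficient of \<open>a * b\<close> cancel up to order
  \<epsilon>^2.\<close>

lemma mutual_info_bits_ge: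
  assumes e: "0 \<le> \<epsilon>" "\<epsilon> \<le> 1 / 2" and F: "0 \<le> F" and a: "\<bar>a\<bar> \<le> 1" and G: "0 \<le> G" and b: "\<bar>b\<bar> \<le> 1"
  defines "q \<equiv> (\<lambda>x y. corr \<epsilon> x y * (F * (1 + a * sg x)) * (G * (1 + b * sg y)))"
  shows "bit_info \<epsilon> * (\<Sum>x\<in>UNIV. \<Sum>y\<in>UNIV. q x y) - mutual_info UNIV UNIV q
     \<le> 3 / 2 * \<epsilon>\<^sup>2 * (F * G * (a\<^sup>2 + b\<^sup>2))"
proof (cases "F * G = 0")
  case True
  then have "q = (\<lambda>x y. 0)" unfolding q_def by (auto simp: fun_eq_iff)
  then show ?thesis using True by (auto simp: mutual_info_def)
next
  case False
  then have FG: "0 < F" "0 < G" using F G by auto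
  have ea: "\<bar>\<epsilon> * a\<bar> \<le> 1 / 2" and eb: "\<bar>\<epsilon> * b\<bar> \<le> 1 / 2"
    using e a b mult_mono[of \<epsilon> "1/2" "\<bar>a\<bar>" 1] mult_mono[of \<epsilon> "1/2" "\<bar>b\<bar>" 1] by (auto simp: abs_mult)
  have "\<bar>\<epsilon> * a * b\<bar> \<le> 1 / 2"
    using ea b mult_mono[of "\<bar>\<epsilon> * a\<bar>" "1/2" "\<bar>b\<bar>" 1] by (simp add: abs_mult)
  then have zp: "0 < 1 + \<epsilon> * a * b" by linarith
  have Z: "(\<Sum>x\<in>UNIV. \<Sum>y\<in>UNIV. q x y) = F * G * (1 + \<epsilon> * a * b)"
    by (simp add: UNIV_bool corr_def q_def field_simps)
  have qx: "(\<Sum>y\<in>UNIV. q x y) = F * G * ((1 + a * sg x) * (1 + \<epsilon> * b * sg x)) / 2" for x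
    by (simp add: UNIV_bool corr_def q_def field_simps)
  have Zx: "(\<Sum>x\<in>UNIV. F * G * ((1 + a * sg x) * (1 + \<epsilon> * b * sg x)) / 2) = F * G * (1 + \<epsilon> * a * b)"
    by (simp add: UNIV_bool field_simps)
  have qy: "(\<Sum>x\<in>UNIV. q x y) = F * G * ((1 + b * sg y) * (1 + \<epsilon> * a * sg y)) / 2" for y
    by (simp add: UNIV_bool corr_def q_def field_simps)
  have qn: "0 \<le> q x y" for x y
    using e a b FG by (auto simp: q_def corr_def)
  have t: "q x y * (ln (1 + \<epsilon> * a * b) + ln (1 + \<epsilon> * sg x * sg y) - \<epsilon> * b * sg x - \<epsilon> * a * sg y)
      \<le> q x y * ln (q x y * (F * G * (1 + \<epsilon> * a * b)) /
         ((F * G * ((1 + a * sg x) * (1 + \<epsilon> * b * sg x)) / 2) * (F * G * ((1 + b * sg y) * (1 + \<epsilon> * a * sg y)) / 2)))"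
    for x y
  proof (cases "q x y = 0")
    case False
    define A where "A = 1 + a * sg x"
    define B where "B = 1 + b * sg y"
    have AB: "0 < A" "0 < B" using False a b by (auto simp: A_def B_def q_def abs_le_iff less_le split: if_splits)
    have p: "0 < 1 + \<epsilon> * sg x * sg y" "0 < 1 + \<epsilon> * b * sg x" "0 < 1 + \<epsilon> * a * sg y"
      using e ea eb by (auto simp: abs_le_iff)
    have "q x y * (F * G * (1 + \<epsilon> * a * b)) /
         ((F * G * (A * (1 + \<epsilon> * b * sg x)) / 2) * (F * G * (B * (1 + \<epsilon> * a * sg y)) / 2))
      = (1 + \<epsilon> * a * b) * (1 + \<epsilon> * sg x * sg y) / ((1 + \<epsilon> * b * sg x) * (1 + \<epsilon> * a * sg y))"
    proof -
      have canc: "P / 4 * (F * A) * (G * B) * (F * G * z) / ((F * G * (A * R) / 2) * (F * G * (B * S) / 2)) = z * P / (R * S)"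
        if "0 < R" "0 < S" for P z R S :: real
        using FG AB that by (simp add: field_simps)
      show ?thesis unfolding q_def corr_def A_def[symmetric] B_def[symmetric]
        by (rule canc) (use p in auto)
    qed
    then have "ln (q x y * (F * G * (1 + \<epsilon> * a * b)) /
         ((F * G * (A * (1 + \<epsilon> * b * sg x)) / 2) * (F * G * (B * (1 + \<epsilon> * a * sg y)) / 2)))
       = ln (1 + \<epsilon> * a * b) + ln (1 + \<epsilon> * sg x * sg y) - ln (1 + \<epsilon> * b * sg x) - ln (1 + \<epsilon> * a * sg y)"
      using zp p by (simp add: ln_div ln_mult)
    moreover have "ln (1 + \<epsilon> * b * sg x) \<le> \<epsilon> * b * sg x" "ln (1 + \<epsilon> * a * sg y) \<le> \<epsilon> * a * sg y"
      using p ln_le_minus_one[of "1 + \<epsilon> * b * sg x"] ln_le_minus_one[of "1 + \<epsilon> * a * sg y"] by auto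
    ultimately show ?thesis
      unfolding A_def[symmetric] B_def[symmetric] using qn[of x y] by (intro mult_left_mono) auto
  qed simp
  define l1 where "l1 = ln (1 + \<epsilon>)"
  define l2 where "l2 = ln (1 - \<epsilon>)"
  have l1: "l1 \<le> \<epsilon>" "\<epsilon> \<le> l1 * (1 + \<epsilon>)" 
    using gibbs_term[of "1 + \<epsilon>" 1] ln_le_minus_one[of "1 + \<epsilon>"] e by (auto simp: l1_def mult.commute)
  have l2: "l2 \<le> -\<epsilon>" "-\<epsilon> \<le> l2 * (1 - \<epsilon>)"
    using gibbs_term[of "1 - \<epsilon>" 1] ln_le_minus_one[of "1 - \<epsilon>"] e by (auto simp: l2_def mult.commute)
  \<comment> \<open>This is \<open>(1 - \<epsilon>\<^sup>2)\<close> times the inverse hyperbolic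
    tangent of \<epsilon>. The coefficient of \<open>a * b\<close> in the loss is \<epsilon> - H,
    and the bounds on \<open>l1\<close> and \<open>l2\<close> place H within \<epsilon>^2 of
    \<epsilon>.\<close>
  define H where "H = (1 - \<epsilon>\<^sup>2) * (l1 - l2) / 2"
  have e2: "0 \<le> 1 - \<epsilon>\<^sup>2" "0 \<le> \<epsilon> ^ 3" "\<epsilon> ^ 3 \<le> \<epsilon>\<^sup>2"
    using e mult_mono[of \<epsilon> 1 \<epsilon> 1] mult_right_mono[of \<epsilon> 1 "\<epsilon> * \<epsilon>"]
    by (auto simp: power2_eq_square power3_eq_cube)
  have H2: "2 * H = (1 - \<epsilon>\<^sup>2) * l1 - (1 - \<epsilon>\<^sup>2) * l2"
  proof -
    have "2 * H = (1 - \<epsilon>\<^sup>2) * (l1 - l2)" by (simp add: H_def)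
    then show ?thesis by (simp only: right_diff_distrib)
  qed
  have Hu: "H \<le> \<epsilon> + \<epsilon>\<^sup>2"
  proof -
    have "(1 - \<epsilon>\<^sup>2) * l1 \<le> (1 - \<epsilon>\<^sup>2) * \<epsilon>" using l1 e2 by (intro mult_left_mono)
    moreover have "(1 + \<epsilon>) * (- \<epsilon>) \<le> (1 + \<epsilon>) * (l2 * (1 - \<epsilon>))" using l2 e by (intro mult_left_mono) auto
    moreover have "(1 + \<epsilon>) * (l2 * (1 - \<epsilon>)) = (1 - \<epsilon>\<^sup>2) * l2" by (simp add: power2_eq_square algebra_simps)
    ultimately have "2 * H \<le> (1 - \<epsilon>\<^sup>2) * \<epsilon> + (1 + \<epsilon>) * \<epsilon>" using H2 by linarith
    also have "\<dots> = 2 * \<epsilon> + \<epsilon>\<^sup>2 - \<epsilon>^3" by (simp add: power2_eq_square power3_eq_cube algebra_simps)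
    finally show ?thesis using e2 zero_le_power2[of \<epsilon>] by linarith
  qed
  have Hl: "\<epsilon> - \<epsilon>\<^sup>2 \<le> H"
  proof -
    have "(1 - \<epsilon>\<^sup>2) * l2 \<le> (1 - \<epsilon>\<^sup>2) * (-\<epsilon>)" using l2 e2 by (intro mult_left_mono)
    moreover have "(1 - \<epsilon>) * \<epsilon> \<le> (1 - \<epsilon>) * (l1 * (1 + \<epsilon>))" using l1 e by (intro mult_left_mono) auto
    moreover have "(1 - \<epsilon>) * (l1 * (1 + \<epsilon>)) = (1 - \<epsilon>\<^sup>2) * l1" by (simp add: power2_eq_square algebra_simps)
    ultimately have "(1 - \<epsilon>\<^sup>2) * \<epsilon> + (1 - \<epsilon>) * \<epsilon> \<le> 2 * H" using H2 by linarith
    moreover have "(1 - \<epsilon>\<^sup>2) * \<epsilon> + (1 - \<epsilon>) * \<epsilon> = 2 * \<epsilon> - \<epsilon>\<^sup>2 - \<epsilon>^3" by (simp add: power2_eq_square power3_eq_cube algebra_simps)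
    ultimately show ?thesis using e2 by linarith
  qed
  have "(\<Sum>x\<in>UNIV. \<Sum>y\<in>UNIV. q x y * (ln (1 + \<epsilon> * a * b) + ln (1 + \<epsilon> * sg x * sg y) - \<epsilon> * b * sg x - \<epsilon> * a * sg y))
     = F * G * ((1 + \<epsilon> * a * b) * ln (1 + \<epsilon> * a * b) + (1 + \<epsilon>) * (1 + a * b) / 2 * l1 + (1 - \<epsilon>) * (1 - a * b) / 2 * l2
        - \<epsilon> * b * (a + \<epsilon> * b) - \<epsilon> * a * (b + \<epsilon> * a))"
    by (simp add: UNIV_bool corr_def q_def l1_def l2_def field_simps)
  moreover have "(\<Sum>x\<in>UNIV. \<Sum>y\<in>UNIV. q x y * (ln (1 + \<epsilon> * a * b) + ln (1 + \<epsilon> * sg x * sg y) - \<epsilon> * b * sg x - \<epsilon> * a * sg y))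
    \<le> mutual_info UNIV UNIV q"
    unfolding mutual_info_def qx qy Zx by (intro sum_mono t)
  moreover have "F * G * (\<epsilon> * a * b) \<le> F * G * ((1 + \<epsilon> * a * b) * ln (1 + \<epsilon> * a * b))"
    using FG zp gibbs_term[of "1 + \<epsilon> * a * b" 1] by (intro mult_left_mono) auto
  ultimately have "F * G * (\<epsilon> * a * b + (1 + \<epsilon>) * (1 + a * b) / 2 * l1 + (1 - \<epsilon>) * (1 - a * b) / 2 * l2
        - \<epsilon> * b * (a + \<epsilon> * b) - \<epsilon> * a * (b + \<epsilon> * a)) \<le> mutual_info UNIV UNIV q"
    by (simp add: algebra_simps)
  then have "bit_info \<epsilon> * (\<Sum>x\<in>UNIV. \<Sum>y\<in>UNIV. q x y) - mutual_info UNIV UNIV q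
    \<le> bit_info \<epsilon> * (F * G * (1 + \<epsilon> * a * b)) - F * G * (\<epsilon> * a * b + (1 + \<epsilon>) * (1 + a * b) / 2 * l1 + (1 - \<epsilon>) * (1 - a * b) / 2 * l2
        - \<epsilon> * b * (a + \<epsilon> * b) - \<epsilon> * a * (b + \<epsilon> * a))"
    unfolding Z by simp
  also have "\<dots> = F * G * (\<epsilon>\<^sup>2 * (a\<^sup>2 + b\<^sup>2) - (H - \<epsilon>) * (a * b))"
    unfolding bit_info_def H_def l1_def[symmetric] l2_def[symmetric]
    by (simp add: power2_eq_square field_simps)
  \<comment> \<open>One unit of the 3/2 stems from linearising the two marginal corrections; the
    half is \<epsilon>^2 times the bound (a^2 + b^2) / 2 for the product of a and b.\<close>
  also have "\<dots> \<le> F * G * (3 / 2 * \<epsilon>\<^sup>2 * (a\<^sup>2 + b\<^sup>2))"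
  proof (intro mult_left_mono)
    have "\<bar>(H - \<epsilon>) * (a * b)\<bar> \<le> \<epsilon>\<^sup>2 * ((a\<^sup>2 + b\<^sup>2) / 2)"
      unfolding abs_mult[of "H - \<epsilon>"]
    proof (intro mult_mono)
      have "0 \<le> (\<bar>a\<bar> - \<bar>b\<bar>)\<^sup>2" by simp
      then show "\<bar>a * b\<bar> \<le> (a\<^sup>2 + b\<^sup>2) / 2" by (simp add: power2_diff abs_mult)
    qed (use Hu Hl in auto)
    then show "\<epsilon>\<^sup>2 * (a\<^sup>2 + b\<^sup>2) - (H - \<epsilon>) * (a * b) \<le> 3 / 2 * \<epsilon>\<^sup>2 * (a\<^sup>2 + b\<^sup>2)"
      by linarith
  qed (use FG in auto)
  finally show ?thesis by (simp add: mult_ac)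
qed

text \<open>The constant is 27 = 18 * 3/2: the two entropies add up to at least F G (a^2 + b^2) /
  18, and the loss is at most 3/2 \<epsilon>^2 F G (a^2 + b^2).\<close>

lemma contracting_bits:
  assumes e: "0 \<le> \<epsilon>" "\<epsilon> \<le> 1 / 2"
  shows "contracting UNIV UNIV (corr \<epsilon>) (bit_info \<epsilon>) (27 * \<epsilon>\<^sup>2)"
  unfolding contracting_def
proof (intro allI impI)
  fix f g :: "bool \<Rightarrow> real"
  assume f: "\<forall>x\<in>UNIV. 0 \<le> f x" and g: "\<forall>x\<in>UNIV. 0 \<le> g x"
  obtain F a where F: "0 \<le> F" "\<bar>a\<bar> \<le> 1" "f = (\<lambda>x. F * (1 + a * sg x))"
    using bool_fun_affine[of f] f by auto
  obtain G b where G: "0 \<le> G" "\<bar>b\<bar> \<le> 1" "g = (\<lambda>x. G * (1 + b * sg x))"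
    using bool_fun_affine[of g] g by auto
  have sy: "(\<lambda>y x. corr \<epsilon> x y) = corr \<epsilon>" by (simp add: fun_eq_iff corr_sym)
  have "F * a\<^sup>2 / 36 * (g True + g False) \<le> cond_ent UNIV UNIV (corr \<epsilon>) f g"
    unfolding F(3) using e F g by (intro cond_ent_bits_ge) auto
  moreover have "G * b\<^sup>2 / 36 * (f True + f False) \<le> cond_ent UNIV UNIV (corr \<epsilon>) g f"
    unfolding G(3) using e G f by (intro cond_ent_bits_ge) auto
  moreover have "g True + g False = 2 * G" "f True + f False = 2 * F"
    by (simp_all add: F(3) G(3) algebra_simps)
  ultimately have "F * a\<^sup>2 / 36 * (2 * G) + G * b\<^sup>2 / 36 * (2 * F) \<le> cond_ent UNIV UNIV (corr \<epsilon>) f g + cond_ent UNIV UNIV (corr \<epsilon>) g f"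
    by (metis add_mono)
  then have "F * G * (a\<^sup>2 + b\<^sup>2) / 18 \<le> cond_ent UNIV UNIV (corr \<epsilon>) f g + cond_ent UNIV UNIV (corr \<epsilon>) g f"
    by (simp add: field_simps)
  then have "27 * \<epsilon>\<^sup>2 * (F * G * (a\<^sup>2 + b\<^sup>2) / 18) \<le> 27 * \<epsilon>\<^sup>2 * (cond_ent UNIV UNIV (corr \<epsilon>) f g + cond_ent UNIV UNIV (corr \<epsilon>) g f)"
    by (intro mult_left_mono) auto
  moreover have "bit_info \<epsilon> * (\<Sum>x\<in>UNIV. \<Sum>y\<in>UNIV. corr \<epsilon> x y * f x * g y) - mutual_info UNIV UNIV (\<lambda>x y. corr \<epsilon> x y * f x * g y)
     \<le> 3 / 2 * \<epsilon>\<^sup>2 * (F * G * (a\<^sup>2 + b\<^sup>2))"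
    using mutual_info_bits_ge[OF e F(1,2) G(1,2)] unfolding F(3)[symmetric] G(3)[symmetric]
    by (simp add: F(3) G(3))
  ultimately show "bit_info \<epsilon> * (\<Sum>x\<in>UNIV. \<Sum>y\<in>UNIV. corr \<epsilon> x y * f x * g y) - mutual_info UNIV UNIV (\<lambda>x y. corr \<epsilon> x y * f x * g y)
     \<le> 27 * \<epsilon>\<^sup>2 * (cond_ent UNIV UNIV (corr \<epsilon>) f g + cond_ent UNIV UNIV (\<lambda>y x. corr \<epsilon> x y) g f)"
    unfolding sy by linarith
qed

section \<open>Transcripts of protocols\<close>

text \<open>The contribution of a single leaf to the bound I(X; Y) - I(X; Y | transcript). The slack
  is Z times the sum of two relative entropies: of the x-marginal \<open>qX / Z\<close> against
  \<open>u f / F\<close>, and of the y-marginal \<open>qY / Z\<close> against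
  \<open>v g / G\<close>.\<close>

lemma kl_rectangle_le:
  assumes fin: "finite X" "finite Y"
    and p: "\<And>x y. x \<in> X \<Longrightarrow> y \<in> Y \<Longrightarrow> 0 < p x y"
    and f: "\<And>x. x \<in> X \<Longrightarrow> 0 \<le> f x" and g: "\<And>y. y \<in> Y \<Longrightarrow> 0 \<le> g y"
  defines "u \<equiv> (\<lambda>x. \<Sum>y\<in>Y. p x y)" and "v \<equiv> (\<lambda>y. \<Sum>x\<in>X. p x y)"
    and "q \<equiv> (\<lambda>x y. p x y * f x * g y)"
  defines "Z \<equiv> (\<Sum>x\<in>X. \<Sum>y\<in>Y. q x y)"
  shows "Z * ln (Z / ((\<Sum>x\<in>X. u x * f x) * (\<Sum>y\<in>Y. v y * g y)))
     \<le> (\<Sum>x\<in>X. \<Sum>y\<in>Y. q x y * ln (p x y / (u x * v y))) - mutual_info X Y q"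
proof -
  have q0: "0 \<le> q x y" if "x \<in> X" "y \<in> Y" for x y
    unfolding q_def using that p[OF that] f g by simp
  define F where "F = (\<Sum>x\<in>X. u x * f x)"
  define G where "G = (\<Sum>y\<in>Y. v y * g y)"
  define qX where "qX = (\<lambda>x. \<Sum>y\<in>Y. q x y)"
  define qY where "qY = (\<lambda>y. \<Sum>x\<in>X. q x y)"
  have mi: "mutual_info X Y q = (\<Sum>x\<in>X. \<Sum>y\<in>Y. q x y * ln (q x y * Z / (qX x * qY y)))"
    by (simp add: mutual_info_def Z_def qX_def qY_def)
  have uv: "0 \<le> u x" "0 \<le> v y" if "x \<in> X" "y \<in> Y" for x y
    unfolding u_def v_def using that p by (auto intro!: sum_nonneg intro: less_imp_le)
  have qXY: "0 \<le> qX x" "0 \<le> qY y" if "x \<in> X" "y \<in> Y" for x y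
    unfolding qX_def qY_def using that q0 by (auto intro!: sum_nonneg)
  show ?thesis
  proof (cases "Z = 0")
    case True
    have "q x y = 0" if "x \<in> X" "y \<in> Y" for x y
    proof -
      have "(\<Sum>y\<in>Y. q x y) = 0" using True that q0 fin unfolding Z_def
        by (subst (asm) sum_nonneg_eq_0_iff) (auto intro!: sum_nonneg)
      then show ?thesis using that q0 fin by (subst (asm) sum_nonneg_eq_0_iff) auto
    qed
    then show ?thesis using True by (simp add: mi)
  next
    case False
    have "0 \<le> Z" unfolding Z_def using q0 by (intro sum_nonneg) auto
    then have Z: "0 < Z" using False by simp
    have Zx: "(\<Sum>x\<in>X. qX x) = Z" by (simp add: qX_def Z_def)
    have Zy: "(\<Sum>y\<in>Y. qY y) = Z" unfolding qY_def Z_def by (rule sum.swap)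
    have pos: "0 < f x \<and> 0 < g y \<and> 0 < u x \<and> 0 < v y \<and> 0 < F \<and> 0 < G \<and> 0 < qX x \<and> 0 < qY y"
      if m: "x \<in> X" "y \<in> Y" and "q x y \<noteq> 0" for x y
    proof -
      have fg: "0 < f x" "0 < g y" using that f g by (auto simp: q_def less_le)
      have "0 < u x" unfolding u_def using fin p m by (intro sum_pos) auto
      moreover have "0 < v y" unfolding v_def using fin p m by (intro sum_pos) auto
      moreover have "u x * f x \<le> F" unfolding F_def using fin uv m f
        by (intro member_le_sum[where f = "\<lambda>x. u x * f x"]) auto
      moreover have "v y * g y \<le> G" unfolding G_def using fin uv m g
        by (intro member_le_sum[where f = "\<lambda>y. v y * g y"]) auto
      moreover have "q x y \<le> qX x" unfolding qX_def using fin q0 m by (intro member_le_sum) auto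
      moreover have "q x y \<le> qY y" unfolding qY_def using fin q0 m
        by (intro member_le_sum[where f = "\<lambda>x. q x y"]) auto
      moreover have "0 < q x y" using q0[OF m] that by simp
      ultimately show ?thesis using fg by (smt (verit) mult_pos_pos)
    qed
    have pw: "q x y * 2 - q x y * (u x * f x * Z / (F * qX x)) - q x y * (v y * g y * Z / (G * qY y))
       \<le> q x y * ln (p x y / (u x * v y)) - q x y * ln (q x y * Z / (qX x * qY y)) - q x y * ln (Z / (F * G))"
      if m: "x \<in> X" "y \<in> Y" for x y
    proof (cases "q x y = 0")
      case False
      note ps = pos[OF m False] p[OF m]
      have "1 - u x * f x * Z / (F * qX x) \<le> ln (1 / (u x * f x * Z / (F * qX x)))"
        using gibbs_term[of 1 "u x * f x * Z / (F * qX x)"] ps Z by auto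
      moreover have "1 - v y * g y * Z / (G * qY y) \<le> ln (1 / (v y * g y * Z / (G * qY y)))"
        using gibbs_term[of 1 "v y * g y * Z / (G * qY y)"] ps Z by auto
      moreover have "ln (p x y / (u x * v y)) - ln (q x y * Z / (qX x * qY y)) - ln (Z / (F * G))
        = ln (1 / (u x * f x * Z / (F * qX x))) + ln (1 / (v y * g y * Z / (G * qY y)))"
        using ps Z by (simp add: q_def ln_div ln_mult)
      ultimately have "q x y * (2 - u x * f x * Z / (F * qX x) - v y * g y * Z / (G * qY y))
        \<le> q x y * (ln (p x y / (u x * v y)) - ln (q x y * Z / (qX x * qY y)) - ln (Z / (F * G)))"
        using q0[OF m] by (intro mult_left_mono) linarith+
      then show ?thesis by (simp only: right_diff_distrib)
    qed simp
    have b1: "(\<Sum>x\<in>X. \<Sum>y\<in>Y. q x y * (u x * f x * Z / (F * qX x))) \<le> Z"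
    proof -
      have "(\<Sum>x\<in>X. \<Sum>y\<in>Y. q x y * (u x * f x * Z / (F * qX x))) = (\<Sum>x\<in>X. qX x * (u x * f x * Z / (F * qX x)))"
        by (simp only: qX_def sum_distrib_right)
      also have "\<dots> \<le> (\<Sum>x\<in>X. u x * f x * Z / F)"
      proof (rule sum_mono)
        fix x assume x: "x \<in> X"
        have "0 \<le> F" unfolding F_def u_def using p f by (auto intro!: sum_nonneg mult_nonneg_nonneg intro: less_imp_le)
        then have "0 \<le> u x * f x * Z / F" using p x f Z unfolding u_def
          by (auto intro!: sum_nonneg mult_nonneg_nonneg divide_nonneg_nonneg intro: less_imp_le)
        then show "qX x * (u x * f x * Z / (F * qX x)) \<le> u x * f x * Z / F"
          by (cases "qX x = 0") auto
      qed
      also have "\<dots> = F * Z / F" by (simp add: F_def sum_distrib_right sum_divide_distrib)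
      also have "\<dots> \<le> Z" using Z by (cases "F = 0") auto
      finally show ?thesis .
    qed
    have b2: "(\<Sum>x\<in>X. \<Sum>y\<in>Y. q x y * (v y * g y * Z / (G * qY y))) \<le> Z"
    proof -
      have "(\<Sum>x\<in>X. \<Sum>y\<in>Y. q x y * (v y * g y * Z / (G * qY y))) = (\<Sum>y\<in>Y. qY y * (v y * g y * Z / (G * qY y)))"
        by (subst sum.swap) (simp only: qY_def sum_distrib_right)
      also have "\<dots> \<le> (\<Sum>y\<in>Y. v y * g y * Z / G)"
      proof (rule sum_mono)
        fix y assume y: "y \<in> Y"
        have "0 \<le> G" unfolding G_def v_def using p g by (auto intro!: sum_nonneg mult_nonneg_nonneg intro: less_imp_le)
        then have "0 \<le> v y * g y * Z / G" using p y g Z unfolding v_def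
          by (auto intro!: sum_nonneg mult_nonneg_nonneg divide_nonneg_nonneg intro: less_imp_le)
        then show "qY y * (v y * g y * Z / (G * qY y)) \<le> v y * g y * Z / G"
          by (cases "qY y = 0") auto
      qed
      also have "\<dots> = G * Z / G" by (simp add: G_def sum_distrib_right sum_divide_distrib)
      also have "\<dots> \<le> Z" using Z by (cases "G = 0") auto
      finally show ?thesis .
    qed
    have "0 \<le> Z * 2 - (\<Sum>x\<in>X. \<Sum>y\<in>Y. q x y * (u x * f x * Z / (F * qX x)))
       - (\<Sum>x\<in>X. \<Sum>y\<in>Y. q x y * (v y * g y * Z / (G * qY y)))"
      using b1 b2 by simp
    also have "\<dots> = (\<Sum>x\<in>X. \<Sum>y\<in>Y. q x y * 2 - q x y * (u x * f x * Z / (F * qX x)) - q x y * (v y * g y * Z / (G * qY y)))"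
      unfolding sum_subtractf by (simp only: sum_distrib_right[symmetric] Z_def)
    also have "\<dots> \<le> (\<Sum>x\<in>X. \<Sum>y\<in>Y. q x y * ln (p x y / (u x * v y)) - q x y * ln (q x y * Z / (qX x * qY y)) - q x y * ln (Z / (F * G)))"
      by (intro sum_mono pw)
    also have "\<dots> = (\<Sum>x\<in>X. \<Sum>y\<in>Y. q x y * ln (p x y / (u x * v y))) - mutual_info X Y q - Z * ln (Z / (F * G))"
      unfolding mi sum_subtractf by (simp only: sum_distrib_right[symmetric] Z_def)
    finally show ?thesis by (simp add: F_def G_def)
  qed
qed

text \<open>The left side is the conditional information I(X; transcript | Y), since a leaf has
  probability f g given (x, y) and \<open>g * T / v\<close> given y. It is at most the entropy of
  the transcript, hence at most ln of the number of leaves. The values of f and g are probabilities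
  rather than 0 or 1, to leave room for private randomness.\<close>

lemma sum_cond_ent_le_ln_card:
  assumes fin: "finite X" "finite Y" "finite L"
    and p: "\<And>x y. x \<in> X \<Longrightarrow> y \<in> Y \<Longrightarrow> 0 < p x y"
    and p1: "(\<Sum>x\<in>X. \<Sum>y\<in>Y. p x y) = 1"
    and f: "\<And>l x. l \<in> L \<Longrightarrow> x \<in> X \<Longrightarrow> 0 \<le> f l x \<and> f l x \<le> 1"
    and g: "\<And>l y. l \<in> L \<Longrightarrow> y \<in> Y \<Longrightarrow> 0 \<le> g l y \<and> g l y \<le> 1"
    and fg: "\<And>x y. x \<in> X \<Longrightarrow> y \<in> Y \<Longrightarrow> (\<Sum>l\<in>L. f l x * g l y) = 1"
  shows "(\<Sum>l\<in>L. cond_ent X Y p (f l) (g l)) \<le> ln (card L)"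
proof -
  define N where "N = real (card L)"
  have "X \<noteq> {}" "Y \<noteq> {}" using p1 by auto
  then obtain x0 y0 where "x0 \<in> X" "y0 \<in> Y" by auto
  then have "L \<noteq> {}" using fg[of x0 y0] by auto
  then have N: "0 < N" using fin by (simp add: N_def card_gt_0_iff)
  define v where "v = (\<lambda>y. \<Sum>x\<in>X. p x y)"
  define T where "T = (\<lambda>l y. \<Sum>x\<in>X. p x y * f l x)"
  define q where "q = (\<lambda>l x y. p x y * f l x * g l y)"
  have v: "0 < v y" if "y \<in> Y" for y
    unfolding v_def using that p fin \<open>X \<noteq> {}\<close> by (intro sum_pos) auto
  \<comment> \<open>Two estimates: f is at most 1, and then Gibbs' inequality against the uniform
    law on the N leaves.\<close>
  have pw: "q l x y * ln (f l x * v y / T l y) \<le> q l x y * (ln N - 1) + q l x y * (v y / (T l y * N))"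
    if m: "l \<in> L" "x \<in> X" "y \<in> Y" for l x y
  proof (cases "q l x y = 0")
    case False
    then have f0: "0 < f l x" and g0: "0 < g l y" using f g m by (auto simp: q_def less_le)
    have "p x y * f l x \<le> T l y" unfolding T_def using m fin p f
      by (intro member_le_sum[where f = "\<lambda>x. p x y * f l x"]) (auto intro!: mult_nonneg_nonneg intro: less_imp_le)
    then have T: "0 < T l y" using p m f0 by (smt (verit) mult_pos_pos)
    have "ln (f l x * v y / T l y) \<le> ln (v y / T l y)"
      using f0 T v m f[of l x] by (simp add: divide_right_mono mult_left_le_one_le)
    also have "\<dots> = ln N + ln (v y / (T l y * N))"
      using T N v[OF m(3)] by (simp add: ln_mult ln_div)
    also have "\<dots> \<le> ln N + (v y / (T l y * N) - 1)"
      using T N v m by (intro add_left_mono ln_le_minus_one) auto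
    finally have "ln (f l x * v y / T l y) \<le> (ln N - 1) + v y / (T l y * N)" by simp
    then have "q l x y * ln (f l x * v y / T l y) \<le> q l x y * ((ln N - 1) + v y / (T l y * N))"
      using p[of x y] f0 g0 m by (intro mult_left_mono) (auto simp: q_def intro: less_imp_le)
    then show ?thesis by (simp only: distrib_left)
  qed simp
  have "(\<Sum>l\<in>L. cond_ent X Y p (f l) (g l)) = (\<Sum>l\<in>L. \<Sum>x\<in>X. \<Sum>y\<in>Y. q l x y * ln (f l x * v y / T l y))"
    by (simp add: cond_ent_def q_def v_def T_def)
  also have "\<dots> \<le> (\<Sum>l\<in>L. \<Sum>x\<in>X. \<Sum>y\<in>Y. q l x y * (ln N - 1) + q l x y * (v y / (T l y * N)))"
    by (intro sum_mono pw)
  also have "\<dots> = (\<Sum>l\<in>L. \<Sum>x\<in>X. \<Sum>y\<in>Y. q l x y) * (ln N - 1) + (\<Sum>l\<in>L. \<Sum>x\<in>X. \<Sum>y\<in>Y. q l x y * (v y / (T l y * N)))"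
    by (simp only: sum.distrib sum_distrib_right)
  also have "(\<Sum>l\<in>L. \<Sum>x\<in>X. \<Sum>y\<in>Y. q l x y) = (\<Sum>x\<in>X. \<Sum>y\<in>Y. p x y * (\<Sum>l\<in>L. f l x * g l y))"
    unfolding q_def sum_distrib_left
    by (subst sum.swap, intro sum.cong refl, subst sum.swap) (simp add: mult.assoc)
  also have "\<dots> = 1" using p1 by (simp add: fg)
  also have "(\<Sum>l\<in>L. \<Sum>x\<in>X. \<Sum>y\<in>Y. q l x y * (v y / (T l y * N))) \<le> 1"
  proof -
    have "(\<Sum>x\<in>X. \<Sum>y\<in>Y. q l x y * (v y / (T l y * N))) \<le> 1 / N" if l: "l \<in> L" for l
    proof -
      have "(\<Sum>x\<in>X. \<Sum>y\<in>Y. q l x y * (v y / (T l y * N))) = (\<Sum>y\<in>Y. (\<Sum>x\<in>X. q l x y) * (v y / (T l y * N)))"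
        by (subst sum.swap) (simp only: sum_distrib_right)
      also have "\<dots> = (\<Sum>y\<in>Y. T l y * g l y * (v y / (T l y * N)))"
        by (simp only: q_def T_def sum_distrib_right)
      also have "\<dots> \<le> (\<Sum>y\<in>Y. v y / N)"
      proof (rule sum_mono)
        fix y assume y: "y \<in> Y"
        have "g l y * v y / N \<le> v y / N"
          using g[OF l y] v[OF y] N by (intro divide_right_mono mult_left_le_one_le) auto
        moreover have "0 \<le> v y / N" using v[OF y] N by simp
        ultimately show "T l y * g l y * (v y / (T l y * N)) \<le> v y / N" by (cases "T l y = 0") auto
      qed
      also have "\<dots> = (\<Sum>x\<in>X. \<Sum>y\<in>Y. p x y) / N"
        unfolding v_def by (subst sum.swap) (simp add: sum_divide_distrib)
      finally show ?thesis by (simp add: p1)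
    qed
    then have "(\<Sum>l\<in>L. \<Sum>x\<in>X. \<Sum>y\<in>Y. q l x y * (v y / (T l y * N))) \<le> (\<Sum>l\<in>L. 1 / N)"
      by (rule sum_mono)
    also have "\<dots> = 1" using N by (simp add: N_def)
    finally show ?thesis .
  qed
  finally show ?thesis by (simp add: N_def)
qed

text \<open>The set \<open>S\<close> consists of the accepting leaves.  Gibbs' inequality against \<open>3/4 P\<^sub>0(l) 2\<^bsup>[l \<in> S]\<^esup>\<close> bounds the
  relative entropy from below by an expression that is linear in both acceptance probabilities and
  can therefore be averaged over public coins.\<close>

lemma contracting_leaves:
  fixes p :: "'a \<Rightarrow> 'b \<Rightarrow> real" and L :: "'l set"
  assumes fin: "finite X" "finite Y" "finite L"
    and p: "\<And>x y. x \<in> X \<Longrightarrow> y \<in> Y \<Longrightarrow> 0 < p x y"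
    and p1: "(\<Sum>x\<in>X. \<Sum>y\<in>Y. p x y) = 1"
    and f: "\<And>l x. l \<in> L \<Longrightarrow> x \<in> X \<Longrightarrow> 0 \<le> f l x \<and> f l x \<le> 1"
    and g: "\<And>l y. l \<in> L \<Longrightarrow> y \<in> Y \<Longrightarrow> 0 \<le> g l y \<and> g l y \<le> 1"
    and fg: "\<And>x y. x \<in> X \<Longrightarrow> y \<in> Y \<Longrightarrow> (\<Sum>l\<in>L. f l x * g l y) = 1"
    and c: "contracting X Y p J \<kappa>" and \<kappa>: "0 \<le> \<kappa>"
  defines "u \<equiv> (\<lambda>x. \<Sum>y\<in>Y. p x y)" and "v \<equiv> (\<lambda>y. \<Sum>x\<in>X. p x y)"
  assumes J: "J = (\<Sum>x\<in>X. \<Sum>y\<in>Y. p x y * ln (p x y / (u x * v y)))"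
    and o: "S \<subseteq> L"
  shows "ln 2 * (\<Sum>l\<in>S. \<Sum>x\<in>X. \<Sum>y\<in>Y. p x y * f l x * g l y)
      - 3 / 4 * (\<Sum>l\<in>S. \<Sum>x\<in>X. \<Sum>y\<in>Y. u x * v y * f l x * g l y) - 1 / 12
      \<le> 2 * \<kappa> * ln (card L)"
proof -
  define P where "P = (\<lambda>l. \<Sum>x\<in>X. \<Sum>y\<in>Y. p x y * f l x * g l y)"
  define P0 where "P0 = (\<lambda>l. (\<Sum>x\<in>X. u x * f l x) * (\<Sum>y\<in>Y. v y * g l y))"
  have P0': "(\<Sum>x\<in>X. \<Sum>y\<in>Y. u x * v y * f l x * g l y) = P0 l" for l
    by (simp add: P0_def sum_product mult_ac)
  have sw: "(\<Sum>l\<in>L. \<Sum>x\<in>X. \<Sum>y\<in>Y. h x y * f l x * g l y) = (\<Sum>x\<in>X. \<Sum>y\<in>Y. h x y)" for h :: "'a \<Rightarrow> 'b \<Rightarrow> real"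
  proof -
    have "(\<Sum>l\<in>L. \<Sum>x\<in>X. \<Sum>y\<in>Y. h x y * f l x * g l y) = (\<Sum>x\<in>X. \<Sum>y\<in>Y. h x y * (\<Sum>l\<in>L. f l x * g l y))"
      unfolding sum_distrib_left
      by (subst sum.swap, intro sum.cong refl, subst sum.swap) (simp add: mult.assoc)
    then show ?thesis by (simp add: fg)
  qed
  have uv: "\<And>x. x \<in> X \<Longrightarrow> 0 \<le> u x" "\<And>y. y \<in> Y \<Longrightarrow> 0 \<le> v y"
    unfolding u_def v_def using p by (auto intro!: sum_nonneg intro: less_imp_le)
  have P_nn: "0 \<le> P l" "0 \<le> P0 l" if "l \<in> L" for l
    unfolding P_def P0_def using that p f g uv
    by (auto intro!: sum_nonneg mult_nonneg_nonneg intro: less_imp_le)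
  \<comment> \<open>Absolute continuity of the transcript laws, without which Gibbs' inequality
    could fail on leaves with \<open>P0 l = 0\<close>.\<close>
  have P_abs: "P l = 0" if l: "l \<in> L" and "P0 l = 0" for l
  proof -
    have "f l x * g l y = 0" if m: "x \<in> X" "y \<in> Y" for x y
    proof (rule ccontr)
      assume "f l x * g l y \<noteq> 0"
      then have fg: "0 < f l x" "0 < g l y" using f g l m by (auto simp: less_le)
      have "0 < u x" "0 < v y" unfolding u_def v_def using fin p m by (auto intro!: sum_pos)
      then have "0 < u x * f l x" "0 < v y * g l y" using fg by auto
      moreover have "u x * f l x \<le> (\<Sum>x\<in>X. u x * f l x)"
        using fin uv m f l by (intro member_le_sum[where f = "\<lambda>x. u x * f l x"]) auto
      moreover have "v y * g l y \<le> (\<Sum>y\<in>Y. v y * g l y)"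
        using fin uv m g l by (intro member_le_sum[where f = "\<lambda>y. v y * g l y"]) auto
      ultimately show False using \<open>P0 l = 0\<close> unfolding P0_def
        by (metis less_le_trans less_irrefl mult_pos_pos)
    qed
    then show ?thesis unfolding P_def mult.assoc by (intro sum.neutral ballI) simp
  qed
  have sP: "sum P L = 1" unfolding P_def using sw[of p] p1 by simp
  have u1: "(\<Sum>x\<in>X. u x) = 1" by (simp add: u_def p1)
  have v1: "(\<Sum>y\<in>Y. v y) = 1" unfolding v_def using p1 by (subst sum.swap)
  have sP0: "sum P0 L = 1"
  proof -
    have "sum P0 L = (\<Sum>x\<in>X. \<Sum>y\<in>Y. u x * v y)"
      unfolding P0'[symmetric] using sw[of "\<lambda>x y. u x * v y"] by simp
    also have "\<dots> = 1" by (simp add: sum_distrib_left[symmetric] sum_distrib_right[symmetric] u1 v1)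
    finally show ?thesis .
  qed
  have "(\<Sum>l\<in>L. P l * ln (P l / P0 l)) \<le> (\<Sum>l\<in>L. (\<Sum>x\<in>X. \<Sum>y\<in>Y. (p x y * f l x * g l y) * ln (p x y / (u x * v y)))
      - mutual_info X Y (\<lambda>x y. p x y * f l x * g l y))"
    unfolding P_def P0_def u_def v_def
    using fin p f g by (intro sum_mono kl_rectangle_le) auto
  also have "\<dots> = (\<Sum>l\<in>L. J * P l - mutual_info X Y (\<lambda>x y. p x y * f l x * g l y))"
  proof -
    have "(\<Sum>l\<in>L. \<Sum>x\<in>X. \<Sum>y\<in>Y. (p x y * f l x * g l y) * ln (p x y / (u x * v y))) = J"
      unfolding J using sw[of "\<lambda>x y. p x y * ln (p x y / (u x * v y))"] by (simp add: mult_ac)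
    moreover have "(\<Sum>l\<in>L. J * P l) = J" by (simp add: sum_distrib_left[symmetric] sP)
    ultimately show ?thesis by (simp only: sum_subtractf)
  qed
  also have "\<dots> \<le> (\<Sum>l\<in>L. \<kappa> * (cond_ent X Y p (f l) (g l) + cond_ent Y X (\<lambda>y x. p x y) (g l) (f l)))"
    unfolding P_def using c f g by (intro sum_mono) (auto simp: contracting_def)
  also have "\<dots> = \<kappa> * ((\<Sum>l\<in>L. cond_ent X Y p (f l) (g l)) + (\<Sum>l\<in>L. cond_ent Y X (\<lambda>y x. p x y) (g l) (f l)))"
    by (simp add: sum_distrib_left sum.distrib distrib_left)
  also have "\<dots> \<le> \<kappa> * (ln (card L) + ln (card L))"
  proof (intro mult_left_mono add_mono \<kappa>)
    show "(\<Sum>l\<in>L. cond_ent X Y p (f l) (g l)) \<le> ln (card L)"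
      by (intro sum_cond_ent_le_ln_card fin p p1 f g fg)
    have "(\<Sum>y\<in>Y. \<Sum>x\<in>X. p x y) = 1" using p1 by (subst sum.swap)
    then show "(\<Sum>l\<in>L. cond_ent Y X (\<lambda>y x. p x y) (g l) (f l)) \<le> ln (card L)"
      using fin p f g fg by (intro sum_cond_ent_le_ln_card) (auto simp: mult.commute)
  qed
  finally have D: "(\<Sum>l\<in>L. P l * ln (P l / P0 l)) \<le> 2 * \<kappa> * ln (card L)" by (simp add: algebra_simps)
  \<comment> \<open>The reference weights have total mass \<open>3 / 4 * (1 + P0(S))\<close>, which
    is 1 exactly when the acceptance probability in the far case is 1/3, the error allowed
    there.\<close>
  have "P l - (3 / 4 * P0 l + (if l \<in> S then 3 / 4 * P0 l else 0)) + (P l * ln (3 / 4) + (if l \<in> S then P l * ln 2 else 0))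
     \<le> P l * ln (P l / P0 l)" if l: "l \<in> L" for l
  proof (cases "P l = 0")
    case True
    then show ?thesis using P_nn[OF l] by auto
  next
    case False
    then have pos: "0 < P l" "0 < P0 l" using P_nn[OF l] P_abs[OF l] by (auto simp: less_le)
    define r where "r = (if l \<in> S then 2 else 1 :: real)"
    have r: "0 < r" by (simp add: r_def)
    have "P l - 3 / 4 * r * P0 l \<le> P l * ln (P l / (3 / 4 * r * P0 l))"
      using pos r by (intro gibbs_term) auto
    also have "ln (P l / (3 / 4 * r * P0 l)) = ln (P l / P0 l) - ln (3 / 4) - ln r"
      using pos r by (simp add: ln_div ln_mult)
    finally show ?thesis by (auto simp: r_def algebra_simps)
  qed
  then have "(\<Sum>l\<in>L. P l - (3 / 4 * P0 l + (if l \<in> S then 3 / 4 * P0 l else 0)) + (P l * ln (3 / 4) + (if l \<in> S then P l * ln 2 else 0)))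
     \<le> (\<Sum>l\<in>L. P l * ln (P l / P0 l))" by (rule sum_mono)
  also have "(\<Sum>l\<in>L. P l - (3 / 4 * P0 l + (if l \<in> S then 3 / 4 * P0 l else 0)) + (P l * ln (3 / 4) + (if l \<in> S then P l * ln 2 else 0)))
    = sum P L - (3 / 4 * sum P0 L + 3 / 4 * sum P0 S) + (sum P L * ln (3 / 4) + sum P S * ln 2)"
  proof -
    have i: "(\<Sum>l\<in>L. if l \<in> S then h l else 0) = sum h S" for h :: "'l \<Rightarrow> real"
      using o fin by (simp add: sum.inter_restrict[symmetric] Int_absorb1)
    show ?thesis
      by (simp add: sum.distrib sum_subtractf i sum_distrib_left[symmetric] sum_distrib_right[symmetric] sum_divide_distrib[symmetric])
  qed
  finally have "1 / 4 + ln (3 / 4) + ln 2 * sum P S - 3 / 4 * sum P0 S \<le> 2 * \<kappa> * ln (card L)"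
    using D by (simp add: sP sP0 mult.commute)
  \<comment> \<open>Source of the constant 1/12: 1 - 3/4 + ln (3/4) is at least 1/4 - 1/3.\<close>
  moreover have "- (1 / 3) \<le> ln (3 / 4 :: real)"
    using gibbs_term[of 1 "4 / 3 :: real"] by simp
  ultimately show ?thesis unfolding P0' P_def by linarith
qed

section \<open>Protocols on noisy bit strings\<close>

lemma contracting_reindex:
  assumes h: "bij_betw h X' X" and k: "bij_betw k Y' Y"
    and c: "contracting X' Y' (\<lambda>x y. p (h x) (k y)) J \<kappa>"
  shows "contracting X Y p J \<kappa>"
proof -
  have sx: "(\<Sum>x\<in>X. F x) = (\<Sum>x\<in>X'. F (h x))" for F :: "_ \<Rightarrow> real"
    by (rule sum.reindex_bij_betw[OF h, symmetric])
  have sy: "(\<Sum>y\<in>Y. F y) = (\<Sum>y\<in>Y'. F (k y))" for F :: "_ \<Rightarrow> real"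
    by (rule sum.reindex_bij_betw[OF k, symmetric])
  have "h ` X' = X" "k ` Y' = Y" using h k by (auto simp: bij_betw_def)
  then show ?thesis
    using c unfolding contracting_def mutual_info_def cond_ent_def sx sy
    by (intro allI impI) (drule_tac x = "\<lambda>x. f (h x)" in spec, drule_tac x = "\<lambda>y. g (k y)" in spec, auto)
qed

section \<open>Strings of independent correlated bits\<close>

definition bit_lists :: "nat \<Rightarrow> bool list set" where
  "bit_lists n = {xs. length xs = n}"

definition corrs :: "real \<Rightarrow> bool list \<Rightarrow> bool list \<Rightarrow> real" where
  "corrs \<epsilon> xs ys = (\<Prod>(x, y)\<leftarrow>zip xs ys. corr \<epsilon> x y)"

lemma corrs_simps [simp]: "corrs \<epsilon> [] [] = 1" "corrs \<epsilon> (x # xs) (y # ys) = corr \<epsilon> x y * corrs \<epsilon> xs ys"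
  by (simp_all add: corrs_def)

lemma finite_bit_lists [simp]: "finite (bit_lists n)"
  using finite_lists_length_eq[of "UNIV :: bool set" n] by (simp add: bit_lists_def)

lemma bit_lists_0 [simp]: "bit_lists 0 = {[]}"
  by (auto simp: bit_lists_def)

lemma bij_betw_bit_lists_Suc: "bij_betw (\<lambda>(x, xs). x # xs) (UNIV \<times> bit_lists n) (bit_lists (Suc n))"
  by (rule bij_betwI[where g = "\<lambda>xs. (hd xs, tl xs)"]) (auto simp: bit_lists_def length_Suc_conv)

lemma sum_bit_lists_Suc: "(\<Sum>xs\<in>bit_lists (Suc n). F xs) = (\<Sum>x\<in>UNIV. \<Sum>xs\<in>bit_lists n. F (x # xs))"
  for F :: "_ \<Rightarrow> real"
  using sum.reindex_bij_betw[OF bij_betw_bit_lists_Suc, of F n]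
  by (simp add: case_prod_unfold sum.cartesian_product')

lemma corr_pos: "\<bar>\<epsilon>\<bar> < 1 \<Longrightarrow> 0 < corr \<epsilon> x y"
  by (auto simp: corr_def)

lemma corrs_pos: "length xs = length ys \<Longrightarrow> \<bar>\<epsilon>\<bar> < 1 \<Longrightarrow> 0 < corrs \<epsilon> xs ys"
  by (induction xs ys rule: list_induct2) (auto intro!: mult_pos_pos corr_pos)

lemma corrs_sym: "length xs = length ys \<Longrightarrow> corrs \<epsilon> xs ys = corrs \<epsilon> ys xs"
  by (induction xs ys rule: list_induct2) (auto simp: corr_sym)

lemma corrs_marginal: "xs \<in> bit_lists n \<Longrightarrow> (\<Sum>ys\<in>bit_lists n. corrs \<epsilon> xs ys) = (1 / 2) ^ n"
proof (induction n arbitrary: xs)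
  case (Suc n)
  then obtain x xs' where xs: "xs = x # xs'" "xs' \<in> bit_lists n"
    by (auto simp: bit_lists_def length_Suc_conv)
  have "(\<Sum>y\<in>UNIV. corr \<epsilon> x y) = 1 / 2" by (simp add: UNIV_bool corr_def field_simps)
  then show ?case using Suc.IH[OF xs(2)]
    by (simp add: xs sum_bit_lists_Suc sum_distrib_left[symmetric] sum_distrib_right[symmetric])
qed simp

lemma corrs_marginal': "ys \<in> bit_lists n \<Longrightarrow> (\<Sum>xs\<in>bit_lists n. corrs \<epsilon> xs ys) = (1 / 2) ^ n"
  using corrs_marginal[of ys n \<epsilon>] sum.cong[of "bit_lists n" "bit_lists n" "\<lambda>xs. corrs \<epsilon> xs ys" "corrs \<epsilon> ys"]
  by (auto simp: bit_lists_def corrs_sym)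

lemma sum_const_bit_lists: "(\<Sum>xs\<in>bit_lists n. (1 / 2) ^ n) = (1 :: real)"
  by (induction n) (simp_all add: sum_bit_lists_Suc UNIV_bool sum_divide_distrib[symmetric] del: sum_constant)

lemma corrs_total: "(\<Sum>xs\<in>bit_lists n. \<Sum>ys\<in>bit_lists n. corrs \<epsilon> xs ys) = 1"
  using sum_const_bit_lists[of n] by (simp add: corrs_marginal del: sum_constant)

text \<open>Both marginals are uniform, so \<open>4 ^ n\<close> is the reciprocal of their product
  and the left side is the mutual information of the strings; it is additive over independent
  coordinates.\<close>

lemma corrs_info:
  assumes "\<bar>\<epsilon>\<bar> < 1"
  shows "(\<Sum>xs\<in>bit_lists n. \<Sum>ys\<in>bit_lists n. corrs \<epsilon> xs ys * ln (corrs \<epsilon> xs ys * 4 ^ n)) = n * bit_info \<epsilon>"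
proof (induction n)
  case (Suc n)
  let ?L = "\<lambda>xs ys. ln (corrs \<epsilon> xs ys * 4 ^ n)"
  have "(\<Sum>xs\<in>bit_lists (Suc n). \<Sum>ys\<in>bit_lists (Suc n). corrs \<epsilon> xs ys * ln (corrs \<epsilon> xs ys * 4 ^ Suc n))
     = (\<Sum>x\<in>UNIV. \<Sum>xs\<in>bit_lists n. \<Sum>y\<in>UNIV. \<Sum>ys\<in>bit_lists n.
         corr \<epsilon> x y * ln (corr \<epsilon> x y * 4) * corrs \<epsilon> xs ys + corr \<epsilon> x y * (corrs \<epsilon> xs ys * ?L xs ys))"
    unfolding sum_bit_lists_Suc
  proof (intro sum.cong refl)
    fix x y xs ys assume "xs \<in> bit_lists n" "ys \<in> bit_lists n"
    then have "0 < corrs \<epsilon> xs ys" "0 < corr \<epsilon> x y"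
      using assms by (auto intro: corrs_pos corr_pos simp: bit_lists_def)
    then show "corrs \<epsilon> (x # xs) (y # ys) * ln (corrs \<epsilon> (x # xs) (y # ys) * 4 ^ Suc n)
       = corr \<epsilon> x y * ln (corr \<epsilon> x y * 4) * corrs \<epsilon> xs ys + corr \<epsilon> x y * (corrs \<epsilon> xs ys * ?L xs ys)"
      by (simp add: ln_mult algebra_simps)
  qed
  also have "\<dots> = (\<Sum>x\<in>UNIV. \<Sum>y\<in>UNIV. \<Sum>xs\<in>bit_lists n. \<Sum>ys\<in>bit_lists n.
         corr \<epsilon> x y * ln (corr \<epsilon> x y * 4) * corrs \<epsilon> xs ys + corr \<epsilon> x y * (corrs \<epsilon> xs ys * ?L xs ys))"
    by (intro sum.cong refl sum.swap)
  also have "\<dots> = (\<Sum>x\<in>UNIV. \<Sum>y\<in>UNIV. corr \<epsilon> x y * ln (corr \<epsilon> x y * 4) + corr \<epsilon> x y * (n * bit_info \<epsilon>))"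
    by (simp only: sum.distrib sum_distrib_left[symmetric] corrs_total Suc.IH mult_1_right)
  also have "\<dots> = bit_info \<epsilon> + n * bit_info \<epsilon>"
  proof -
    have c: "corr \<epsilon> x y * 4 = 1 + \<epsilon> * sg x * sg y" for x y by (simp add: corr_def)
    show ?thesis unfolding c by (simp add: UNIV_bool corr_def bit_info_def) (simp add: field_simps)
  qed
  finally show ?case by (simp add: distrib_right)
qed simp

lemma contracting_corrs:
  assumes e: "0 \<le> \<epsilon>" "\<epsilon> \<le> 1 / 2"
  shows "contracting (bit_lists n) (bit_lists n) (corrs \<epsilon>) (n * bit_info \<epsilon>) (27 * \<epsilon>\<^sup>2)"
proof (induction n)
  case 0
  show ?case by (auto simp: contracting_def mutual_info_def cond_ent_def)
next
  case (Suc n)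
  have "contracting (UNIV \<times> bit_lists n) (UNIV \<times> bit_lists n)
     (\<lambda>(x1, x2) (y1, y2). corr \<epsilon> x1 y1 * corrs \<epsilon> x2 y2) (bit_info \<epsilon> + n * bit_info \<epsilon>) (27 * \<epsilon>\<^sup>2)"
    using e corrs_pos[of _ _ \<epsilon>]
    by (intro contracting_tensor contracting_bits Suc.IH finite_bit_lists) (auto intro: corr_pos simp: bit_lists_def)
  then have "contracting (bit_lists (Suc n)) (bit_lists (Suc n)) (corrs \<epsilon>) (bit_info \<epsilon> + n * bit_info \<epsilon>) (27 * \<epsilon>\<^sup>2)"
    by (intro contracting_reindex[OF bij_betw_bit_lists_Suc bij_betw_bit_lists_Suc])
       (simp add: case_prod_unfold)
  then show ?case by (simp add: algebra_simps)
qed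

subsection \<open>Expectations\<close>

abbreviation expct :: "'a pmf \<Rightarrow> ('a \<Rightarrow> real) \<Rightarrow> real" where
  "expct p \<phi> \<equiv> measure_pmf.expectation p \<phi>"

lemma integrable_pmf_bounded:
  fixes \<phi> :: "'a \<Rightarrow> real"
  assumes "\<And>x. 0 \<le> \<phi> x \<and> \<phi> x \<le> B"
  shows "integrable (measure_pmf p) \<phi>"
  using assms by (intro measure_pmf.integrable_const_bound[where B = B]) (auto intro!: AE_pmfI)

lemma expct_bounds:
  fixes \<phi> :: "'a \<Rightarrow> real"
  assumes "\<And>x. 0 \<le> \<phi> x \<and> \<phi> x \<le> 1"
  shows "0 \<le> expct p \<phi> \<and> expct p \<phi> \<le> 1"
proof -
  have "expct p \<phi> \<le> expct p (\<lambda>_. 1)"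
    using assms by (intro integral_mono integrable_pmf_bounded[of _ 1]) auto
  then show ?thesis using assms by (auto intro!: integral_nonneg_AE)
qed

lemma expct_mono:
  fixes \<phi> \<psi> :: "'a \<Rightarrow> real"
  assumes "\<And>x. 0 \<le> \<phi> x \<and> \<phi> x \<le> B" "\<And>x. 0 \<le> \<psi> x \<and> \<psi> x \<le> B" "\<And>x. x \<in> set_pmf p \<Longrightarrow> \<phi> x \<le> \<psi> x"
  shows "expct p \<phi> \<le> expct p \<psi>"
  using assms by (intro integral_mono_AE integrable_pmf_bounded) (auto simp: AE_measure_pmf_iff)

lemma expct_bind:
  fixes \<phi> :: "'b \<Rightarrow> real"
  assumes b: "\<And>x. 0 \<le> \<phi> x \<and> \<phi> x \<le> 1"
  shows "expct (bind_pmf p f) \<phi> = expct p (\<lambda>x. expct (f x) \<phi>)"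
proof -
  have nn: "(\<integral>\<^sup>+x. ennreal (\<psi> x) \<partial>measure_pmf q) = ennreal (expct q \<psi>)"
    if "\<And>x. 0 \<le> \<psi> x \<and> \<psi> x \<le> 1" for \<psi> :: "'c \<Rightarrow> real" and q
    using that by (intro nn_integral_eq_integral integrable_pmf_bounded[of _ 1]) auto
  have nb: "(\<integral>\<^sup>+x. ennreal (\<phi> x) \<partial>measure_pmf q) = ennreal (expct q \<phi>)" for q
    using b by (intro nn_integral_eq_integral integrable_pmf_bounded[of _ 1]) auto
  have "ennreal (expct (bind_pmf p f) \<phi>) = (\<integral>\<^sup>+x. ennreal (expct (f x) \<phi>) \<partial>measure_pmf p)"
    by (simp add: nb[symmetric])
  also have "\<dots> = ennreal (expct p (\<lambda>x. expct (f x) \<phi>))"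
    using expct_bounds[OF b] by (intro nn)
  finally show ?thesis
    using expct_bounds[OF b] b by (subst (asm) ennreal_inj) (auto intro!: integral_nonneg_AE AE_pmfI)
qed

lemma expct_pair:
  fixes \<phi> :: "'a \<times> 'b \<Rightarrow> real"
  assumes b: "\<And>x. 0 \<le> \<phi> x \<and> \<phi> x \<le> 1"
  shows "expct (pair_pmf p q) \<phi> = expct p (\<lambda>x. expct q (\<lambda>y. \<phi> (x, y)))"
  unfolding pair_pmf_def using b by (simp add: expct_bind)

lemma expct_pair_mult:
  fixes f :: "'a \<Rightarrow> real" and g :: "'b \<Rightarrow> real"
  assumes "\<And>x. 0 \<le> f x \<and> f x \<le> 1" "\<And>x. 0 \<le> g x \<and> g x \<le> 1"
  shows "expct (pair_pmf p q) (\<lambda>(x, y). f x * g y) = expct p f * expct q g"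
  using assms by (subst expct_pair) (auto simp: mult_le_one)

subsection \<open>Protocols\<close>

text \<open>Each leaf is stored with the rectangle of input pairs that reach it. A list is used
  because different leaves may carry the same triple and must be counted separately.\<close>

primrec leaves :: "('x, 'y) protocol \<Rightarrow> ('x set \<times> 'y set \<times> bool) list" where
  "leaves (Output b) = [(UNIV, UNIV, b)]"
| "leaves (Alice f P Q) = map (\<lambda>(A, B, b). ({x \<in> A. f x}, B, b)) (leaves P) @
     map (\<lambda>(A, B, b). ({x \<in> A. \<not> f x}, B, b)) (leaves Q)"
| "leaves (Bob g P Q) = map (\<lambda>(A, B, b). (A, {y \<in> B. g y}, b)) (leaves P) @
     map (\<lambda>(A, B, b). (A, {y \<in> B. \<not> g y}, b)) (leaves Q)"

lemma length_leaves: "length (leaves P) \<le> 2 ^ comm_bits P"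
proof (induction P)
  case (Alice f P Q)
  have "2 ^ comm_bits P \<le> (2 :: nat) ^ max (comm_bits P) (comm_bits Q)"
    "2 ^ comm_bits Q \<le> (2 :: nat) ^ max (comm_bits P) (comm_bits Q)"
    by (auto intro: power_increasing)
  then have "length (leaves P) + length (leaves Q) \<le> 2 * 2 ^ max (comm_bits P) (comm_bits Q)"
    using Alice by linarith
  then show ?case by simp
next
  case (Bob f P Q)
  have "2 ^ comm_bits P \<le> (2 :: nat) ^ max (comm_bits P) (comm_bits Q)"
    "2 ^ comm_bits Q \<le> (2 :: nat) ^ max (comm_bits P) (comm_bits Q)"
    by (auto intro: power_increasing)
  then have "length (leaves P) + length (leaves Q) \<le> 2 * 2 ^ max (comm_bits P) (comm_bits Q)"
    using Bob by linarith
  then show ?case by simp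
qed simp

text \<open>Stated for a general \<Phi> to serve twice: the constant True shows that the rectangles
  partition the inputs, and the identity selects the accepting ones.\<close>

lemma sum_list_leaves:
  "(\<Sum>(A, B, b)\<leftarrow>leaves P. if \<Phi> b then indicator A x * indicator B y else 0) = (if \<Phi> (run P x y) then 1 else (0 :: real))"
proof (induction P)
  case (Alice f P Q)
  have "(\<Sum>(A, B, b)\<leftarrow>map (\<lambda>(A, B, b). ({x \<in> A. c x}, B, b)) R. if \<Phi> b then indicator A x * indicator B y else (0 :: real))
     = (if c x then (\<Sum>(A, B, b)\<leftarrow>R. if \<Phi> b then indicator A x * indicator B y else 0) else 0)"
    for c and R :: "('a set \<times> 'b set \<times> bool) list"
    by (induction R) (auto simp: indicator_def)
  then show ?case unfolding leaves.simps map_append sum_list.append by (auto simp: Alice)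
next
  case (Bob g P Q)
  have "(\<Sum>(A, B, b)\<leftarrow>map (\<lambda>(A, B, b). (A, {y \<in> B. c y}, b)) R. if \<Phi> b then indicator A x * indicator B y else (0 :: real))
     = (if c y then (\<Sum>(A, B, b)\<leftarrow>R. if \<Phi> b then indicator A x * indicator B y else 0) else 0)"
    for c and R :: "('a set \<times> 'b set \<times> bool) list"
    by (induction R) (auto simp: indicator_def)
  then show ?case unfolding leaves.simps map_append sum_list.append by (auto simp: Bob)
qed simp

lemma protocol_rectangles:
  fixes P :: "('x, 'y) protocol"
  obtains N :: nat and A :: "nat \<Rightarrow> 'x set" and B :: "nat \<Rightarrow> 'y set" and S :: "nat set"
  where "N \<le> 2 ^ comm_bits P" "S \<subseteq> {..<N}"
    "\<And>x y. (\<Sum>l<N. indicator (A l) x * indicator (B l) y) = (1 :: real)"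
    "\<And>x y. (\<Sum>l\<in>S. indicator (A l) x * indicator (B l) y) = (of_bool (run P x y) :: real)"
proof
  let ?A = "\<lambda>l. fst (leaves P ! l)" let ?B = "\<lambda>l. fst (snd (leaves P ! l))"
  let ?N = "length (leaves P)"
  let ?S = "{l\<in>{..<?N}. snd (snd (leaves P ! l))}"
  show "?N \<le> 2 ^ comm_bits P" by (rule length_leaves)
  show "?S \<subseteq> {..<?N}" by auto
  fix x y
  show "(\<Sum>l<?N. indicator (?A l) x * indicator (?B l) y) = (1 :: real)"
    using sum_list_leaves[of "\<lambda>_. True" x y P] by (simp add: sum_list_sum_nth case_prod_unfold atLeast0LessThan)
  show "(\<Sum>l\<in>?S. indicator (?A l) x * indicator (?B l) y) = (of_bool (run P x y) :: real)"
    using sum_list_leaves[of "\<lambda>b. b" x y P]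
    by (subst sum.inter_filter) (simp_all add: sum_list_sum_nth case_prod_unfold atLeast0LessThan)
qed

section \<open>Inputs generated from correlated bits\<close>

definition bits_pmf :: "real \<Rightarrow> (bool \<times> bool) pmf" where
  "bits_pmf \<epsilon> = embed_pmf (\<lambda>(x, y). corr \<epsilon> x y)"

lemma pmf_bits_pmf:
  assumes "\<bar>\<epsilon>\<bar> \<le> 1"
  shows "pmf (bits_pmf \<epsilon>) (x, y) = corr \<epsilon> x y"
proof -
  have nn: "0 \<le> (case z of (x, y) \<Rightarrow> corr \<epsilon> x y)" for z
    using assms by (auto simp: corr_def split: prod.split)
  have "(\<integral>\<^sup>+z. ennreal (case z of (x, y) \<Rightarrow> corr \<epsilon> x y) \<partial>count_space UNIV)
     = ennreal (\<Sum>z\<in>UNIV. case z of (x, y) \<Rightarrow> corr \<epsilon> x y)"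
    using nn by (subst nn_integral_count_space_finite) (simp_all add: sum_ennreal)
  also have "(\<Sum>z\<in>UNIV. case z of (x, y) \<Rightarrow> corr \<epsilon> x y) = 1"
    unfolding UNIV_Times_UNIV[symmetric] sum.cartesian_product' by (simp add: UNIV_bool corr_def field_simps)
  finally show ?thesis using nn unfolding bits_pmf_def by (subst pmf_embed_pmf) auto
qed

lemma expct_bits_pmf:
  assumes "\<bar>\<epsilon>\<bar> \<le> 1"
  shows "expct (bits_pmf \<epsilon>) F = (\<Sum>x\<in>UNIV. \<Sum>y\<in>UNIV. corr \<epsilon> x y * F (x, y))"
proof -
  have "expct (bits_pmf \<epsilon>) F = (\<Sum>z\<in>UNIV. F z * pmf (bits_pmf \<epsilon>) z)"
    by (intro integral_measure_pmf_real) auto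
  also have "\<dots> = (\<Sum>x\<in>UNIV. \<Sum>y\<in>UNIV. corr \<epsilon> x y * F (x, y))"
    unfolding UNIV_Times_UNIV[symmetric] sum.cartesian_product' using assms by (simp add: pmf_bits_pmf mult.commute)
  finally show ?thesis .
qed

lemma expct_replicate_bits:
  assumes e: "\<bar>\<epsilon>\<bar> \<le> 1" and h: "\<And>xs ys. 0 \<le> h xs ys \<and> h xs ys \<le> 1"
  shows "expct (replicate_pmf n (bits_pmf \<epsilon>)) (\<lambda>zs. h (map fst zs) (map snd zs))
    = (\<Sum>xs\<in>bit_lists n. \<Sum>ys\<in>bit_lists n. corrs \<epsilon> xs ys * h xs ys)"
  using h
proof (induction n arbitrary: h)
  case (Suc n)
  have "expct (replicate_pmf (Suc n) (bits_pmf \<epsilon>)) (\<lambda>zs. h (map fst zs) (map snd zs))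
     = expct (bits_pmf \<epsilon>) (\<lambda>z. expct (replicate_pmf n (bits_pmf \<epsilon>)) (\<lambda>zs. h (fst z # map fst zs) (snd z # map snd zs)))"
    using Suc.prems by (simp add: expct_bind)
  also have "\<dots> = expct (bits_pmf \<epsilon>) (\<lambda>z. \<Sum>xs\<in>bit_lists n. \<Sum>ys\<in>bit_lists n. corrs \<epsilon> xs ys * h (fst z # xs) (snd z # ys))"
    using Suc.prems by (subst Suc.IH) auto
  also have "\<dots> = (\<Sum>x\<in>UNIV. \<Sum>y\<in>UNIV. \<Sum>xs\<in>bit_lists n. \<Sum>ys\<in>bit_lists n. corr \<epsilon> x y * corrs \<epsilon> xs ys * h (x # xs) (y # ys))"
    using e by (simp add: expct_bits_pmf sum_distrib_left mult.assoc)
  also have "\<dots> = (\<Sum>x\<in>UNIV. \<Sum>xs\<in>bit_lists n. \<Sum>y\<in>UNIV. \<Sum>ys\<in>bit_lists n. corr \<epsilon> x y * corrs \<epsilon> xs ys * h (x # xs) (y # ys))"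
    by (intro sum.cong refl sum.swap)
  also have "\<dots> = (\<Sum>xs\<in>bit_lists (Suc n). \<Sum>ys\<in>bit_lists (Suc n). corrs \<epsilon> xs ys * h xs ys)"
    unfolding sum_bit_lists_Suc by simp
  finally show ?case .
qed simp

lemma corrs_0: "length xs = length ys \<Longrightarrow> corrs 0 xs ys = (1 / 2) ^ length xs * (1 / 2) ^ length ys"
  by (induction xs ys rule: list_induct2) (auto simp: corr_def)

text \<open>Each party turns its own bit string into its input by a private channel, \<alpha> for
  Alice and \<beta> for Bob. As the channels are independent given the strings, the probability of
  reaching a leaf still factorises into f(xs) g(ys).\<close>

definition noisy_inputs ::
  "nat \<Rightarrow> (bool list \<Rightarrow> 'x pmf) \<Rightarrow> (bool list \<Rightarrow> 'y pmf) \<Rightarrow> real \<Rightarrow> ('x \<times> 'y) pmf" where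
  "noisy_inputs n \<alpha> \<beta> \<epsilon> =
     bind_pmf (replicate_pmf n (bits_pmf \<epsilon>)) (\<lambda>zs. pair_pmf (\<alpha> (map fst zs)) (\<beta> (map snd zs)))"

text \<open>There are at most \<open>2 ^ C\<close> leaves and \<kappa> = 27 \<epsilon>^2, so
  \<open>contracting_leaves\<close> yields 2 * 27 \<epsilon>^2 * C ln 2. The product of the
  marginals of \<open>corrs \<epsilon>\<close> is \<open>corrs 0\<close>, which identifies the
  reference law with the case of independent bits.\<close>

lemma protocol_bits_bound:
  fixes P :: "('x, 'y) protocol"
  assumes e: "0 \<le> \<epsilon>" "\<epsilon> \<le> 1 / 2" and C: "comm_bits P \<le> C"
  defines "\<phi> \<equiv> (\<lambda>(x, y). of_bool (run P x y))"
  shows "ln 2 * expct (noisy_inputs n \<alpha> \<beta> \<epsilon>) \<phi> - 3 / 4 * expct (noisy_inputs n \<alpha> \<beta> 0) \<phi> - 1 / 12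
     \<le> 54 * \<epsilon>\<^sup>2 * C * ln 2"
proof -
  obtain N :: nat and A B S where N: "N \<le> 2 ^ comm_bits P" and S: "S \<subseteq> {..<N}"
    and one: "\<And>x y. (\<Sum>l<N. indicator (A l) x * indicator (B l) y) = (1 :: real)"
    and out: "\<And>x y. (\<Sum>l\<in>S. indicator (A l) x * indicator (B l) y) = (of_bool (run P x y) :: real)"
    by (rule protocol_rectangles[of P]) (rule that; assumption)
  define f where "f = (\<lambda>l xs. expct (\<alpha> xs) (indicator (A l)))"
  define g where "g = (\<lambda>l ys. expct (\<beta> ys) (indicator (B l)))"
  have f: "0 \<le> f l x \<and> f l x \<le> 1" for l x unfolding f_def by (intro expct_bounds) (auto simp: indicator_def)
  have g: "0 \<le> g l x \<and> g l x \<le> 1" for l x unfolding g_def by (intro expct_bounds) (auto simp: indicator_def)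
  have fg: "(\<Sum>l\<in>T. f l xs * g l ys) = expct (pair_pmf (\<alpha> xs) (\<beta> ys)) (\<lambda>(x, y). \<Sum>l\<in>T. indicator (A l) x * indicator (B l) y)"
    for T xs ys
  proof -
    have "(\<Sum>l\<in>T. f l xs * g l ys) = (\<Sum>l\<in>T. expct (pair_pmf (\<alpha> xs) (\<beta> ys)) (\<lambda>(x, y). indicator (A l) x * indicator (B l) y))"
      unfolding f_def g_def by (intro sum.cong refl expct_pair_mult[symmetric]) (auto simp: indicator_def)
    also have "\<dots> = expct (pair_pmf (\<alpha> xs) (\<beta> ys)) (\<lambda>z. \<Sum>l\<in>T. case z of (x, y) \<Rightarrow> indicator (A l) x * indicator (B l) y)"
      by (intro Bochner_Integration.integral_sum[symmetric] integrable_pmf_bounded[of _ 1]) (auto simp: indicator_def)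
    finally show ?thesis by (simp add: case_prod_unfold)
  qed
  have \<phi>01: "0 \<le> \<phi> z \<and> \<phi> z \<le> 1" for z by (auto simp: \<phi>_def split: prod.split)
  have fgS: "(\<Sum>l\<in>S. f l xs * g l ys) = expct (pair_pmf (\<alpha> xs) (\<beta> ys)) \<phi>" for xs ys
    unfolding fg \<phi>_def out ..
  have ev: "expct (noisy_inputs n \<alpha> \<beta> \<delta>) \<phi> = (\<Sum>l\<in>S. \<Sum>xs\<in>bit_lists n. \<Sum>ys\<in>bit_lists n. corrs \<delta> xs ys * f l xs * g l ys)"
    if "\<bar>\<delta>\<bar> \<le> 1" for \<delta>
  proof -
    have "expct (noisy_inputs n \<alpha> \<beta> \<delta>) \<phi> = expct (replicate_pmf n (bits_pmf \<delta>)) (\<lambda>zs. \<Sum>l\<in>S. f l (map fst zs) * g l (map snd zs))"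
      unfolding noisy_inputs_def using \<phi>01 by (simp add: expct_bind fgS)
    also have "\<dots> = (\<Sum>xs\<in>bit_lists n. \<Sum>ys\<in>bit_lists n. corrs \<delta> xs ys * (\<Sum>l\<in>S. f l xs * g l ys))"
      unfolding fgS using that by (intro expct_replicate_bits expct_bounds \<phi>01) auto
    also have "\<dots> = (\<Sum>l\<in>S. \<Sum>xs\<in>bit_lists n. \<Sum>ys\<in>bit_lists n. corrs \<delta> xs ys * f l xs * g l ys)"
      unfolding sum_distrib_left
      by (subst (2) sum.swap, intro sum.cong refl, subst sum.swap) (simp add: mult.assoc)
    finally show ?thesis .
  qed
  have c0: "corrs 0 xs ys = (1 / 2) ^ n * (1 / 2) ^ n" if "xs \<in> bit_lists n" "ys \<in> bit_lists n" for xs ys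
    using that by (simp add: corrs_0 bit_lists_def)
  have "ln 2 * (\<Sum>l\<in>S. \<Sum>xs\<in>bit_lists n. \<Sum>ys\<in>bit_lists n. corrs \<epsilon> xs ys * f l xs * g l ys)
      - 3 / 4 * (\<Sum>l\<in>S. \<Sum>xs\<in>bit_lists n. \<Sum>ys\<in>bit_lists n.
          (\<Sum>ys\<in>bit_lists n. corrs \<epsilon> xs ys) * (\<Sum>xs\<in>bit_lists n. corrs \<epsilon> xs ys) * f l xs * g l ys) - 1 / 12
      \<le> 2 * (27 * \<epsilon>\<^sup>2) * ln (card {..<N})"
  proof (rule contracting_leaves[where J = "n * bit_info \<epsilon>"])
    show "0 < corrs \<epsilon> xs ys" if "xs \<in> bit_lists n" "ys \<in> bit_lists n" for xs ys
      using that e by (intro corrs_pos) (auto simp: bit_lists_def)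
    show "(\<Sum>l<N. f l xs * g l ys) = 1" for xs ys unfolding fg one by (simp add: case_prod_unfold)
    show "n * bit_info \<epsilon> = (\<Sum>xs\<in>bit_lists n. \<Sum>ys\<in>bit_lists n. corrs \<epsilon> xs ys * ln (corrs \<epsilon> xs ys /
       ((\<Sum>ys\<in>bit_lists n. corrs \<epsilon> xs ys) * (\<Sum>xs\<in>bit_lists n. corrs \<epsilon> xs ys))))"
    proof -
      have "(1 / 2) ^ n * (1 / 2) ^ n = 1 / (4 ^ n :: real)"
        by (simp add: power_mult_distrib[symmetric] power_one_over)
      then show ?thesis using corrs_info[of \<epsilon> n, symmetric] e
        by (simp add: corrs_marginal corrs_marginal')
    qed
  qed (use e f g S in \<open>auto simp: contracting_corrs corrs_total\<close>)
  also have "ln (card {..<N}) \<le> C * ln 2"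
  proof (cases "N = 0")
    case False
    have "N \<le> 2 ^ C" using N power_increasing[OF C, of "2 :: nat"] by linarith
    then have "real N \<le> 2 ^ C" by (metis of_nat_le_iff of_nat_numeral of_nat_power)
    then have "ln (real N) \<le> ln (2 ^ C)" using False by (subst ln_le_cancel_iff) auto
    then show ?thesis by (simp add: ln_realpow)
  qed auto
  finally have "ln 2 * expct (noisy_inputs n \<alpha> \<beta> \<epsilon>) \<phi> - 3 / 4 * expct (noisy_inputs n \<alpha> \<beta> 0) \<phi> - 1 / 12
     \<le> 2 * (27 * \<epsilon>\<^sup>2) * (C * ln 2)"
    using e by (simp add: ev c0 corrs_marginal corrs_marginal' mult_left_mono cong: sum.cong)
  then show ?thesis by simp
qed

subsection \<open>Randomized protocols\<close>

definition accept_prob :: "('x, 'y) protocol measure \<Rightarrow> 'x \<times> 'y \<Rightarrow> real" where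
  "accept_prob M = (\<lambda>(x, y). measure M {P \<in> space M. run P x y})"

lemma accept_prob_bounds: "randomized_protocol M \<Longrightarrow> 0 \<le> accept_prob M z \<and> accept_prob M z \<le> 1"
  by (auto simp: accept_prob_def randomized_protocol_def prob_space.prob_le_1 split: prod.split)

lemma sets_run:
  assumes "randomized_protocol M"
  shows "{P \<in> space M. run P x y = ans} \<in> sets M"
proof -
  have "(\<lambda>P. run P x y) -` {ans} \<inter> space M \<in> sets M"
    using assms unfolding randomized_protocol_def by (intro measurable_sets[of _ _ "count_space UNIV"]) auto
  also have "(\<lambda>P. run P x y) -` {ans} \<inter> space M = {P \<in> space M. run P x y = ans}" by auto
  finally show ?thesis .
qed

text \<open>A randomized protocol guarantees measurability only for each fixed pair of inputs.
  Countability of the inputs makes the joint event a countable union of measurable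
  rectangles.\<close>

lemma sets_run_pair:
  fixes M :: "('x :: countable, 'y :: countable) protocol measure"
  assumes "randomized_protocol M"
  shows "{(P, x, y). P \<in> space M \<and> run P x y = ans} \<in> sets (M \<Otimes>\<^sub>M measure_pmf D)"
proof -
  have "(\<Union>z. {P \<in> space M. run P (fst z) (snd z) = ans} \<times> {z}) \<in> sets (M \<Otimes>\<^sub>M measure_pmf D)"
    using sets_run[OF assms] by (intro sets.countable_UN) auto
  also have "(\<Union>z. {P \<in> space M. run P (fst z) (snd z) = ans} \<times> {z}) = {(P, x, y). P \<in> space M \<and> run P x y = ans}"
    by auto
  finally show ?thesis .
qed

lemma measure_run_pair:
  fixes M :: "('x :: countable, 'y :: countable) protocol measure"
  assumes M: "randomized_protocol M"
  shows "measure (M \<Otimes>\<^sub>M measure_pmf D) {(P, x, y). P \<in> space M \<and> run P x y = ans}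
     = expct D (\<lambda>(x, y). measure M {P \<in> space M. run P x y = ans})"
proof -
  interpret M: prob_space M using M by (simp add: randomized_protocol_def)
  interpret D: prob_space "measure_pmf D" by (rule prob_space_measure_pmf)
  interpret pair_prob_space M "measure_pmf D" ..
  let ?E = "{(P, x, y). P \<in> space M \<and> run P x y = ans}"
  have sl: "(\<lambda>P. (P, z)) -` ?E = {P \<in> space M. run P (fst z) (snd z) = ans}" for z by auto
  have "emeasure (M \<Otimes>\<^sub>M measure_pmf D) ?E = (\<integral>\<^sup>+z. ennreal (measure M {P \<in> space M. run P (fst z) (snd z) = ans}) \<partial>measure_pmf D)"
    by (subst emeasure_pair_measure_alt2[OF sets_run_pair[OF M]]) (simp add: sl M.emeasure_eq_measure case_prod_unfold)
  also have "\<dots> = ennreal (expct D (\<lambda>z. measure M {P \<in> space M. run P (fst z) (snd z) = ans}))"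
    by (intro nn_integral_eq_integral integrable_pmf_bounded[of _ 1]) auto
  finally show ?thesis
    by (simp add: measure_def case_prod_unfold)
qed

lemma output_prob_True:
  assumes "randomized_protocol M"
  shows "output_prob t a b M True = expct (pair_pmf (poisson_samples t a) (poisson_samples t b)) (accept_prob M)"
  unfolding output_prob_def measure_run_pair[OF assms] by (simp add: accept_prob_def)

lemma output_prob_False:
  assumes M: "randomized_protocol M"
  shows "output_prob t a b M False = 1 - expct (pair_pmf (poisson_samples t a) (poisson_samples t b)) (accept_prob M)"
proof -
  interpret M: prob_space M using M by (simp add: randomized_protocol_def)
  have "measure M {P \<in> space M. run P x y = False} = 1 - accept_prob M (x, y)" for x y
  proof -
    have "{P \<in> space M. run P x y = False} = space M - {P \<in> space M. run P x y = True}" by auto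
    then show ?thesis using M.prob_compl[OF sets_run[OF M, of x y True]] by (simp add: accept_prob_def)
  qed
  then have "output_prob t a b M False = expct (pair_pmf (poisson_samples t a) (poisson_samples t b)) (\<lambda>z. 1 - accept_prob M z)"
    unfolding output_prob_def measure_run_pair[OF M] by (simp add: case_prod_unfold)
  also have "\<dots> = 1 - expct (pair_pmf (poisson_samples t a) (poisson_samples t b)) (accept_prob M)"
    using accept_prob_bounds[OF M] by (subst Bochner_Integration.integral_diff) (auto intro!: integrable_pmf_bounded[of _ 1])
  finally show ?thesis .
qed

lemma expct_accept_prob:
  fixes M :: "('x :: countable, 'y :: countable) protocol measure"
  assumes M: "randomized_protocol M"
  shows "integrable M (\<lambda>P. expct D (\<lambda>(x, y). of_bool (run P x y)))"
    and "expct D (accept_prob M) = (\<integral>P. expct D (\<lambda>(x, y). of_bool (run P x y)) \<partial>M)"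
proof -
  interpret M: prob_space M using M by (simp add: randomized_protocol_def)
  interpret D: prob_space "measure_pmf D" by (rule prob_space_measure_pmf)
  interpret pair_prob_space M "measure_pmf D" ..
  define E where "E = {(P, x, y). P \<in> space M \<and> run P x y = True}"
  have E: "E \<in> sets (M \<Otimes>\<^sub>M measure_pmf D)" unfolding E_def by (rule sets_run_pair[OF M])
  have int: "integrable (M \<Otimes>\<^sub>M measure_pmf D) (\<lambda>(P, z). indicator E (P, z) :: real)"
    using E by (simp add: case_prod_unfold emeasure_eq_measure)
  have eq: "expct D (\<lambda>z. indicator E (P, z)) = expct D (\<lambda>(x, y). of_bool (run P x y))" if "P \<in> space M" for P
    using that by (intro arg_cong[where f = "expct D"]) (auto simp: E_def fun_eq_iff)
  have "integrable M (\<lambda>P. expct D (\<lambda>z. indicator E (P, z)))" by (rule integrable_fst[OF int])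
  then show "integrable M (\<lambda>P. expct D (\<lambda>(x, y). of_bool (run P x y)))"
    by (subst (asm) Bochner_Integration.integrable_cong[OF refl eq]) auto
  have "expct D (accept_prob M) = expct D (\<lambda>z. \<integral>P. indicator E (P, z) \<partial>M)"
  proof (intro arg_cong[where f = "expct D"] ext)
    fix z :: "'x \<times> 'y"
    have "(\<integral>P. indicator E (P, z) \<partial>M) = (\<integral>P. indicator {P \<in> space M. run P (fst z) (snd z)} P \<partial>M)"
      by (intro Bochner_Integration.integral_cong) (auto simp: E_def indicator_def split: prod.splits)
    also have "\<dots> = accept_prob M z"
      using sets_run[OF M, of "fst z" "snd z" True] by (simp add: accept_prob_def case_prod_unfold)
    finally show "accept_prob M z = (\<integral>P. indicator E (P, z) \<partial>M)" ..
  qed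
  also have "\<dots> = (\<integral>P. expct D (\<lambda>z. indicator E (P, z)) \<partial>M)"
    by (rule Fubini_integral[OF int])
  also have "\<dots> = (\<integral>P. expct D (\<lambda>(x, y). of_bool (run P x y)) \<partial>M)"
    by (intro Bochner_Integration.integral_cong refl eq)
  finally show "expct D (accept_prob M) = (\<integral>P. expct D (\<lambda>(x, y). of_bool (run P x y)) \<partial>M)" .
qed

lemma randomized_bits_bound:
  fixes M :: "('x :: countable, 'y :: countable) protocol measure"
  assumes e: "0 \<le> \<epsilon>" "\<epsilon> \<le> 1 / 2" and M: "randomized_protocol M" and C: "uses_at_most_bits M C"
  shows "ln 2 * expct (noisy_inputs n \<alpha> \<beta> \<epsilon>) (accept_prob M)
     - 3 / 4 * expct (noisy_inputs n \<alpha> \<beta> 0) (accept_prob M) - 1 / 12 \<le> 54 * \<epsilon>\<^sup>2 * C * ln 2"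
proof -
  interpret M: prob_space M using M by (simp add: randomized_protocol_def)
  note [simp] = expct_accept_prob(1)[OF M]
  let ?\<phi> = "\<lambda>P (x, y). of_bool (run P x y)"
  have "(\<integral>P. ln 2 * expct (noisy_inputs n \<alpha> \<beta> \<epsilon>) (?\<phi> P) - 3 / 4 * expct (noisy_inputs n \<alpha> \<beta> 0) (?\<phi> P) - 1 / 12 \<partial>M)
     \<le> (\<integral>P. 54 * \<epsilon>\<^sup>2 * C * ln 2 \<partial>M)"
    using C e unfolding uses_at_most_bits_def by (intro integral_mono protocol_bits_bound) auto
  then show ?thesis by (simp add: expct_accept_prob(2)[OF M] M.prob_space)
qed

section \<open>The gadget for one element\<close>

text \<open>Rate 0 is a genuine case, a light element missing on one side, and gets the point mass
  at 0.\<close>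

definition pois :: "real \<Rightarrow> nat pmf" where
  "pois r = (if r = 0 then return_pmf 0 else poisson_pmf r)"

lemma pmf_pois: "0 \<le> r \<Longrightarrow> pmf (pois r) k = r ^ k / fact k * exp (- r)"
  by (cases "k = 0") (auto simp: pois_def)

definition rate_prior :: "bool \<Rightarrow> real \<Rightarrow> (real \<times> real) pmf" where
  "rate_prior same \<theta> = bind_pmf (bernoulli_pmf (\<theta> / 200)) (\<lambda>h. bind_pmf (bernoulli_pmf (1 / 2)) (\<lambda>c.
     return_pmf (if h then (1, 1) else (if c then \<theta> else 0, if c = same then \<theta> else 0))))"

definition pair_counts :: "bool \<Rightarrow> real \<Rightarrow> (nat \<times> nat) pmf" where
  "pair_counts same \<theta> = bind_pmf (rate_prior same \<theta>) (\<lambda>(A, B). pair_pmf (pois A) (pois B))"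

lemma pmf_pair_counts:
  assumes "0 \<le> \<theta>" "\<theta> \<le> 1"
  shows "pmf (pair_counts same \<theta>) (x, y) = \<theta> / 200 * (pmf (pois 1) x * pmf (pois 1) y) +
     (1 - \<theta> / 200) / 2 * (pmf (pois \<theta>) x * pmf (pois (if same then \<theta> else 0)) y
        + pmf (pois 0) x * pmf (pois (if same then 0 else \<theta>)) y)"
  using assms unfolding pair_counts_def rate_prior_def
  by (cases same) (simp_all add: pmf_bind bind_assoc_pmf bind_return_pmf pmf_pair field_simps)

text \<open>The component r is the normalised remainder of p after w times \<nu> has been
  removed.\<close>

lemma pmf_mixture_split:
  fixes p \<nu> :: "'a pmf"
  assumes w: "0 \<le> w" "w < 1" and le: "\<And>z. w * pmf \<nu> z \<le> pmf p z"
  obtains r where "\<And>z. pmf p z = w * pmf \<nu> z + (1 - w) * pmf r z"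
proof
  let ?f = "\<lambda>z. (pmf p z - w * pmf \<nu> z) / (1 - w)"
  have nn: "0 \<le> ?f z" for z using w le[of z] by simp
  have int: "integrable (count_space UNIV) ?f"
    by (intro Bochner_Integration.integrable_divide Bochner_Integration.integrable_diff
        integrable_mult_right integrable_pmf)
  have "(\<integral>\<^sup>+z. ?f z \<partial>count_space UNIV) = ennreal (\<integral>z. ?f z \<partial>count_space UNIV)"
    using nn by (intro nn_integral_eq_integral int) auto
  also have "(\<integral>z. ?f z \<partial>count_space UNIV) = 1"
    using w by (simp add: Bochner_Integration.integral_diff integrable_pmf integral_pmf)
  finally have "pmf (embed_pmf ?f) z = ?f z" for z
    using nn by (intro pmf_embed_pmf) auto
  then show "pmf p z = w * pmf \<nu> z + (1 - w) * pmf (embed_pmf ?f) z" for z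
    using w by simp
qed

text \<open>The far law is split as \<open>w * \<mu> 0\<close> plus a remainder. Since
  \<open>w * (\<mu> \<epsilon> - \<mu> 0)\<close> is exactly the difference of the two laws,
  exchanging \<open>\<mu> 0\<close> for \<open>\<mu> \<epsilon>\<close> gives the equal law with the
  same remainder. The variable r lists, for each party, its count for bit False and its count for
  bit True, so each count depends on r and on the party's own bit only.\<close>

lemma pair_counts_noisy_bits:
  assumes \<theta>: "0 < \<theta>" "\<theta> \<le> 1 / 1800"
  obtains R :: "((nat \<times> nat) \<times> (nat \<times> nat)) pmf" where
    "\<And>same. pair_counts same \<theta> = bind_pmf R (\<lambda>r. map_pmf
       (\<lambda>z. (if fst z then snd (fst r) else fst (fst r), if snd z then snd (snd r) else fst (snd r)))
       (bits_pmf (if same then 900 * \<theta> else 0)))"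
proof -
  define \<kappa> where "\<kappa> = 1 - exp (- \<theta>)"
  have k: "0 < \<kappa>" "\<kappa> \<le> \<theta>" using \<theta> exp_ge_add_one_self[of "- \<theta>"] by (auto simp: \<kappa>_def)
  have k2: "\<theta> * exp (- \<theta>) \<le> \<kappa>"
  proof -
    have "(1 + \<theta>) * exp (- \<theta>) \<le> exp \<theta> * exp (- \<theta>)" using exp_ge_add_one_self[of \<theta>] by (intro mult_right_mono) auto
    then show ?thesis by (simp add: \<kappa>_def exp_minus field_simps)
  qed
  have m1: "measure (poisson_pmf \<theta>) {1..} = \<kappa>"
  proof -
    have "measure (poisson_pmf \<theta>) {1..} = measure (poisson_pmf \<theta>) (space (measure_pmf (poisson_pmf \<theta>)) - {0})"
      by (intro arg_cong2[where f = measure]) auto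
    also have "\<dots> = 1 - pmf (poisson_pmf \<theta>) 0"
      by (subst measure_pmf.prob_compl) (auto simp: measure_pmf_single)
    finally show ?thesis using \<theta> by (simp add: \<kappa>_def)
  qed
  define q where "q = cond_pmf (poisson_pmf \<theta>) {1..}"
  have ne: "set_pmf (poisson_pmf \<theta>) \<inter> {1..} \<noteq> {}" using \<theta> by auto
  have q: "pmf q x = (if 1 \<le> x then pmf (pois \<theta>) x / \<kappa> else 0)" for x
    unfolding q_def by (subst pmf_cond[OF ne]) (use \<theta> in \<open>simp add: m1[unfolded One_nat_def] pois_def\<close>)
  define \<delta> where "\<delta> = (\<lambda>x. pmf (return_pmf (0 :: nat)) x)"
  have p0: "pmf (pois 0) x = \<delta> x" for x by (simp add: pois_def \<delta>_def)
  have pt: "pmf (pois \<theta>) x = \<delta> x + \<kappa> * (pmf q x - \<delta> x)" for x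
    using \<theta> k by (cases "x = 0") (auto simp: q \<delta>_def pmf_pois \<kappa>_def)
  define qb where "qb = (\<lambda>u. if u then q else return_pmf 0)"
  \<comment> \<open>A bit True draws a count from q and a bit False gives 0. The correlation enters
    the resulting law only through a multiple of
    \<open>(q - \<delta>) \<otimes> (q - \<delta>)\<close>.\<close>
  define \<mu> where "\<mu> = (\<lambda>\<epsilon>. bind_pmf (bits_pmf \<epsilon>) (\<lambda>z. pair_pmf (qb (fst z)) (qb (snd z))))"
  have \<mu>: "pmf (\<mu> \<epsilon>) (x, y) = (pmf q x + \<delta> x) / 2 * ((pmf q y + \<delta> y) / 2) + \<epsilon> / 4 * ((pmf q x - \<delta> x) * (pmf q y - \<delta> y))"
    if "\<bar>\<epsilon>\<bar> \<le> 1" for \<epsilon> x y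
    unfolding \<mu>_def pmf_bind expct_bits_pmf[OF that]
    by (simp add: UNIV_bool corr_def pmf_pair qb_def \<delta>_def[symmetric]) (simp add: field_simps)
  \<comment> \<open>chosen so that \<open>w * (900 * \<theta>) / 4 = (1 - \<theta> / 200) / 2 * \<kappa>\<^sup>2\<close>, the coefficient of the difference of the two laws\<close>
  define w where "w = (1 - \<theta> / 200) * \<kappa>\<^sup>2 / (450 * \<theta>)"
  have w0: "0 \<le> w" using \<theta> by (auto simp: w_def)
  have w1: "w \<le> \<theta> / 450"
  proof -
    have "(1 - \<theta> / 200) * \<kappa>\<^sup>2 \<le> 1 * \<theta>\<^sup>2" using \<theta> k by (intro mult_mono power_mono) auto
    then have "w \<le> \<theta>\<^sup>2 / (450 * \<theta>)" unfolding w_def using \<theta> by (intro divide_right_mono) auto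
    then show ?thesis using \<theta> by (simp add: power2_eq_square)
  qed
  have e1: "1 / 3 \<le> exp (- 1 :: real)"
    using exp_le by (simp add: exp_minus field_simps)
  \<comment> \<open>The supports of q and \<delta> are disjoint, so only one summand is present at a
    time. By \<open>k2\<close>, \<open>pmf q x\<close> is at most \<open>1 / fact x\<close>, while
    Poi(1) has mass at least a third of that.\<close>
  have dom: "(pmf q x + \<delta> x) / 3 \<le> pmf (pois 1) x" for x
  proof (cases "x = 0")
    case True
    then show ?thesis using e1 by (simp add: q \<delta>_def pmf_pois)
  next
    case False
    have "\<theta> ^ x \<le> \<theta> ^ 1" using \<theta> False by (intro power_decreasing) auto
    then have "\<theta> ^ x * exp (- \<theta>) \<le> \<theta> * exp (- \<theta>)" by (intro mult_right_mono) auto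
    then have "\<theta> ^ x * exp (- \<theta>) \<le> \<kappa>" using k2 by linarith
    then have "\<theta> ^ x * exp (- \<theta>) / \<kappa> \<le> 1" using k by simp
    then have "\<theta> ^ x * exp (- \<theta>) / \<kappa> * (1 / fact x) * (1 / 3) \<le> 1 * (1 / fact x) * exp (- 1)"
      using e1 \<theta> k by (intro mult_mono) auto
    then show ?thesis using False \<theta> by (simp add: q \<delta>_def pmf_pois mult.commute[of \<kappa>])
  qed
  have "w * pmf (\<mu> 0) z \<le> pmf (pair_counts False \<theta>) z" for z
  proof -
    obtain x y where z: "z = (x, y)" by (cases z)
    let ?n = "\<lambda>x. (pmf q x + \<delta> x)"
    have nn: "0 \<le> ?n x" for x by (simp add: \<delta>_def)
    have "w * pmf (\<mu> 0) z = w * (?n x / 2 * (?n y / 2))" by (simp add: z \<mu>)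
    also have "\<dots> \<le> \<theta> / 450 * (?n x / 2 * (?n y / 2))"
      using w1 nn[of x] nn[of y] by (intro mult_right_mono) auto
    also have "\<dots> = \<theta> / 200 * (?n x / 3 * (?n y / 3))" by simp
    also have "\<dots> \<le> \<theta> / 200 * (pmf (pois 1) x * pmf (pois 1) y)"
      using dom nn \<theta> by (intro mult_left_mono mult_mono) auto
    also have "\<dots> \<le> pmf (pair_counts False \<theta>) z"
      using \<theta> by (simp add: z pmf_pair_counts)
    finally show ?thesis .
  qed
  then obtain rest where rest: "\<And>z. pmf (pair_counts False \<theta>) z = w * pmf (\<mu> 0) z + (1 - w) * pmf rest z"
    using w0 w1 \<theta> by (elim pmf_mixture_split[rotated 2]) auto
  let ?h = "\<lambda>r z. (if fst z then snd (fst r) else fst (fst r), if snd z then snd (snd r) else fst (snd r))"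
  \<comment> \<open>With probability w the bit decides between 0 and a fresh draw from q; otherwise
    both options of a party coincide and the bits have no influence.\<close>
  define R where "R = bind_pmf (bernoulli_pmf w) (\<lambda>c. if c then map_pmf (\<lambda>(a, b). ((0, a), (0, b))) (pair_pmf q q)
     else map_pmf (\<lambda>(x, y). ((x, x), (y, y))) rest)"
  have main: "pair_counts same \<theta> = bind_pmf R (\<lambda>r. map_pmf (?h r) (bits_pmf (if same then 900 * \<theta> else 0)))" for same
  proof (rule pmf_eqI)
    fix z :: "nat \<times> nat"
    obtain x y where z: "z = (x, y)" by (cases z)
    let ?e = "if same then 900 * \<theta> else 0 :: real"
    have e: "\<bar>?e\<bar> \<le> 1" using \<theta> by auto
    have b1: "bind_pmf (map_pmf (\<lambda>(a, b). ((0, a), (0, b))) (pair_pmf q q)) (\<lambda>r. map_pmf (?h r) (bits_pmf ?e)) = \<mu> ?e"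
    proof -
      have "bind_pmf (map_pmf (\<lambda>(a, b). ((0, a), (0, b))) (pair_pmf q q)) (\<lambda>r. map_pmf (?h r) (bits_pmf ?e))
        = bind_pmf (bits_pmf ?e) (\<lambda>z. bind_pmf (pair_pmf q q) (\<lambda>(a, b). return_pmf (if fst z then a else 0, if snd z then b else 0)))"
        unfolding map_pmf_def bind_assoc_pmf bind_return_pmf
        by (subst bind_commute_pmf) (intro bind_pmf_cong refl, auto)
      also have "\<dots> = \<mu> ?e"
        unfolding \<mu>_def
      proof (rule bind_pmf_cong[OF refl])
        fix z :: "bool \<times> bool"
        show "bind_pmf (pair_pmf q q) (\<lambda>(a, b). return_pmf (if fst z then a else 0, if snd z then b else 0)) = pair_pmf (qb (fst z)) (qb (snd z))"
          by (simp add: pair_pmf_def bind_assoc_pmf bind_return_pmf qb_def)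
      qed
      finally show ?thesis .
    qed
    have b2: "bind_pmf (map_pmf (\<lambda>(x, y). ((x, x), (y, y))) rest) (\<lambda>r. map_pmf (?h r) (bits_pmf ?e)) = rest"
    proof -
      have "?h (case z of (x, y) \<Rightarrow> ((x, x), (y, y))) = (\<lambda>_. z)" for z :: "nat \<times> nat"
        by (cases z) (auto simp: fun_eq_iff)
      then show ?thesis by (simp only: bind_map_pmf map_pmf_const bind_return_pmf')
    qed
    have "bind_pmf R (\<lambda>r. map_pmf (?h r) (bits_pmf ?e)) = bind_pmf (bernoulli_pmf w) (\<lambda>c. if c then \<mu> ?e else rest)"
      unfolding R_def bind_assoc_pmf
    proof (rule bind_pmf_cong[OF refl])
      fix c show "bind_pmf (if c then map_pmf (\<lambda>(a, b). ((0, a), (0, b))) (pair_pmf q q) else map_pmf (\<lambda>(x, y). ((x, x), (y, y))) rest)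
        (\<lambda>r. map_pmf (?h r) (bits_pmf ?e)) = (if c then \<mu> ?e else rest)"
        using b1 b2 by (cases c) simp_all
    qed
    then have "pmf (bind_pmf R (\<lambda>r. map_pmf (?h r) (bits_pmf ?e))) z = w * pmf (\<mu> ?e) z + (1 - w) * pmf rest z"
      using w0 w1 \<theta> by (simp add: pmf_bind)
    also have "\<dots> = pmf (pair_counts False \<theta>) z + w * (pmf (\<mu> ?e) z - pmf (\<mu> 0) z)"
      by (simp add: rest algebra_simps)
    also have "\<dots> = pmf (pair_counts same \<theta>) z"
    proof (cases same)
      case True
      have "w * (900 * \<theta> / 4) = (1 - \<theta> / 200) / 2 * \<kappa>\<^sup>2"
        using \<theta> by (simp add: w_def)
      moreover have "pmf (\<mu> ?e) z - pmf (\<mu> 0) z = 900 * \<theta> / 4 * ((pmf q x - \<delta> x) * (pmf q y - \<delta> y))"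
        using True e by (simp add: z \<mu>)
      ultimately have "w * (pmf (\<mu> ?e) z - pmf (\<mu> 0) z) = (1 - \<theta> / 200) / 2 * \<kappa>\<^sup>2 * ((pmf q x - \<delta> x) * (pmf q y - \<delta> y))"
        by (metis mult.assoc)
      moreover have "pmf (pair_counts True \<theta>) z - pmf (pair_counts False \<theta>) z
        = (1 - \<theta> / 200) / 2 * \<kappa>\<^sup>2 * ((pmf q x - \<delta> x) * (pmf q y - \<delta> y))"
        using \<theta> by (simp add: z pmf_pair_counts p0 pt power2_eq_square) (simp add: field_simps)
      ultimately show ?thesis using True by simp
    qed simp
    finally show "pmf (pair_counts same \<theta>) z = pmf (bind_pmf R (\<lambda>r. map_pmf (?h r) (bits_pmf ?e))) z" ..
  qed
  then show thesis by (rule that)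
qed

section \<open>Many elements: drawing shared randomness or rates before the counts\<close>

lemma replicate_pmf_bind_map:
  "replicate_pmf m (bind_pmf R (\<lambda>r. map_pmf (h r) B)) =
   bind_pmf (replicate_pmf m R) (\<lambda>rs. map_pmf (\<lambda>zs. map2 h rs zs) (replicate_pmf m B))"
proof (induction m)
  case 0
  show ?case by (simp add: bind_return_pmf)
next
  case (Suc m)
  have "replicate_pmf (Suc m) (bind_pmf R (\<lambda>r. map_pmf (h r) B)) =
     bind_pmf R (\<lambda>r. bind_pmf B (\<lambda>z. bind_pmf (replicate_pmf m R) (\<lambda>rs. bind_pmf (replicate_pmf m B) (\<lambda>zs.
        return_pmf (h r z # map2 h rs zs)))))"
    unfolding replicate_pmf.simps Suc.IH by (simp add: map_pmf_def bind_assoc_pmf bind_return_pmf)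
  also have "\<dots> = bind_pmf R (\<lambda>r. bind_pmf (replicate_pmf m R) (\<lambda>rs. bind_pmf B (\<lambda>z. bind_pmf (replicate_pmf m B) (\<lambda>zs.
        return_pmf (h r z # map2 h rs zs)))))"
    by (subst bind_commute_pmf) (rule refl)
  also have "\<dots> = bind_pmf (replicate_pmf (Suc m) R) (\<lambda>rs. map_pmf (\<lambda>zs. map2 h rs zs) (replicate_pmf (Suc m) B))"
    by (simp add: map_pmf_def bind_assoc_pmf bind_return_pmf)
  finally show ?case .
qed

primrec indep_pois :: "real list \<Rightarrow> nat list pmf" where
  "indep_pois [] = return_pmf []"
| "indep_pois (r # rs) = bind_pmf (pois r) (\<lambda>x. map_pmf (\<lambda>xs. x # xs) (indep_pois rs))"

text \<open>Drawing the counts element by element fits the bit representation; drawing all rates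
  first fixes a and b and makes the two parties' counts independent. The continuation K lets the two
  views be exchanged inside a larger experiment.\<close>

lemma replicate_pair_counts:
  "bind_pmf (replicate_pmf m (pair_counts same \<theta>)) (\<lambda>cs. K (map fst cs) (map snd cs)) =
   bind_pmf (replicate_pmf m (rate_prior same \<theta>)) (\<lambda>AB.
     bind_pmf (indep_pois (map fst AB)) (\<lambda>xs. bind_pmf (indep_pois (map snd AB)) (\<lambda>ys. K xs ys)))"
proof (induction m arbitrary: K)
  case 0
  show ?case by (simp add: bind_return_pmf)
next
  case (Suc m)
  have "bind_pmf (replicate_pmf (Suc m) (pair_counts same \<theta>)) (\<lambda>cs. K (map fst cs) (map snd cs))
    = bind_pmf (rate_prior same \<theta>) (\<lambda>z. bind_pmf (pois (fst z)) (\<lambda>x. bind_pmf (pois (snd z)) (\<lambda>y.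
        bind_pmf (replicate_pmf m (pair_counts same \<theta>)) (\<lambda>cs. K (x # map fst cs) (y # map snd cs)))))"
    by (simp add: pair_counts_def bind_assoc_pmf bind_return_pmf case_prod_unfold pair_pmf_def)
  also have "\<dots> = bind_pmf (rate_prior same \<theta>) (\<lambda>z. bind_pmf (pois (fst z)) (\<lambda>x. bind_pmf (pois (snd z)) (\<lambda>y.
        bind_pmf (replicate_pmf m (rate_prior same \<theta>)) (\<lambda>AB.
          bind_pmf (indep_pois (map fst AB)) (\<lambda>xs. bind_pmf (indep_pois (map snd AB)) (\<lambda>ys. K (x # xs) (y # ys)))))))"
    by (subst Suc.IH) (rule refl)
  also have "\<dots> = bind_pmf (rate_prior same \<theta>) (\<lambda>z. bind_pmf (replicate_pmf m (rate_prior same \<theta>)) (\<lambda>AB.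
        bind_pmf (pois (fst z)) (\<lambda>x. bind_pmf (indep_pois (map fst AB)) (\<lambda>xs. bind_pmf (pois (snd z)) (\<lambda>y.
          bind_pmf (indep_pois (map snd AB)) (\<lambda>ys. K (x # xs) (y # ys)))))))"
    by (subst (2) bind_commute_pmf, subst (1) bind_commute_pmf, subst (3) bind_commute_pmf) (rule refl)
  also have "\<dots> = bind_pmf (replicate_pmf (Suc m) (rate_prior same \<theta>)) (\<lambda>AB.
     bind_pmf (indep_pois (map fst AB)) (\<lambda>xs. bind_pmf (indep_pois (map snd AB)) (\<lambda>ys. K xs ys)))"
    by (simp add: map_pmf_def bind_assoc_pmf bind_return_pmf)
  finally show ?case .
qed

section \<open>Poisson samples from independent counts\<close>

text \<open>List positions start at 0 but the domain is {1..n}, hence the shift by one here and in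
  \<open>rate_pmf\<close>.\<close>

definition count_mset :: "nat list \<Rightarrow> nat multiset" where
  "count_mset cs = (\<Sum>i<length cs. replicate_mset (cs ! i) (Suc i))"

definition shuffle_pmf :: "nat list \<Rightarrow> nat list pmf" where
  "shuffle_pmf cs = pmf_of_set (permutations_of_multiset (count_mset cs))"

definition rate_pmf :: "real list \<Rightarrow> nat pmf" where
  "rate_pmf rs = embed_pmf (\<lambda>i. if i \<in> {1..length rs} then rs ! (i - 1) / sum_list rs else 0)"

lemma pmf_rate_pmf:
  assumes nn: "\<And>r. r \<in> set rs \<Longrightarrow> 0 \<le> r" and S: "0 < sum_list rs"
  shows "pmf (rate_pmf rs) i = (if i \<in> {1..length rs} then rs ! (i - 1) / sum_list rs else 0)"
proof -
  let ?f = "\<lambda>i. if i \<in> {1..length rs} then rs ! (i - 1) / sum_list rs else 0"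
  have f: "0 \<le> ?f i" for i using nn S by auto
  have "(\<integral>\<^sup>+i. ennreal (?f i) \<partial>count_space UNIV) = (\<Sum>i\<in>{1..length rs}. ennreal (?f i))"
    using f by (intro nn_integral_count_space') auto
  also have "\<dots> = ennreal (\<Sum>i\<in>{1..length rs}. ?f i)" by (intro sum_ennreal f)
  also have "(\<Sum>i\<in>{1..length rs}. ?f i) = (\<Sum>i\<in>{1..length rs}. rs ! (i - 1)) / sum_list rs"
    by (simp add: sum_divide_distrib)
  also have "(\<Sum>i\<in>{1..length rs}. rs ! (i - 1)) = (\<Sum>i<length rs. rs ! i)"
    by (rule sum.reindex_bij_witness[where i = Suc and j = "\<lambda>i. i - 1"]) auto
  also have "\<dots> = sum_list rs" by (simp add: sum_list_sum_nth atLeast0LessThan)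
  also have "ennreal (sum_list rs / sum_list rs) = 1" using S by simp
  finally show ?thesis unfolding rate_pmf_def by (rule pmf_embed_pmf[OF f])
qed

lemma count_count_mset: "count (count_mset cs) x = (if x \<in> {1..length cs} then cs ! (x - 1) else 0)"
proof -
  have "count (count_mset cs) x = (\<Sum>i<length cs. if Suc i = x then cs ! i else 0)"
    unfolding count_mset_def count_sum by (intro sum.cong) auto
  also have "\<dots> = (if x \<in> {1..length cs} then cs ! (x - 1) else 0)"
  proof (cases x)
    case (Suc y)
    then show ?thesis by (auto simp: sum.delta)
  qed auto
  finally show ?thesis .
qed

lemma set_count_mset: "set_mset (count_mset cs) \<subseteq> {1..length cs}"
  by (rule subsetI) (simp add: count_count_mset flip: count_greater_zero_iff split: if_splits)

lemma count_mset_eq_iff: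
  assumes "length cs = n" "set xs \<subseteq> {1..n}"
  shows "mset xs = count_mset cs \<longleftrightarrow> cs = map (\<lambda>i. count_list xs (Suc i)) [0..<n]"
proof
  assume e: "mset xs = count_mset cs"
  show "cs = map (\<lambda>i. count_list xs (Suc i)) [0..<n]"
  proof (rule nth_equalityI)
    fix i assume "i < length cs"
    then show "cs ! i = map (\<lambda>i. count_list xs (Suc i)) [0..<n] ! i"
      using assms(1) count_count_mset[of cs "Suc i"] by (simp flip: count_mset add: e)
  qed (use assms in auto)
next
  assume e: "cs = map (\<lambda>i. count_list xs (Suc i)) [0..<n]"
  show "mset xs = count_mset cs"
  proof (rule multiset_eqI)
    fix x show "count (mset xs) x = count (count_mset cs) x"
    proof (cases "x \<in> {1..n}")
      case True
      then obtain y where "x = Suc y" "y < n" by (cases x) auto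
      then show ?thesis using assms by (simp add: count_count_mset e count_mset)
    next
      case False
      then have "x \<notin> set xs" using assms by auto
      then have "count (mset xs) x = 0" by (simp add: count_eq_zero_iff)
      then show ?thesis using False assms by (auto simp: count_count_mset)
    qed
  qed
qed

lemma pmf_shuffle:
  "pmf (shuffle_pmf cs) xs = (if mset xs = count_mset cs then (\<Prod>i<length cs. fact (cs ! i)) / fact (sum_list cs) else 0)"
proof (cases "mset xs = count_mset cs")
  case True
  let ?A = "count_mset cs"
  have "(\<Prod>x\<in>set_mset ?A. fact (count ?A x) :: nat) = (\<Prod>x\<in>{1..length cs}. fact (count ?A x))"
    using set_count_mset[of cs] by (intro prod.mono_neutral_left) (auto simp: not_in_iff)
  also have "\<dots> = (\<Prod>i<length cs. fact (cs ! i))"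
    by (rule prod.reindex_bij_witness[where i = Suc and j = "\<lambda>i. i - 1"]) (auto simp: count_count_mset)
  finally have p: "(\<Prod>x\<in>set_mset ?A. fact (count ?A x)) = (\<Prod>i<length cs. fact (cs ! i) :: nat)" .
  have sz: "size ?A = sum_list cs"
    by (simp add: count_mset_def sum_list_sum_nth atLeast0LessThan size_multiset_sum)
  have "card (permutations_of_multiset ?A) * (\<Prod>i<length cs. fact (cs ! i)) = fact (sum_list cs)"
    using card_permutations_of_multiset[of ?A] unfolding p sz by simp
  then have "real (card (permutations_of_multiset ?A)) * (\<Prod>i<length cs. fact (cs ! i)) = fact (sum_list cs)"
    by (metis (mono_tags, lifting) of_nat_fact of_nat_mult of_nat_prod prod.cong)
  moreover have "0 < (\<Prod>i<length cs. fact (cs ! i) :: real)" by (intro prod_pos) auto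
  ultimately have "1 / real (card (permutations_of_multiset ?A)) = (\<Prod>i<length cs. fact (cs ! i)) / fact (sum_list cs)"
    by (simp add: field_simps)
  then show ?thesis using True by (simp add: shuffle_pmf_def permutations_of_multisetI)
qed (auto simp: shuffle_pmf_def indicator_def dest: permutations_of_multisetD)

lemma length_indep_pois: "xs \<in> set_pmf (indep_pois rs) \<Longrightarrow> length xs = length rs"
  by (induction rs arbitrary: xs) auto

lemma pmf_indep_pois:
  "(\<And>r. r \<in> set rs \<Longrightarrow> 0 \<le> r) \<Longrightarrow> length cs = length rs \<Longrightarrow>
   pmf (indep_pois rs) cs = (\<Prod>i<length rs. rs ! i ^ (cs ! i) / fact (cs ! i)) * exp (- sum_list rs)"
proof (induction rs arbitrary: cs)
  case (Cons r rs)
  then obtain c cs' where cs: "cs = c # cs'" "length cs' = length rs" by (cases cs) auto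
  have "indep_pois (r # rs) = map_pmf (\<lambda>(x, xs). x # xs) (pair_pmf (pois r) (indep_pois rs))"
    by (simp add: pair_pmf_def map_pmf_def bind_assoc_pmf bind_return_pmf)
  moreover have "inj (\<lambda>(x, xs). x # xs)" by (auto simp: inj_def)
  ultimately have "pmf (indep_pois (r # rs)) cs = pmf (pois r) c * pmf (indep_pois rs) cs'"
    using pmf_map_inj'[of "\<lambda>(x, xs). x # xs" "pair_pmf (pois r) (indep_pois rs)" "(c, cs')"] by (simp add: cs pmf_pair)
  also have "\<dots> = (r ^ c / fact c * exp (- r)) * ((\<Prod>i<length rs. rs ! i ^ (cs' ! i) / fact (cs' ! i)) * exp (- sum_list rs))"
    using Cons.IH[of cs'] Cons.prems cs by (simp add: pmf_pois)
  also have "\<dots> = (\<Prod>i<Suc (length rs). (r # rs) ! i ^ (cs ! i) / fact (cs ! i)) * exp (- (r + sum_list rs))"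
  proof -
    have "exp (- (r + sum_list rs)) = exp (- r) * exp (- sum_list rs)" by (simp add: mult_exp_exp)
    then show ?thesis unfolding cs prod.lessThan_Suc_shift by (simp add: mult_ac)
  qed
  finally show ?case by simp
qed simp

lemma pmf_replicate_pmf: "pmf (replicate_pmf N a) xs = (if length xs = N then (\<Prod>x\<leftarrow>xs. pmf a x) else 0)"
proof (induction N arbitrary: xs)
  case (Suc N)
  have r: "replicate_pmf (Suc N) a = map_pmf (\<lambda>(x, xs). x # xs) (pair_pmf a (replicate_pmf N a))"
    by (simp add: pair_pmf_def map_pmf_def bind_assoc_pmf bind_return_pmf)
  have inj: "inj (\<lambda>(x :: 'a, xs). x # xs)" by (auto simp: inj_def)
  show ?case
  proof (cases xs)
    case Nil
    then show ?thesis unfolding r by (subst pmf_map_outside) auto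
  next
    case (Cons x xs')
    then show ?thesis unfolding r
      using pmf_map_inj'[OF inj, of "pair_pmf a (replicate_pmf N a)" "(x, xs')"] by (simp add: pmf_pair Suc.IH)
  qed
qed (auto simp: indicator_def)

lemma prod_list_by_count:
  fixes f :: "nat \<Rightarrow> real"
  shows "set xs \<subseteq> {1..n} \<Longrightarrow> (\<Prod>x\<leftarrow>xs. f x) = (\<Prod>i<n. f (Suc i) ^ count_list xs (Suc i))"
proof (induction xs)
  case (Cons x xs)
  then obtain y where y: "x = Suc y" "y < n" by (cases x) auto
  have "(\<Prod>i<n. f (Suc i) ^ count_list (x # xs) (Suc i)) = (\<Prod>i<n. (if i = y then f x else 1) * f (Suc i) ^ count_list xs (Suc i))"
    using y by (intro prod.cong) auto
  then show ?case using Cons y by (simp add: prod.distrib)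
qed simp

lemma sum_count_list_Suc: "set xs \<subseteq> {1..n} \<Longrightarrow> (\<Sum>i<n. count_list xs (Suc i)) = length xs"
proof (induction xs)
  case (Cons x xs)
  then obtain y where y: "x = Suc y" "y < n" by (cases x) auto
  have "(\<Sum>i<n. count_list (x # xs) (Suc i)) = (\<Sum>i<n. (if i = y then 1 else 0) + count_list xs (Suc i))"
    using y by (intro sum.cong) auto
  then show ?case using Cons y by (simp add: sum.distrib)
qed simp

text \<open>Poisson splitting at the level of ordered samples: the factorials of the counts cancel
  between the Poisson weights and the number of orderings. What remains is the Poisson weight of the
  length times the product of the normalised rates along the list.\<close>

lemma shuffle_indep_pois:
  assumes nn: "\<And>r. r \<in> set rs \<Longrightarrow> 0 \<le> r" and S: "0 < sum_list rs"
  shows "bind_pmf (indep_pois rs) shuffle_pmf = poisson_samples (sum_list rs) (rate_pmf rs)"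
proof (rule pmf_eqI)
  fix xs
  let ?S = "sum_list rs" let ?n = "length rs"
  have rhs: "pmf (poisson_samples ?S (rate_pmf rs)) xs = ?S ^ length xs / fact (length xs) * exp (- ?S) * (\<Prod>x\<leftarrow>xs. pmf (rate_pmf rs) x)"
  proof -
    have "pmf (poisson_samples ?S (rate_pmf rs)) xs
      = (\<Sum>N\<in>{length xs}. pmf (replicate_pmf N (rate_pmf rs)) xs * pmf (poisson_pmf ?S) N)"
      unfolding poisson_samples_def pmf_bind
      by (intro integral_measure_pmf_real) (auto simp: pmf_replicate_pmf split: if_splits)
    then show ?thesis using S by (simp add: pmf_replicate_pmf)
  qed
  show "pmf (bind_pmf (indep_pois rs) shuffle_pmf) xs = pmf (poisson_samples ?S (rate_pmf rs)) xs"
  proof (cases "set xs \<subseteq> {1..?n}")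
    case False
    then obtain x where x: "x \<in> set xs" "x \<notin> {1..?n}" by blast
    then have "pmf (rate_pmf rs) x = 0" by (auto simp: pmf_rate_pmf[OF nn S])
    then have "(\<Prod>x\<leftarrow>xs. pmf (rate_pmf rs) x) = 0" using x by (auto simp: prod_list_zero_iff image_iff)
    moreover have "pmf (shuffle_pmf cs) xs = 0" if "cs \<in> set_pmf (indep_pois rs)" for cs
    proof -
      have "mset xs \<noteq> count_mset cs"
      proof
        assume "mset xs = count_mset cs"
        then have "set xs = set_mset (count_mset cs)" by (metis set_mset_mset)
        then show False using x set_count_mset[of cs] length_indep_pois[OF that] by auto
      qed
      then show ?thesis by (simp add: pmf_shuffle)
    qed
    then have "pmf (bind_pmf (indep_pois rs) shuffle_pmf) xs = 0"
      unfolding pmf_bind by (subst integral_cong_AE[where g = "\<lambda>_. 0"]) (auto intro!: AE_pmfI)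
    ultimately show ?thesis unfolding rhs by simp
  next
    case True
    \<comment> \<open>A sample determines its vector of counts, so a single term of the mixture
      survives.\<close>
    define cs where "cs = map (\<lambda>i. count_list xs (Suc i)) [0..<?n]"
    have len: "length cs = ?n" by (simp add: cs_def)
    have sl: "sum_list cs = length xs"
      using sum_count_list_Suc[OF True] by (simp add: cs_def sum_list_sum_nth atLeast0LessThan)
    have "pmf (bind_pmf (indep_pois rs) shuffle_pmf) xs = (\<Sum>cs\<in>{cs}. pmf (shuffle_pmf cs) xs * pmf (indep_pois rs) cs)"
      unfolding pmf_bind
    proof (intro integral_measure_pmf_real)
      fix cs' assume "cs' \<in> set_pmf (indep_pois rs)" "pmf (shuffle_pmf cs') xs \<noteq> 0"
      then show "cs' \<in> {cs}"
        using count_mset_eq_iff[OF length_indep_pois True] by (auto simp: pmf_shuffle cs_def split: if_splits)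
    qed simp
    also have "\<dots> = (\<Prod>i<?n. fact (cs ! i)) / fact (length xs) *
       ((\<Prod>i<?n. rs ! i ^ (cs ! i) / fact (cs ! i)) * exp (- ?S))"
      using count_mset_eq_iff[OF len True] nn len by (simp add: pmf_shuffle pmf_indep_pois sl cs_def[symmetric])
    also have "\<dots> = (\<Prod>i<?n. rs ! i ^ (cs ! i)) / fact (length xs) * exp (- ?S)"
    proof -
      have "(\<Prod>i<?n. fact (cs ! i) :: real) \<noteq> 0" by simp
      then show ?thesis by (simp add: prod_dividef)
    qed
    also have "(\<Prod>i<?n. rs ! i ^ (cs ! i)) = ?S ^ length xs * (\<Prod>x\<leftarrow>xs. pmf (rate_pmf rs) x)"
    proof -
      have "(\<Prod>x\<leftarrow>xs. pmf (rate_pmf rs) x) = (\<Prod>i<?n. (rs ! i / ?S) ^ count_list xs (Suc i))"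
        unfolding prod_list_by_count[OF True] by (intro prod.cong) (auto simp: pmf_rate_pmf[OF nn S])
      also have "\<dots> = (\<Prod>i<?n. rs ! i ^ (cs ! i)) / ?S ^ (\<Sum>i<?n. count_list xs (Suc i))"
        by (simp add: power_divide prod_dividef power_sum cs_def)
      finally show ?thesis using S by (simp add: sum_count_list_Suc[OF True])
    qed
    finally show ?thesis unfolding rhs by simp
  qed
qed

subsection \<open>Subsampling\<close>

lemma take_replicate_pmf: "k \<le> N \<Longrightarrow> map_pmf (take k) (replicate_pmf N a) = replicate_pmf k a"
proof (induction N arbitrary: k)
  case (Suc N)
  show ?case
  proof (cases k)
    case 0
    then show ?thesis by simp
  next
    case (Suc k')
    then have "map_pmf (take k) (replicate_pmf (Suc N) a) = bind_pmf a (\<lambda>x. map_pmf (\<lambda>xs. x # xs) (map_pmf (take k') (replicate_pmf N a)))"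
      by (simp add: map_pmf_def bind_assoc_pmf bind_return_pmf)
    also have "map_pmf (take k') (replicate_pmf N a) = replicate_pmf k' a" using Suc.IH[of k'] Suc.prems \<open>k = Suc k'\<close> by simp
    finally show ?thesis using \<open>k = Suc k'\<close> by (simp add: map_pmf_def)
  qed
qed simp

lemma nn_integral_power_poisson:
  assumes r: "0 < r" and z: "0 \<le> z"
  shows "(\<integral>\<^sup>+N. ennreal (z ^ N) \<partial>measure_pmf (poisson_pmf r)) = ennreal (exp (r * (z - 1)))"
proof -
  have s: "(\<lambda>N. z ^ N * pmf (poisson_pmf r) N) sums exp (r * (z - 1))"
  proof -
    have "(\<lambda>N. (z * r) ^ N /\<^sub>R fact N) sums exp (z * r)" by (rule exp_converges)
    then have "(\<lambda>N. (z * r) ^ N /\<^sub>R fact N * exp (- r)) sums (exp (z * r) * exp (- r))" by (rule sums_mult2)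
    moreover have "(z * r) ^ N /\<^sub>R fact N * exp (- r) = z ^ N * pmf (poisson_pmf r) N" for N
      using r by (simp add: power_mult_distrib field_simps)
    moreover have "exp (z * r) * exp (- r) = exp (r * (z - 1))" by (simp add: mult_exp_exp algebra_simps)
    ultimately show ?thesis by simp
  qed
  have "(\<integral>\<^sup>+N. ennreal (z ^ N) \<partial>measure_pmf (poisson_pmf r)) = (\<integral>\<^sup>+N. ennreal (z ^ N * pmf (poisson_pmf r) N) \<partial>count_space UNIV)"
    using z by (simp add: nn_integral_measure_pmf ennreal_mult' mult.commute)
  also have "\<dots> = (\<Sum>N. ennreal (z ^ N * pmf (poisson_pmf r) N))" by (rule nn_integral_count_space_nat)
  also have "\<dots> = ennreal (exp (r * (z - 1)))"
    using s z by (intro suminf_ennreal_eq) auto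
  finally show ?thesis .
qed

lemma nn_integral_pmf_expct:
  assumes "\<And>x. 0 \<le> \<phi> x \<and> \<phi> x \<le> 1"
  shows "(\<integral>\<^sup>+x. ennreal (\<phi> x) \<partial>measure_pmf p) = ennreal (expct p \<phi>)"
  using assms by (intro nn_integral_eq_integral integrable_pmf_bounded[of _ 1]) auto

text \<open>A Chernoff bound: the event N < k has indicator at most 100^(k - 1 - N). By independence
  the generating functions give the exponent 99 t - 99 S / 100, which is nonpositive for S at least
  100 t, and the shift by 1 leaves the factor 1/100, whatever the size of t.\<close>

lemma poisson_less_prob:
  assumes t: "0 < t" and S: "100 * t \<le> S"
  shows "expct (poisson_pmf t) (\<lambda>k. expct (poisson_pmf S) (\<lambda>N. of_bool (N < k))) \<le> 1 / 100"
proof -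
  let ?e = "expct (poisson_pmf t) (\<lambda>k. expct (poisson_pmf S) (\<lambda>N. of_bool (N < k)))"
  have S0: "0 < S" using t S by linarith
  have b: "0 \<le> expct (poisson_pmf S) (\<lambda>N. of_bool (N < k)) \<and> expct (poisson_pmf S) (\<lambda>N. of_bool (N < k)) \<le> 1" for k
    by (intro expct_bounds) auto
  have "ennreal ?e = (\<integral>\<^sup>+k. \<integral>\<^sup>+N. ennreal (of_bool (N < k)) \<partial>measure_pmf (poisson_pmf S) \<partial>measure_pmf (poisson_pmf t))"
    using b by (simp add: nn_integral_pmf_expct)
  also have "\<dots> \<le> (\<integral>\<^sup>+k. \<integral>\<^sup>+N. ennreal (100 ^ k / 100) * ennreal ((1 / 100) ^ N) \<partial>measure_pmf (poisson_pmf S) \<partial>measure_pmf (poisson_pmf t))"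
  proof (intro nn_integral_mono)
    fix k N :: nat
    have "of_bool (N < k) \<le> 100 ^ k / 100 * (1 / 100 :: real) ^ N"
    proof (cases "N < k")
      case True
      then have "(100 :: real) ^ Suc N \<le> 100 ^ k" by (intro power_increasing) auto
      then show ?thesis using True by (simp add: power_one_over field_simps)
    qed simp
    then show "ennreal (of_bool (N < k)) \<le> ennreal (100 ^ k / 100) * ennreal ((1 / 100) ^ N)"
      by (simp add: ennreal_mult'[symmetric] ennreal_leI del: power_one_over)
  qed
  also have "\<dots> = (\<integral>\<^sup>+k. ennreal (exp (S * (1 / 100 - 1)) / 100) * ennreal (100 ^ k) \<partial>measure_pmf (poisson_pmf t))"
  proof (intro nn_integral_cong)
    fix k
    have "(\<integral>\<^sup>+N. ennreal (100 ^ k / 100) * ennreal ((1 / 100) ^ N) \<partial>measure_pmf (poisson_pmf S))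
       = ennreal (100 ^ k / 100) * ennreal (exp (S * (1 / 100 - 1)))"
      by (subst nn_integral_cmult) (simp_all only: measurable_measure_pmf nn_integral_power_poisson[OF S0], auto)
    then show "(\<integral>\<^sup>+N. ennreal (100 ^ k / 100) * ennreal ((1 / 100) ^ N) \<partial>measure_pmf (poisson_pmf S))
       = ennreal (exp (S * (1 / 100 - 1)) / 100) * ennreal (100 ^ k)"
      by (simp add: ennreal_mult'[symmetric] mult.commute)
  qed
  also have "\<dots> = ennreal (exp (S * (1 / 100 - 1)) / 100) * ennreal (exp (t * (100 - 1)))"
    using nn_integral_power_poisson[OF t, of 100] by (subst nn_integral_cmult) auto
  also have "\<dots> = ennreal (exp (S * (1 / 100 - 1)) / 100 * exp (t * (100 - 1)))"
    by (rule ennreal_mult'[symmetric]) simp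
  finally have "?e \<le> exp (S * (1 / 100 - 1)) / 100 * exp (t * (100 - 1))"
    by (simp add: ennreal_le_iff)
  also have "\<dots> = exp (S * (1 / 100 - 1) + t * (100 - 1)) / 100"
    by (simp add: mult_exp_exp)
  also have "\<dots> \<le> exp 0 / 100" using S by (intro divide_right_mono) auto
  finally show ?thesis by simp
qed

text \<open>A list that is too short is kept whole; for Poisson samples this is the only source of
  deviation from Poi(t) samples.\<close>

definition subsample :: "real \<Rightarrow> nat list pmf \<Rightarrow> nat list pmf" where
  "subsample t p = bind_pmf p (\<lambda>xs. map_pmf (\<lambda>k. take k xs) (poisson_pmf t))"

text \<open>A coupling with the same k and N on both sides: the conditional expectations coincide
  unless N < k, an event of probability at most 1/100.\<close>

lemma subsample_close:
  fixes \<phi> :: "nat list \<Rightarrow> real"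
  assumes t: "0 < t" and S: "100 * t \<le> S" and \<phi>: "\<And>x. 0 \<le> \<phi> x \<and> \<phi> x \<le> 1"
  shows "\<bar>expct (subsample t (poisson_samples S a)) \<phi> - expct (poisson_samples t a) \<phi>\<bar> \<le> 1 / 100"
proof -
  let ?e1 = "\<lambda>k N. expct (replicate_pmf N a) (\<lambda>xs. \<phi> (take k xs))"
  let ?e2 = "\<lambda>k. expct (replicate_pmf k a) \<phi>"
  let ?b = "\<lambda>N k. of_bool (N < k) :: real"
  have e1: "0 \<le> ?e1 k N \<and> ?e1 k N \<le> 1" for k N using \<phi> by (intro expct_bounds) auto
  have e2: "0 \<le> ?e2 k \<and> ?e2 k \<le> 1" for k using \<phi> by (intro expct_bounds) auto
  have E1: "expct (subsample t (poisson_samples S a)) \<phi> = expct (poisson_pmf t) (\<lambda>k. expct (poisson_pmf S) (\<lambda>N. ?e1 k N))"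
  proof -
    have "subsample t (poisson_samples S a) = bind_pmf (poisson_pmf t) (\<lambda>k. bind_pmf (poisson_pmf S) (\<lambda>N. map_pmf (take k) (replicate_pmf N a)))"
      unfolding subsample_def poisson_samples_def bind_assoc_pmf map_pmf_def
      by (subst (2) bind_commute_pmf, subst bind_commute_pmf) (rule refl)
    then show ?thesis using \<phi> by (simp add: expct_bind)
  qed
  have E2: "expct (poisson_samples t a) \<phi> = expct (poisson_pmf t) (\<lambda>k. expct (poisson_pmf S) (\<lambda>N. ?e2 k))"
    unfolding poisson_samples_def using \<phi> by (simp add: expct_bind)
  have diff: "\<bar>?e1 k N - ?e2 k\<bar> \<le> ?b N k" for k N
  proof (cases "N < k")
    case False
    then have "?e1 k N = expct (map_pmf (take k) (replicate_pmf N a)) \<phi>" by simp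
    also have "\<dots> = ?e2 k" using False by (simp add: take_replicate_pmf)
    finally show ?thesis by simp
  qed (use e1[of N k] e2[of k] in \<open>auto simp: abs_le_iff\<close>)
  have int: "integrable (measure_pmf q) \<psi>" if "\<And>x. 0 \<le> \<psi> x \<and> \<psi> x \<le> 2" for q and \<psi> :: "nat \<Rightarrow> real"
    using that by (rule integrable_pmf_bounded)
  have ex: "0 \<le> expct q \<psi> \<and> expct q \<psi> \<le> 2" if "\<And>x. 0 \<le> \<psi> x \<and> \<psi> x \<le> 2" for q and \<psi> :: "nat \<Rightarrow> real"
  proof -
    have "expct q \<psi> \<le> expct q (\<lambda>_. 2)" using that by (intro integral_mono int) auto
    then show ?thesis using that by (auto intro!: integral_nonneg_AE)
  qed
  have dom: "expct (poisson_pmf t) (\<lambda>k. expct (poisson_pmf S) (f k)) \<le> expct (poisson_pmf t) (\<lambda>k. expct (poisson_pmf S) (g k)) + 1 / 100"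
    if f: "\<And>k N. 0 \<le> f k N \<and> f k N \<le> 1" and g: "\<And>k N. 0 \<le> g k N \<and> g k N \<le> 1"
      and le: "\<And>k N. f k N \<le> g k N + ?b N k" for f g
  proof -
    have gb: "0 \<le> g k N + ?b N k \<and> g k N + ?b N k \<le> 2" for k N using g[of k N] by auto
    have f2: "0 \<le> f k N \<and> f k N \<le> 2" for k N using f[of k N] by auto
    have b2: "0 \<le> ?b N k \<and> ?b N k \<le> 2" for k N by auto
    have g2: "0 \<le> g k N \<and> g k N \<le> 2" for k N using g[of k N] by auto
    have "expct (poisson_pmf t) (\<lambda>k. expct (poisson_pmf S) (f k)) \<le> expct (poisson_pmf t) (\<lambda>k. expct (poisson_pmf S) (\<lambda>N. g k N + ?b N k))"
      by (intro integral_mono int ex f2 gb le)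
    also have "\<dots> = expct (poisson_pmf t) (\<lambda>k. expct (poisson_pmf S) (g k) + expct (poisson_pmf S) (\<lambda>N. ?b N k))"
      by (intro arg_cong[where f = "expct (poisson_pmf t)"] ext Bochner_Integration.integral_add int g2 b2)
    also have "\<dots> = expct (poisson_pmf t) (\<lambda>k. expct (poisson_pmf S) (g k)) + expct (poisson_pmf t) (\<lambda>k. expct (poisson_pmf S) (\<lambda>N. ?b N k))"
      by (intro Bochner_Integration.integral_add int ex g2 b2)
    also have "\<dots> \<le> expct (poisson_pmf t) (\<lambda>k. expct (poisson_pmf S) (g k)) + 1 / 100"
      using poisson_less_prob[OF t S] by simp
    finally show ?thesis .
  qed
  have "expct (subsample t (poisson_samples S a)) \<phi> \<le> expct (poisson_samples t a) \<phi> + 1 / 100"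
    unfolding E1 E2 using diff by (intro dom e1 e2) (simp add: abs_le_iff algebra_simps)
  moreover have "expct (poisson_samples t a) \<phi> \<le> expct (subsample t (poisson_samples S a)) \<phi> + 1 / 100"
    unfolding E1 E2 using diff by (intro dom e1 e2) (simp add: abs_le_iff algebra_simps)
  ultimately show ?thesis by linarith
qed

lemma expct_pair_swap:
  fixes \<phi> :: "'a \<times> 'b \<Rightarrow> real"
  assumes b: "\<And>x. 0 \<le> \<phi> x \<and> \<phi> x \<le> 1"
  shows "expct (pair_pmf p q) \<phi> = expct q (\<lambda>y. expct p (\<lambda>x. \<phi> (x, y)))"
  unfolding pair_pmf_def by (subst bind_commute_pmf) (use b in \<open>simp add: expct_bind\<close>)

lemma subsample_pair_close:
  fixes \<phi> :: "nat list \<times> nat list \<Rightarrow> real"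
  assumes t: "0 < t" and S: "100 * t \<le> S" "100 * t \<le> S'" and \<phi>: "\<And>x. 0 \<le> \<phi> x \<and> \<phi> x \<le> 1"
  shows "\<bar>expct (pair_pmf (subsample t (poisson_samples S a)) (subsample t (poisson_samples S' b))) \<phi>
     - expct (pair_pmf (poisson_samples t a) (poisson_samples t b)) \<phi>\<bar> \<le> 1 / 50"
proof -
  let ?p = "subsample t (poisson_samples S a)" let ?q = "subsample t (poisson_samples S' b)"
  let ?p' = "poisson_samples t a" let ?q' = "poisson_samples t b"
  have "\<bar>expct (pair_pmf ?p ?q) \<phi> - expct (pair_pmf ?p' ?q) \<phi>\<bar> \<le> 1 / 100"
    unfolding expct_pair[OF \<phi>] by (intro subsample_close[OF t S(1)] expct_bounds \<phi>)
  moreover have "\<bar>expct (pair_pmf ?p' ?q) \<phi> - expct (pair_pmf ?p' ?q') \<phi>\<bar> \<le> 1 / 100"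
    unfolding expct_pair_swap[OF \<phi>] by (intro subsample_close[OF t S(2)] expct_bounds \<phi>)
  ultimately show ?thesis by linarith
qed

section \<open>Properties of the random rates\<close>

lemma expct_const_le:
  fixes \<phi> :: "'a \<Rightarrow> real"
  assumes "\<And>x. 0 \<le> \<phi> x \<and> \<phi> x \<le> 1" "\<And>x. x \<in> set_pmf p \<Longrightarrow> c \<le> \<phi> x"
  shows "c \<le> expct p \<phi>"
proof -
  have "expct p (\<lambda>_. c) \<le> expct p \<phi>"
    using assms by (intro integral_mono_AE integrable_pmf_bounded[of \<phi> 1]) (auto simp: AE_measure_pmf_iff)
  then show ?thesis by simp
qed

lemma rate_prior_cases:
  assumes "z \<in> set_pmf (rate_prior same \<theta>)"
  shows "z = (1, 1) \<or> z = (\<theta>, if same then \<theta> else 0) \<or> z = (0, if same then 0 else \<theta>)"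
  using assms by (auto simp: rate_prior_def split: if_splits)

lemma set_replicate_rate_prior:
  assumes "AB \<in> set_pmf (replicate_pmf m (rate_prior same \<theta>))"
  shows "length AB = m" "\<And>z. z \<in> set AB \<Longrightarrow> z \<in> set_pmf (rate_prior same \<theta>)"
  using assms by (auto simp: set_replicate_pmf)

text \<open>Markov's inequality in integrated form: the truncated quantity is at least the indicator
  of more than 1/K heavy elements, and stays bounded, hence integrable.\<close>

lemma expct_heavy_count:
  fixes K :: real
  assumes \<theta>: "0 \<le> \<theta>" "\<theta> < 1" and K: "0 \<le> K"
  shows "expct (replicate_pmf m (rate_prior same \<theta>)) (\<lambda>AB. min 1 (K * length (filter (\<lambda>z. z = (1, 1)) AB)))
     \<le> K * (m * (\<theta> / 200))"
proof (induction m)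
  case (Suc m)
  let ?N = "\<lambda>AB. real (length (filter (\<lambda>z. z = (1 :: real, 1 :: real)) AB))"
  let ?\<psi> = "\<lambda>AB. min 1 (K * ?N AB)"
  let ?h = "\<lambda>z. of_bool (z = (1 :: real, 1 :: real)) :: real"
  have psi: "0 \<le> ?\<psi> AB \<and> ?\<psi> AB \<le> 1" for AB using K by auto
  have e: "0 \<le> expct p ?\<psi> \<and> expct p ?\<psi> \<le> 1" for p by (intro expct_bounds psi)
  have "expct (replicate_pmf (Suc m) (rate_prior same \<theta>)) ?\<psi>
     = expct (rate_prior same \<theta>) (\<lambda>z. expct (replicate_pmf m (rate_prior same \<theta>)) (\<lambda>AB. ?\<psi> (z # AB)))"
    unfolding replicate_pmf.simps by (simp only: expct_bind[OF psi] expectation_return_pmf)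
  also have "\<dots> \<le> expct (rate_prior same \<theta>) (\<lambda>z. K * ?h z + expct (replicate_pmf m (rate_prior same \<theta>)) ?\<psi>)"
  proof (rule expct_mono[where B = "K + 1"])
    fix z
    have "expct (replicate_pmf m (rate_prior same \<theta>)) (\<lambda>AB. ?\<psi> (z # AB))
       \<le> expct (replicate_pmf m (rate_prior same \<theta>)) (\<lambda>AB. K * ?h z + ?\<psi> AB)"
      using K psi by (intro expct_mono[where B = "K + 1"]) (auto simp: algebra_simps min_def add_increasing)
    also have "\<dots> = K * ?h z + expct (replicate_pmf m (rate_prior same \<theta>)) ?\<psi>"
      using psi by (subst Bochner_Integration.integral_add) (auto intro!: integrable_pmf_bounded[of _ 1])
    finally show "expct (replicate_pmf m (rate_prior same \<theta>)) (\<lambda>AB. ?\<psi> (z # AB))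
       \<le> K * ?h z + expct (replicate_pmf m (rate_prior same \<theta>)) ?\<psi>" .
    have "0 \<le> expct (replicate_pmf m (rate_prior same \<theta>)) (\<lambda>AB. ?\<psi> (z # AB)) \<and>
       expct (replicate_pmf m (rate_prior same \<theta>)) (\<lambda>AB. ?\<psi> (z # AB)) \<le> 1"
      by (intro expct_bounds psi)
    then show "0 \<le> expct (replicate_pmf m (rate_prior same \<theta>)) (\<lambda>AB. ?\<psi> (z # AB)) \<and>
       expct (replicate_pmf m (rate_prior same \<theta>)) (\<lambda>AB. ?\<psi> (z # AB)) \<le> K + 1"
      using K by linarith
    show "0 \<le> K * ?h z + expct (replicate_pmf m (rate_prior same \<theta>)) ?\<psi> \<and>
       K * ?h z + expct (replicate_pmf m (rate_prior same \<theta>)) ?\<psi> \<le> K + 1"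
      using K e[of "replicate_pmf m (rate_prior same \<theta>)"] by auto
  qed
  also have "\<dots> = K * expct (rate_prior same \<theta>) ?h + expct (replicate_pmf m (rate_prior same \<theta>)) ?\<psi>"
    by (subst Bochner_Integration.integral_add) (auto intro!: integrable_mult_right integrable_pmf_bounded[of _ 1])
  also have "expct (rate_prior same \<theta>) ?h = \<theta> / 200"
    unfolding rate_prior_def using \<theta> by (simp add: expct_bind)
  also have "K * (\<theta> / 200) + expct (replicate_pmf m (rate_prior same \<theta>)) ?\<psi> \<le> K * (\<theta> / 200) + K * (m * (\<theta> / 200))"
    using Suc.IH by simp
  finally show ?case by (simp add: algebra_simps)
qed simp

lemma indep_pois_snoc: "indep_pois (rs @ [d]) = bind_pmf (indep_pois rs) (\<lambda>cs. map_pmf (\<lambda>c. cs @ [c]) (pois d))"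
  by (induction rs) (simp_all add: map_pmf_def bind_assoc_pmf bind_return_pmf)

text \<open>An extra element of known rate \<open>d\<close> keeps the random total rate above \<open>100 t\<close>; the parties
  then keep only the first \<open>Poi(t)\<close> of their samples, which removes the dependence on that total.\<close>

definition samples_of_counts :: "real \<Rightarrow> real \<Rightarrow> nat list \<Rightarrow> nat list pmf" where
  "samples_of_counts d t cs = subsample t (bind_pmf (pois d) (\<lambda>c. shuffle_pmf (cs @ [c])))"

lemma samples_of_indep_pois:
  assumes "\<And>r. r \<in> set rs \<Longrightarrow> 0 \<le> r" "0 < d"
  shows "bind_pmf (indep_pois rs) (samples_of_counts d t)
    = subsample t (poisson_samples (sum_list (rs @ [d])) (rate_pmf (rs @ [d])))"
proof -
  have "0 \<le> sum_list rs" using assms(1) by (intro sum_list_nonneg)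
  then have "bind_pmf (indep_pois (rs @ [d])) shuffle_pmf = poisson_samples (sum_list (rs @ [d])) (rate_pmf (rs @ [d]))"
    using assms by (intro shuffle_indep_pois) auto
  moreover have "bind_pmf (indep_pois rs) (samples_of_counts d t) = subsample t (bind_pmf (indep_pois (rs @ [d])) shuffle_pmf)"
    by (simp add: samples_of_counts_def[abs_def] subsample_def indep_pois_snoc bind_assoc_pmf bind_map_pmf)
  ultimately show ?thesis by simp
qed

lemma distribution_on_rate_pmf:
  assumes "\<And>r. r \<in> set rs \<Longrightarrow> 0 \<le> r" "0 < sum_list rs"
  shows "distribution_on (length rs) (rate_pmf rs)"
  unfolding distribution_on_def using pmf_rate_pmf[OF assms] by (auto simp: set_pmf_iff split: if_splits)

text \<open>Every light element has rate \<theta> for one party and 0 for the other. The two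
  normalising totals differ, so both are replaced by the common upper bound U; each light element
  then contributes at least \<theta> / U to the distance.\<close>

lemma l1_dist_rate_pmf:
  assumes AB: "AB \<in> set_pmf (replicate_pmf m (rate_prior False \<theta>))" and \<theta>: "0 < \<theta>" "\<theta> < 1" and m: "0 < m"
    and H: "length (filter (\<lambda>z. z = (1, 1)) AB) \<le> m * \<theta> / 4"
  defines "d \<equiv> m * \<theta> / 4"
  shows "1 / 2 \<le> l1_dist (Suc m) (rate_pmf (map fst AB @ [d])) (rate_pmf (map snd AB @ [d]))"
proof -
  have len: "length AB = m" and cs: "\<And>z. z \<in> set AB \<Longrightarrow> z = (1, 1) \<or> z = (\<theta>, 0) \<or> z = (0, \<theta>)"
    using set_replicate_rate_prior[OF AB] rate_prior_cases[of _ False \<theta>] by auto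
  let ?A = "map fst AB @ [d]" let ?B = "map snd AB @ [d]"
  define h where "h = (\<lambda>i. of_bool (AB ! i = (1, 1)) :: real)"
  define N where "N = (\<Sum>i<m. h i)"
  have N: "N = length (filter (\<lambda>z. z = (1, 1)) AB)"
    unfolding N_def h_def len[symmetric] length_filter_conv_card
    by (simp add: sum.inter_filter[symmetric] of_bool_def lessThan_def Collect_conj_eq)
  have d: "0 < d" using \<theta> m by (simp add: d_def)
  define U where "U = d + N + (m - N) * \<theta>"
  have nth: "AB ! i = (1, 1) \<or> AB ! i = (\<theta>, 0) \<or> AB ! i = (0, \<theta>)" if "i < m" for i
    using cs[of "AB ! i"] that len by simp
  have sumU: "(\<Sum>i<m. h i + (1 - h i) * \<theta>) = N + (m - N) * \<theta>"
    by (simp add: N_def sum.distrib sum_subtractf sum_distrib_right[symmetric])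
  have SA: "sum_list ?A = (\<Sum>i<m. fst (AB ! i)) + d" "sum_list ?B = (\<Sum>i<m. snd (AB ! i)) + d"
  proof -
    have "sum_list (map fst AB) = (\<Sum>i<m. fst (AB ! i))" "sum_list (map snd AB) = (\<Sum>i<m. snd (AB ! i))"
      by (subst sum_list_sum_nth, simp add: len atLeast0LessThan)+
    then show "sum_list ?A = (\<Sum>i<m. fst (AB ! i)) + d" "sum_list ?B = (\<Sum>i<m. snd (AB ! i)) + d" by simp_all
  qed
  have A0: "0 \<le> (\<Sum>i<m. fst (AB ! i))" "0 \<le> (\<Sum>i<m. snd (AB ! i))"
  proof -
    have "0 \<le> fst (AB ! i) \<and> 0 \<le> snd (AB ! i)" if "i < m" for i using nth[OF that] \<theta> by auto
    then show "0 \<le> (\<Sum>i<m. fst (AB ! i))" "0 \<le> (\<Sum>i<m. snd (AB ! i))" by (auto intro!: sum_nonneg)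
  qed
  have "(\<Sum>i<m. fst (AB ! i)) \<le> (\<Sum>i<m. h i + (1 - h i) * \<theta>)" "(\<Sum>i<m. snd (AB ! i)) \<le> (\<Sum>i<m. h i + (1 - h i) * \<theta>)"
    using \<theta> by (auto intro!: sum_mono simp: h_def dest!: nth)
  then have SU: "sum_list ?A \<le> U" "sum_list ?B \<le> U" unfolding SA U_def sumU by auto
  have Sp: "0 < sum_list ?A" "0 < sum_list ?B" unfolding SA using A0 d by auto
  have nn: "\<And>r. r \<in> set ?A \<Longrightarrow> 0 \<le> r" "\<And>r. r \<in> set ?B \<Longrightarrow> 0 \<le> r" using cs d \<theta> by fastforce+
  have term_ge: "(1 - h i) * (\<theta> / U) \<le> \<bar>pmf (rate_pmf ?A) (Suc i) - pmf (rate_pmf ?B) (Suc i)\<bar>" if i: "i < m" for i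
  proof -
    have pA: "pmf (rate_pmf ?A) (Suc i) = fst (AB ! i) / sum_list ?A" and pB: "pmf (rate_pmf ?B) (Suc i) = snd (AB ! i) / sum_list ?B"
      using i len by (simp_all only: pmf_rate_pmf[OF nn(1) Sp(1)] pmf_rate_pmf[OF nn(2) Sp(2)]) (simp_all add: nth_append)
    have "\<theta> / U \<le> \<theta> / sum_list ?A" "\<theta> / U \<le> \<theta> / sum_list ?B" using \<theta> SU Sp by (auto intro!: divide_left_mono mult_pos_pos)
    moreover have "0 \<le> \<theta> / sum_list ?A" "0 \<le> \<theta> / sum_list ?B" using \<theta> Sp by auto
    ultimately show ?thesis unfolding pA pB using nth[OF i] \<theta> Sp by (auto simp: h_def abs_of_pos)
  qed
  \<comment> \<open>U consists of the light part \<open>(m - N) * \<theta>\<close> and of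
    \<open>d + N\<close>. The latter is at most m \<theta> / 2 and the former at least 3 m \<theta>
    / 4, so the light part is more than half of U.\<close>
  have "1 / 2 \<le> (m - N) * \<theta> / U"
  proof -
    have Nd: "N \<le> d" using H by (simp add: N d_def)
    have "N * \<theta> \<le> N" using \<theta> by (simp add: N mult_left_le)
    then have "d + N \<le> (m - N) * \<theta>" using Nd d by (simp add: d_def algebra_simps)
    moreover have "0 < U" using SU Sp by linarith
    ultimately show ?thesis by (simp add: U_def field_simps)
  qed
  also have "\<dots> = (\<Sum>i<m. (1 - h i) * (\<theta> / U))"
    by (simp only: sum_distrib_right[symmetric]) (simp add: N_def sum_subtractf)
  also have "\<dots> \<le> (\<Sum>i<m. \<bar>pmf (rate_pmf ?A) (Suc i) - pmf (rate_pmf ?B) (Suc i)\<bar>)"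
    by (intro sum_mono term_ge) auto
  also have "\<dots> = (\<Sum>i\<in>{1..m}. \<bar>pmf (rate_pmf ?A) i - pmf (rate_pmf ?B) i\<bar>)"
    by (rule sum.reindex_bij_witness[where j = Suc and i = "\<lambda>i. i - 1"]) auto
  also have "\<dots> \<le> l1_dist (Suc m) (rate_pmf ?A) (rate_pmf ?B)"
    unfolding l1_dist_def by (intro sum_mono2) auto
  finally show ?thesis .
qed

section \<open>The lower bound\<close>

definition hard_inputs :: "nat \<Rightarrow> real \<Rightarrow> real \<Rightarrow> bool \<Rightarrow> (nat list \<times> nat list) pmf" where
  "hard_inputs m \<theta> t same = bind_pmf (replicate_pmf m (pair_counts same \<theta>)) (\<lambda>cs.
     pair_pmf (samples_of_counts (m * \<theta> / 4) t (map fst cs)) (samples_of_counts (m * \<theta> / 4) t (map snd cs)))"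

text \<open>Exhibits the hard inputs as a mixture over pairs (a, b), so that the guarantee of the
  protocol can be applied to each fixed pair of rate lists.\<close>

lemma hard_inputs_eq_mixture:
  "hard_inputs m \<theta> t same = bind_pmf (replicate_pmf m (rate_prior same \<theta>)) (\<lambda>AB.
     pair_pmf (bind_pmf (indep_pois (map fst AB)) (samples_of_counts (m * \<theta> / 4) t))
              (bind_pmf (indep_pois (map snd AB)) (samples_of_counts (m * \<theta> / 4) t)))"
proof -
  let ?s = "samples_of_counts (m * \<theta> / 4) t"
  have "bind_pmf p (\<lambda>xs. bind_pmf q (\<lambda>ys. pair_pmf (?s xs) (?s ys))) = pair_pmf (bind_pmf p ?s) (bind_pmf q ?s)" for p q
    unfolding pair_pmf_def bind_assoc_pmf by (rule bind_pmf_cong[OF refl], rule bind_commute_pmf)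
  then show ?thesis
    unfolding hard_inputs_def
    by (subst replicate_pair_counts[where K = "\<lambda>xs ys. pair_pmf (?s xs) (?s ys)"]) simp
qed

lemma map_map2_split:
  "map fst (map2 (\<lambda>r z. (f r (fst z), g r (snd z))) rs zs) = map2 f rs (map fst zs)"
  "map snd (map2 (\<lambda>r z. (f r (fst z), g r (snd z))) rs zs) = map2 g rs (map snd zs)"
  by (induction rs zs rule: list_induct2') auto

text \<open>The other view of the same inputs: once \<open>rs\<close> is fixed, each party computes
  its counts from its own bits, and its later sampling steps are private. The inequality is linear
  in both acceptance probabilities and survives averaging over \<open>rs\<close>.\<close>

lemma hard_inputs_bound:
  fixes M :: "(nat list, nat list) protocol measure"
  assumes \<theta>: "0 < \<theta>" "\<theta> \<le> 1 / 1800" and M: "randomized_protocol M" and C: "uses_at_most_bits M C"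
  shows "ln 2 * expct (hard_inputs m \<theta> t True) (accept_prob M)
     - 3 / 4 * expct (hard_inputs m \<theta> t False) (accept_prob M) - 1 / 12 \<le> 54 * (900 * \<theta>)\<^sup>2 * C * ln 2"
proof -
  let ?s = "samples_of_counts (m * \<theta> / 4) t"
  let ?f = "\<lambda>r u. if u then snd (fst r) else fst (fst r) :: nat"
  let ?g = "\<lambda>r v. if v then snd (snd r) else fst (snd r) :: nat"
  obtain R :: "((nat \<times> nat) \<times> (nat \<times> nat)) pmf" where R: "\<And>same. pair_counts same \<theta> = bind_pmf R (\<lambda>r. map_pmf
       (\<lambda>z. (?f r (fst z), ?g r (snd z))) (bits_pmf (if same then 900 * \<theta> else 0)))"
    using pair_counts_noisy_bits[OF \<theta>] by blast
  let ?\<alpha> = "\<lambda>rs us. ?s (map2 ?f rs us)" let ?\<beta> = "\<lambda>rs vs. ?s (map2 ?g rs vs)"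
  have eq: "hard_inputs m \<theta> t same = bind_pmf (replicate_pmf m R) (\<lambda>rs.
     noisy_inputs m (?\<alpha> rs) (?\<beta> rs) (if same then 900 * \<theta> else 0))" for same
    unfolding hard_inputs_def R replicate_pmf_bind_map noisy_inputs_def bind_assoc_pmf bind_map_pmf
      map_map2_split[of ?f ?g] ..
  note acc = accept_prob_bounds[OF M]
  let ?E = "\<lambda>\<epsilon> rs. expct (noisy_inputs m (?\<alpha> rs) (?\<beta> rs) \<epsilon>) (accept_prob M)"
  have int: "integrable (measure_pmf q) (?E \<epsilon>)" for q \<epsilon>
    by (intro integrable_pmf_bounded[of _ 1] expct_bounds acc)
  have E: "expct (hard_inputs m \<theta> t same) (accept_prob M) = expct (replicate_pmf m R) (?E (if same then 900 * \<theta> else 0))" for same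
    unfolding eq by (rule expct_bind[OF acc])
  have "expct (replicate_pmf m R) (\<lambda>rs. ln 2 * ?E (900 * \<theta>) rs - 3 / 4 * ?E 0 rs - 1 / 12)
     \<le> expct (replicate_pmf m R) (\<lambda>rs. 54 * (900 * \<theta>)\<^sup>2 * C * ln 2)"
    using \<theta> int by (intro integral_mono randomized_bits_bound M C) auto
  then show ?thesis using int by (simp add: E)
qed

lemma communication_bound:
  fixes M :: "(nat list, nat list) protocol measure" and t :: real
  assumes n: "2 \<le> n" and t: "0 < t" "1440000 * t \<le> n"
    and M: "randomized_protocol M" and D: "distinguishes n t M" and C: "uses_at_most_bits M C"
  shows "real n ^ 2 / t ^ 2 / 10 ^ 16 \<le> C"
proof -
  \<comment> \<open>Element n is reserved for the known rate d; the other n - 1 carry the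
    gadget.\<close>
  define m where "m = n - 1"
  have m: "0 < m" "n = Suc m" "real n \<le> 2 * real m" using n by (auto simp: m_def)
  \<comment> \<open>Chosen so that d = m \<theta> / 4 is 100 t, as subsampling requires. The bound
    1/1800 on \<theta> makes 900 \<theta> at most 1/2, and it is the origin of 1440000 = 800 *
    1800.\<close>
  define \<theta> where "\<theta> = 400 * t / m"
  define d where "d = m * \<theta> / 4"
  have d: "d = 100 * t" using m by (simp add: d_def \<theta>_def)
  have \<theta>0: "0 < \<theta>" using t m by (simp add: \<theta>_def)
  have \<theta>n: "\<theta> \<le> 800 * t / n"
    using m t by (simp add: \<theta>_def field_simps)
  also have "\<dots> \<le> 1 / 1800" using t m by (simp add: field_simps)
  finally have \<theta>1: "\<theta> \<le> 1 / 1800" .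
  note acc = accept_prob_bounds[OF M]
  have rates: "length AB = m" "\<And>r. r \<in> set (map fst AB) \<Longrightarrow> 0 \<le> r" "\<And>r. r \<in> set (map snd AB) \<Longrightarrow> 0 \<le> r"
    if "AB \<in> set_pmf (replicate_pmf m (rate_prior same \<theta>))" for AB same
    using set_replicate_rate_prior[OF that] rate_prior_cases[of _ same \<theta>] \<theta>0 by fastforce+
  let ?in = "\<lambda>AB. pair_pmf (bind_pmf (indep_pois (map fst AB)) (samples_of_counts d t))
              (bind_pmf (indep_pois (map snd AB)) (samples_of_counts d t))"
  have hard: "expct (hard_inputs m \<theta> t same) (accept_prob M)
    = expct (replicate_pmf m (rate_prior same \<theta>)) (\<lambda>AB. expct (?in AB) (accept_prob M))" for same
    unfolding hard_inputs_eq_mixture d_def[symmetric] by (rule expct_bind[OF acc])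
  let ?a = "\<lambda>AB. rate_pmf (map fst AB @ [d])" let ?b = "\<lambda>AB. rate_pmf (map snd AB @ [d])"
  have close: "\<bar>expct (?in AB) (accept_prob M) - output_prob t (?a AB) (?b AB) M True\<bar> \<le> 1 / 50"
    and dist: "distribution_on n (?a AB)" "distribution_on n (?b AB)"
    if AB: "AB \<in> set_pmf (replicate_pmf m (rate_prior same \<theta>))" for AB same
  proof -
    have s: "0 \<le> sum_list (map fst AB)" "0 \<le> sum_list (map snd AB)"
      using rates[OF AB] by (auto intro!: sum_list_nonneg)
    have d0: "0 < d" using d t by simp
    have S: "100 * t \<le> sum_list (map fst AB @ [d])" "100 * t \<le> sum_list (map snd AB @ [d])" using s d by auto
    show "\<bar>expct (?in AB) (accept_prob M) - output_prob t (?a AB) (?b AB) M True\<bar> \<le> 1 / 50"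
    proof -
      have eq: "bind_pmf (indep_pois (map fst AB)) (samples_of_counts d t) = subsample t (poisson_samples (sum_list (map fst AB @ [d])) (?a AB))"
        "bind_pmf (indep_pois (map snd AB)) (samples_of_counts d t) = subsample t (poisson_samples (sum_list (map snd AB @ [d])) (?b AB))"
        by (rule samples_of_indep_pois[OF _ d0], erule rates[OF AB])+
      show ?thesis
        unfolding eq output_prob_True[OF M] by (rule subsample_pair_close[OF t(1) S acc])
    qed
    have len: "length (map fst AB @ [d]) = n" "length (map snd AB @ [d]) = n" using rates(1)[OF AB] m by auto
    have nn: "\<And>r. r \<in> set (map fst AB @ [d]) \<Longrightarrow> 0 \<le> r" "\<And>r. r \<in> set (map snd AB @ [d]) \<Longrightarrow> 0 \<le> r"
      unfolding set_append using rates(2)[OF AB] rates(3)[OF AB] d0 by (metis Un_iff empty_iff less_imp_le list.set(1,2) insert_iff)+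
    have Sp: "0 < sum_list (map fst AB @ [d])" "0 < sum_list (map snd AB @ [d])" using S t by linarith+
    show "distribution_on n (?a AB)" using distribution_on_rate_pmf[OF nn(1) Sp(1)] unfolding len .
    show "distribution_on n (?b AB)" using distribution_on_rate_pmf[OF nn(2) Sp(2)] unfolding len .
  qed
  have in01: "0 \<le> expct (?in AB) (accept_prob M) \<and> expct (?in AB) (accept_prob M) \<le> 1" for AB
    by (intro expct_bounds acc)
  \<comment> \<open>The loss 1/50 is the subsampling error of the two parties together.\<close>
  have yes: "2 / 3 - 1 / 50 \<le> expct (hard_inputs m \<theta> t True) (accept_prob M)"
    unfolding hard
  proof (rule expct_const_le)
    fix AB assume AB: "AB \<in> set_pmf (replicate_pmf m (rate_prior True \<theta>))"
    have "map fst AB = map snd AB"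
      using set_replicate_rate_prior[OF AB] rate_prior_cases[of _ True \<theta>] by (intro map_cong refl) fastforce
    then have "?a AB = ?b AB" by (simp only:)
    then have "2 / 3 \<le> output_prob t (?a AB) (?b AB) M True"
      using D dist[OF AB] unfolding distinguishes_def by metis
    then show "2 / 3 - 1 / 50 \<le> expct (?in AB) (accept_prob M)" using close[OF AB] by linarith
  qed (rule in01)
  let ?H = "\<lambda>AB. real (length (filter (\<lambda>z. z = (1 :: real, 1 :: real)) AB))"
  let ?\<psi> = "\<lambda>AB. min 1 (4 / (m * \<theta>) * ?H AB)"
  have \<psi>: "0 \<le> ?\<psi> AB \<and> ?\<psi> AB \<le> 1" for AB using \<theta>0 m by auto
  \<comment> \<open>One 1/50 is the subsampling error; the other bounds the expectation of
    \<open>?\<psi>\<close>, which pays for rate lists with too many heavy elements, where a and b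
    need not be far apart.\<close>
  have no: "expct (hard_inputs m \<theta> t False) (accept_prob M) \<le> 1 / 3 + 1 / 50 + 1 / 50"
  proof -
    have "expct (hard_inputs m \<theta> t False) (accept_prob M)
       \<le> expct (replicate_pmf m (rate_prior False \<theta>)) (\<lambda>AB. (1 / 3 + 1 / 50) + ?\<psi> AB)"
      unfolding hard
    proof (rule expct_mono[where B = 2])
      fix AB assume AB: "AB \<in> set_pmf (replicate_pmf m (rate_prior False \<theta>))"
      show "expct (?in AB) (accept_prob M) \<le> (1 / 3 + 1 / 50) + ?\<psi> AB"
      proof (cases "?H AB \<le> m * \<theta> / 4")
        case True
        have "1 / 2 \<le> l1_dist n (?a AB) (?b AB)"
          unfolding m(2) d_def using \<theta>0 \<theta>1 m True by (intro l1_dist_rate_pmf AB) auto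
        then have "2 / 3 \<le> output_prob t (?a AB) (?b AB) M False"
          using D dist[OF AB] unfolding distinguishes_def by metis
        then have "output_prob t (?a AB) (?b AB) M True \<le> 1 / 3"
          unfolding output_prob_True[OF M] output_prob_False[OF M] by simp
        then show ?thesis using close[OF AB] \<psi>[of AB] by linarith
      next
        case False
        then have "1 \<le> 4 / (m * \<theta>) * ?H AB" using \<theta>0 m by (simp add: field_simps)
        then show ?thesis using in01[of AB] by simp
      qed
    next
      fix AB
      show "0 \<le> expct (?in AB) (accept_prob M) \<and> expct (?in AB) (accept_prob M) \<le> 2" using in01[of AB] by linarith
      show "0 \<le> (1 / 3 + 1 / 50) + ?\<psi> AB \<and> (1 / 3 + 1 / 50) + ?\<psi> AB \<le> 2" using \<psi>[of AB] by linarith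
    qed
    also have "\<dots> = (1 / 3 + 1 / 50) + expct (replicate_pmf m (rate_prior False \<theta>)) ?\<psi>"
      using \<psi> by (subst Bochner_Integration.integral_add) (auto intro!: integrable_pmf_bounded[of _ 1])
    also have "expct (replicate_pmf m (rate_prior False \<theta>)) ?\<psi> \<le> 4 / (m * \<theta>) * (m * (\<theta> / 200))"
      using \<theta>0 \<theta>1 by (intro expct_heavy_count) auto
    also have "4 / (m * \<theta>) * (m * (\<theta> / 200)) = 1 / 50" using \<theta>0 m by simp
    finally show ?thesis by simp
  qed
  have "2 / 3 * (2 / 3 - 1 / 50) \<le> ln 2 * expct (hard_inputs m \<theta> t True) (accept_prob M)"
    using yes ln2_ge_two_thirds by (intro mult_mono) auto
  then have lower: "97 / 225 \<le> ln 2 * expct (hard_inputs m \<theta> t True) (accept_prob M)" by simp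
  \<comment> \<open>Numerically 97/225 exceeds 0.43, while the subtracted terms are 3/4 * 28/75 =
    0.28 and 1/12, so more than 0.06 remains.\<close>
  have "1 / 20 \<le> 54 * (900 * \<theta>)\<^sup>2 * C * ln 2"
  proof -
    have "1 / 20 \<le> z" if "97 / 225 \<le> x" "x - 3 / 4 * y - 1 / 12 \<le> z" "y \<le> 1 / 3 + 1 / 50 + 1 / 50"
      for x y z :: real using that by linarith
    from this[OF lower hard_inputs_bound[OF \<theta>0 \<theta>1 M C] no] show ?thesis .
  qed
  also have "\<dots> \<le> 54 * (900 * \<theta>)\<^sup>2 * C * 1"
    using ln_2_less_1 by (intro mult_left_mono) auto
  also have "\<dots> = 43740000 * \<theta>\<^sup>2 * C" by (simp add: power_mult_distrib)
  also have "\<dots> \<le> 43740000 * (800 * t / n)\<^sup>2 * C"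
    using \<theta>n \<theta>0 by (intro mult_right_mono mult_left_mono power_mono) auto
  finally have "1 / 20 \<le> 27993600000000 * (C * (t\<^sup>2 / (real n)\<^sup>2))"
    by (simp add: power_mult_distrib power_divide mult_ac)
  then have "(real n)\<^sup>2 / t\<^sup>2 * (1 / 20) \<le> (real n)\<^sup>2 / t\<^sup>2 * (27993600000000 * (C * (t\<^sup>2 / (real n)\<^sup>2)))"
    by (intro mult_left_mono) auto
  also have "\<dots> = 27993600000000 * C" using t n by simp
  finally show ?thesis by simp
qed

theorem mainTheorem2:
  shows "\<exists>c0 > (1::real). \<forall>c \<ge> c0. \<exists>K > (0::real). \<exists>k::nat.
    \<forall>\<^sub>F n in sequentially.
      \<forall>(t::real) (M :: (nat list, nat list) protocol measure) (C::nat).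
        0 < t \<longrightarrow> t \<le> real n / (ln (real n)) powr c \<longrightarrow>
        randomized_protocol M \<longrightarrow> distinguishes n t M \<longrightarrow> uses_at_most_bits M C \<longrightarrow>
        real C \<ge> K * ((real n)\<^sup>2 / t\<^sup>2) / (ln (real n)) ^ k"
proof (rule exI[of _ 2], intro conjI allI impI)
  fix c :: real assume c: "2 \<le> c"
  have "filterlim (\<lambda>n. ln (real n)) at_top sequentially"
    by (rule filterlim_compose[OF ln_at_top filterlim_real_sequentially])
  \<comment> \<open>Beyond this point \<open>ln n powr c\<close> is at least 1440000 as well, and
    the assumed upper bound on t yields \<open>1440000 * t \<le> n\<close>.\<close>
  then have "\<forall>\<^sub>F n in sequentially. 1440000 \<le> ln (real n)"
    by (simp add: filterlim_at_top)
  then have "\<forall>\<^sub>F n in sequentially. \<forall>t M C. 0 < t \<longrightarrow> t \<le> real n / (ln (real n)) powr c \<longrightarrow>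
        randomized_protocol M \<longrightarrow> distinguishes n t M \<longrightarrow> uses_at_most_bits M C \<longrightarrow>
        1 / 10 ^ 16 * ((real n)\<^sup>2 / t\<^sup>2) / (ln (real n)) ^ 0 \<le> real C"
    using eventually_ge_at_top[of 2]
  proof eventually_elim
    case (elim n)
    have "1440000 \<le> ln (real n) powr 1" using elim by simp
    also have "\<dots> \<le> ln (real n) powr c" using elim c by (intro powr_mono) auto
    finally have p: "1440000 \<le> ln (real n) powr c" .
    show ?case
    proof (intro allI impI)
      fix t M C
      assume t: "0 < t" "t \<le> real n / ln (real n) powr c"
        and M: "randomized_protocol M" "distinguishes n t M" "uses_at_most_bits M C"
      have "1440000 * t \<le> ln (real n) powr c * t" using p t by (intro mult_right_mono) auto
      also have "\<dots> \<le> n"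
      proof -
        have "0 < ln (real n) powr c" using p by linarith
        then show ?thesis using t by (simp add: pos_le_divide_eq mult.commute)
      qed
      finally have "real n ^ 2 / t ^ 2 / 10 ^ 16 \<le> C"
        using elim t M by (intro communication_bound) auto
      then show "1 / 10 ^ 16 * ((real n)\<^sup>2 / t\<^sup>2) / (ln (real n)) ^ 0 \<le> real C" by simp
    qed
  qed
  then show "\<exists>K > (0::real). \<exists>k::nat. \<forall>\<^sub>F n in sequentially.
      \<forall>(t::real) (M :: (nat list, nat list) protocol measure) (C::nat).
        0 < t \<longrightarrow> t \<le> real n / (ln (real n)) powr c \<longrightarrow>
        randomized_protocol M \<longrightarrow> distinguishes n t M \<longrightarrow> uses_at_most_bits M C \<longrightarrow>
        real C \<ge> K * ((real n)\<^sup>2 / t\<^sup>2) / (ln (real n)) ^ k"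
    by (intro exI[of _ "1 / 10 ^ 16"] conjI exI[of _ 0]) auto
qed simp

end
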